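(* Let $R$ be a finite commutative local ring with $2\in R^\times$, having a unique minimal (nonzero) ideal, with residue field $F_q$ of order $q$, and let $\lambda:R^+\to\mathbb C^\times$ be a primitive group homomorphism. Let $V$ be a free $R$-module of rank $2n$ ($n\ge1$) with a nondegenerate alternating form $\langle\ ,\ \rangle$, symplectic group $\mathrm{Sp}$, and symplectic basis $u_1,\dots,u_n,v_1,\dots,v_n$; let $M,N,\mathrm{Sp}_{M,N},\mathrm{Sp}^M,s,\mu,G(\lambda)$ be as defined in the context, and let $X$ be a complex vector space with basis $(e_v)_{v\in N}$. Suppose that $q>3$. Then there is one and only one group representation $W:\mathrm{Sp}\to\mathrm{GL}(X)$ such that $$W(g)e_v=\mu(\det g|_N)\,e_{gv},\quad v\in N,\ g\in \mathrm{Sp}_{M,N},$$ $$W(g)e_v=\lambda(\langle gv,v\rangle)\, e_{v},\quad v\in N,\ g\in\mathrm{Sp}^M,$$ $$W(s)e_v=G(\lambda)^{-n} \sum_{w\in N} \lambda\Big(-2\sum_{1\leq i\leq n} \langle u_i,w\rangle \langle u_i,v\rangle\Big) e_{w},\quad v\in N.$$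
   Context: A group homomorphism $\lambda:R^+\to\mathbb C^\times$ from the additive group of $R$ is primitive if its kernel contains no ideal of $R$ other than $(0)$. Let $d>0$ be defined by $|R|=q^d$. The homomorphism $\mu:R^\times\to\{1,-1\}$ is trivial if $d$ is even; if $d$ is odd, $\mu(r)=1$ when $r$ is a square in $R^\times$ and $\mu(r)=-1$ otherwise. The quadratic Gauss sum is $G(\lambda)=\sum_{r\in R}\lambda(r^2)$ (it is nonzero). The alternating form $\langle\ ,\ \rangle:V\times V\to R$ is nondegenerate in the sense that $V\to \mathrm{Hom}_R(V,R)$, $v\mapsto\langle v,-\rangle$, is an isomorphism. $\mathrm{Sp}=\mathrm{Sp}(2n,R)$ is the group of $R$-linear automorphisms of $V$ preserving the form. A basis $u_1,\dots,u_n,v_1,\dots,v_n$ is symplectic if $\langle u_i,v_j\rangle=\delta_{ij}$ and $\langle u_i,u_j\rangle=0=\langle v_i,v_j\rangle$ for all $i,j$. $M$ and $N$ are the $R$-spans of $u_1,\dots,u_n$ and of $v_1,\dots,v_n$ respectively. $\mathrm{Sp}_{M,N}=\{g\in\mathrm{Sp}: gM=M,\ gN=N\}$, $\mathrm{Sp}^M=\{g\in\mathrm{Sp}: gu=u\text{ for all }u\in M\}$, and $s\in\mathrm{Sp}$ is given by $u_i\mapsto v_i$, $v_i\mapsto -u_i$ for $1\le i\le n$. *)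

theory Defs
  imports "HOL-Algebra.Group" "HOL-Library.FuncSet" "Jordan_Normal_Form.Determinant"
begin

section \<open>Local rings, residue field, primitive characters\<close>

text \<open>
  Rings are types of class \<open>comm_ring_1\<close>; an ideal of such a ring is a submodule of the ring
  regarded as a module over itself. (The name \<open>module\<close> is qualified because
  HOL-Algebra has a locale of the same name.)
\<close>

definition ring_ideal :: "'r::comm_ring_1 set \<Rightarrow> bool" where
  "ring_ideal I \<longleftrightarrow> Modules.module.subspace ((*) :: 'r \<Rightarrow> 'r \<Rightarrow> 'r) I"

definition max_ideal :: "'r::comm_ring_1 set \<Rightarrow> bool" where
  "max_ideal I \<longleftrightarrow> ring_ideal I \<and> I \<noteq> UNIV \<and>
     (\<forall>J. ring_ideal J \<and> I \<subseteq> J \<longrightarrow> J = I \<or> J = UNIV)"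

definition min_ideal :: "'r::comm_ring_1 set \<Rightarrow> bool" where
  "min_ideal I \<longleftrightarrow> ring_ideal I \<and> I \<noteq> {0} \<and>
     (\<forall>J. ring_ideal J \<and> J \<subseteq> I \<longrightarrow> J = {0} \<or> J = I)"

text \<open>Only meaningful for local rings, where the maximal ideal is unique.\<close>

definition residue_field :: "'r::comm_ring_1 set set" where
  "residue_field = UNIV // {(x, y). x - y \<in> (THE I. max_ideal I)}"

definition additive_char :: "('r::comm_ring_1 \<Rightarrow> complex) \<Rightarrow> bool" where
  "additive_char lam \<longleftrightarrow>
     (\<forall>x. lam x \<noteq> 0) \<and> (\<forall>x y. lam (x + y) = lam x * lam y)"

definition primitive_char :: "('r::comm_ring_1 \<Rightarrow> complex) \<Rightarrow> bool" where
  "primitive_char lam \<longleftrightarrow> (\<forall>I. ring_ideal I \<and> I \<subseteq> {x. lam x = 1} \<longrightarrow> I = {0})"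

definition gauss_sum :: "('r::{finite, comm_ring_1} \<Rightarrow> complex) \<Rightarrow> complex" where
  "gauss_sum lam = (\<Sum>r\<in>UNIV. lam (r ^ 2))"

text \<open>
  For a finite local ring with residue field of order \<open>q\<close>, \<open>d\<close> is the unique exponent
  with \<open>|R| = q ^ d\<close>. The function is only used on units, and it takes values in \<open>{1, -1}\<close>.
\<close>

definition quad_char :: "'r::{finite, comm_ring_1} \<Rightarrow> complex" where
  "quad_char r =
     (let d = (THE d. d > 0 \<and> card (UNIV :: 'r set) = card (residue_field :: 'r set set) ^ d)
      in if even d \<or> (\<exists>t. t dvd 1 \<and> r = t ^ 2) then 1 else - 1)"


section \<open>Bases and determinants\<close>

definition basis_family ::
    "('r::comm_ring_1 \<Rightarrow> 'v::ab_group_add \<Rightarrow> 'v) \<Rightarrow> 'i set \<Rightarrow> ('i \<Rightarrow> 'v) \<Rightarrow> bool" where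
  "basis_family scale I b \<longleftrightarrow>
     inj_on b I \<and> \<not> Modules.module.dependent scale (b ` I) \<and>
     Modules.module.span scale (b ` I) = UNIV"

text \<open>
  The determinant of the restriction of \<open>f\<close> to the span of the independent family
  \<open>b 0, \<dots>, b (n - 1)\<close>, provided that \<open>f\<close> maps this span into itself: column \<open>j\<close> of the matrix
  consists of the coordinates of \<open>f (b j)\<close>.
\<close>

definition det_on_span ::
    "('r::comm_ring_1 \<Rightarrow> 'v::ab_group_add \<Rightarrow> 'v) \<Rightarrow> nat \<Rightarrow> (nat \<Rightarrow> 'v) \<Rightarrow> ('v \<Rightarrow> 'v) \<Rightarrow> 'r" where
  "det_on_span scale n b f =
     Determinant.det (mat n n (\<lambda>(i, j).
       Modules.module.representation scale (b ` {..<n}) (f (b j)) (b i)))"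


section \<open>Alternating forms and symplectic groups\<close>

definition alternating_form ::
    "('r::comm_ring_1 \<Rightarrow> 'v::ab_group_add \<Rightarrow> 'v) \<Rightarrow> ('v \<Rightarrow> 'v \<Rightarrow> 'r) \<Rightarrow> bool" where
  "alternating_form scale B \<longleftrightarrow>
     (\<forall>y. module_hom scale (*) (\<lambda>x. B x y)) \<and> (\<forall>x. module_hom scale (*) (B x)) \<and>
     (\<forall>x. B x x = 0)"

text \<open>
  For bilinear \<open>B\<close>, the map \<open>x \<mapsto> B x\<close> into the dual module is linear, so that it is an
  isomorphism if and only if it is bijective.
\<close>

definition nondegenerate_form ::
    "('r::comm_ring_1 \<Rightarrow> 'v::ab_group_add \<Rightarrow> 'v) \<Rightarrow> ('v \<Rightarrow> 'v \<Rightarrow> 'r) \<Rightarrow> bool" where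
  "nondegenerate_form scale B \<longleftrightarrow> bij_betw (\<lambda>x. B x) UNIV {f. module_hom scale (*) f}"

definition Sp ::
    "('r::comm_ring_1 \<Rightarrow> 'v::ab_group_add \<Rightarrow> 'v) \<Rightarrow> ('v \<Rightarrow> 'v \<Rightarrow> 'r) \<Rightarrow> ('v \<Rightarrow> 'v) monoid" where
  "Sp scale B =
     \<lparr>carrier = {g. module_hom scale scale g \<and> bij g \<and> (\<forall>x y. B (g x) (g y) = B x y)},
      mult = (\<circ>), one = id\<rparr>"

definition GL :: "(complex \<Rightarrow> 'x::ab_group_add \<Rightarrow> 'x) \<Rightarrow> ('x \<Rightarrow> 'x) monoid" where
  "GL scaleX =
     \<lparr>carrier = {f. Vector_Spaces.linear scaleX scaleX f \<and> bij f}, mult = (\<circ>), one = id\<rparr>"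

text \<open>The index set \<open>{1, \<dots>, n}\<close> is shifted to \<open>{0, \<dots>, n - 1}\<close>.\<close>

definition symplectic_basis ::
    "('r::comm_ring_1 \<Rightarrow> 'v::ab_group_add \<Rightarrow> 'v) \<Rightarrow> ('v \<Rightarrow> 'v \<Rightarrow> 'r) \<Rightarrow>
     nat \<Rightarrow> (nat \<Rightarrow> 'v) \<Rightarrow> (nat \<Rightarrow> 'v) \<Rightarrow> bool" where
  "symplectic_basis scale B n u v \<longleftrightarrow>
     basis_family scale ({..<n} <+> {..<n}) (case_sum u v) \<and>
     (\<forall>i<n. \<forall>j<n. B (u i) (v j) = (if i = j then 1 else 0) \<and>
                   B (u i) (u j) = 0 \<and> B (v i) (v j) = 0)"

definition Sp_stab ::
    "('r::comm_ring_1 \<Rightarrow> 'v::ab_group_add \<Rightarrow> 'v) \<Rightarrow> ('v \<Rightarrow> 'v \<Rightarrow> 'r) \<Rightarrow>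
     'v set \<Rightarrow> 'v set \<Rightarrow> ('v \<Rightarrow> 'v) set" where
  "Sp_stab scale B M N = {g \<in> carrier (Sp scale B). g ` M = M \<and> g ` N = N}"

definition Sp_fix ::
    "('r::comm_ring_1 \<Rightarrow> 'v::ab_group_add \<Rightarrow> 'v) \<Rightarrow> ('v \<Rightarrow> 'v \<Rightarrow> 'r) \<Rightarrow>
     'v set \<Rightarrow> ('v \<Rightarrow> 'v) set" where
  "Sp_fix scale B M = {g \<in> carrier (Sp scale B). \<forall>x\<in>M. g x = x}"

definition sp_flip ::
    "('r::comm_ring_1 \<Rightarrow> 'v::ab_group_add \<Rightarrow> 'v) \<Rightarrow> ('v \<Rightarrow> 'v \<Rightarrow> 'r) \<Rightarrow>
     nat \<Rightarrow> (nat \<Rightarrow> 'v) \<Rightarrow> (nat \<Rightarrow> 'v) \<Rightarrow> 'v \<Rightarrow> 'v" where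
  "sp_flip scale B n u v =
     (THE g. g \<in> carrier (Sp scale B) \<and> (\<forall>i<n. g (u i) = v i \<and> g (v i) = - u i))"

end

theory Submission
  imports Defs "HOL-Library.Product_Plus"
begin

text \<open>
  Uniqueness holds because the symplectic group is generated by \<open>s\<close> and the pointwise stabilizer
  \<open>Sp\<^sup>M\<close> of \<open>M\<close> (\<open>Sp_induct\<close>), on which \<open>W\<close> is prescribed.

  For existence, let the vectors of \<open>V\<close> act on the functions on \<open>N\<close> through the Schroedinger
  representation \<open>heis\<close> of the Heisenberg group. Each of the operators in the three formulas
  carries \<open>heis x\<close> to \<open>heis (g x)\<close> for its group element \<open>g\<close>. By Schur's lemma
  (\<open>heis_commutant\<close>) such an intertwiner is unique up to a scalar, and by generation there is one
  for every \<open>g\<close>. Thus only the scalars have to be chosen, multiplicatively and in agreement with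
  the formulas.

  The choice is made by a determinant. All operators concerned commute with \<open>e\<^sub>x \<mapsto> e\<^sub>-\<^sub>x\<close>. Let
  \<open>delta A\<close> be the determinant of \<open>A\<close> on the even functions divided by that on the odd functions.
  It is multiplicative, and as \<open>N\<close> has an odd number of elements and the origin is the only fixed
  point of \<open>x \<mapsto> - x\<close>, the two spaces differ by one in dimension, so that \<open>delta (c A) = c * delta A\<close>. The
  intertwiners with \<open>delta A = 1\<close> are therefore unique and closed under multiplication: they are
  the values of \<open>W\<close>. It remains to see that the operators in the formulas have \<open>delta = 1\<close>.

  \<^item> On diagonal even operators, such as those of \<open>Sp\<^sup>M\<close>, \<open>delta\<close> is the value at the origin
    (\<open>delta_diag\<close>).
  \<^item> For \<open>s\<close>, the relation \<open>t s t s t = s\<close> with a suitable \<open>t\<close> in \<open>Sp\<^sup>M\<close> holds for the operators as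
    well; this is where the factor \<open>G(\<lambda>)\<^sup>-\<^sup>n\<close> is needed (\<open>braid\<close>). It shows that \<open>delta\<close> of the
    Fourier transform is equal to its own square (\<open>delta_fourier\<close>).
  \<^item> On the permutation operators of the Levi subgroup, \<open>delta\<close> is a sign depending multiplicatively
    on the matrix of \<open>g\<close> on \<open>N\<close>. Elementary matrices are squares and have sign \<open>1\<close>. For a diagonal
    matrix with entries \<open>a\<^sub>i\<close>, the relation \<open>t s t' s t\<close> with forms \<open>a\<close> and \<open>a\<^sup>-\<^sup>1\<close> expresses the sign as
    a product of quotients \<open>G(a\<^sub>i \<lambda>) / G(\<lambda>)\<close>. Elimination over a local ring reduces everything to
    these two cases (\<open>unit_mat_sign_mat\<close>).

  The last case rests on \<open>G(t \<lambda>) = \<mu>(t) G(\<lambda>)\<close> for units \<open>t\<close> (\<open>gauss_sum_scaled\<close>). For a nonsquare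
  \<open>t\<close> the quadratic form \<open>r\<^sup>2\<close> on the ring is stripped of hyperbolic planes, which contribute no sign,
  until an anisotropic form over the residue field is left, each of whose diagonal entries
  contributes a factor \<open>- 1\<close>; their number has the parity of \<open>d\<close>.
\<close>

section \<open>Finite local rings\<close>

lemma ring_ideal_iff:
  "ring_ideal I \<longleftrightarrow> 0 \<in> I \<and> (\<forall>x\<in>I. \<forall>y\<in>I. x + y \<in> I) \<and> (\<forall>c. \<forall>x\<in>I. c * x \<in> I)"
proof -
  interpret Modules.module "(*) :: 'a \<Rightarrow> 'a \<Rightarrow> 'a"
    by unfold_locales (simp_all add: algebra_simps)
  show ?thesis
    unfolding ring_ideal_def subspace_def by blast
qed

lemma ring_ideal_zero: "ring_ideal I \<Longrightarrow> 0 \<in> I"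
  and ring_ideal_add: "ring_ideal I \<Longrightarrow> x \<in> I \<Longrightarrow> y \<in> I \<Longrightarrow> x + y \<in> I"
  and ring_ideal_mult: "ring_ideal I \<Longrightarrow> x \<in> I \<Longrightarrow> c * x \<in> I"
  by (simp_all add: ring_ideal_iff)

lemma ring_ideal_UNIV: "ring_ideal UNIV"
  by (simp add: ring_ideal_iff)

lemma ring_ideal_principal: "ring_ideal (range (\<lambda>r. r * x))"
  unfolding ring_ideal_iff
proof (intro conjI ballI allI)
  show "0 \<in> range (\<lambda>r. r * x)" by (rule range_eqI[of _ _ 0]) simp
  fix a b c assume "a \<in> range (\<lambda>r. r * x)"
  then obtain r where a: "a = r * x" by blast
  show "c * a \<in> range (\<lambda>r. r * x)" by (rule range_eqI[of _ _ "c * r"]) (simp add: a mult.assoc)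
  assume "b \<in> range (\<lambda>r. r * x)"
  then obtain s where "b = s * x" by blast
  with a show "a + b \<in> range (\<lambda>r. r * x)" by (intro range_eqI[of _ _ "r + s"]) (simp add: distrib_right)
qed

lemma ring_ideal_annihilator_in:
  "ring_ideal I \<Longrightarrow> ring_ideal {y \<in> I. x * y = 0}"
  by (auto simp: ring_ideal_iff distrib_left mult.left_commute)

lemma ring_ideal_mult_image: "ring_ideal I \<Longrightarrow> ring_ideal ((\<lambda>y. x * y) ` I)"
  unfolding ring_ideal_iff
proof (intro conjI ballI allI; (elim conjE)?)
  assume "0 \<in> I" then show "0 \<in> (*) x ` I" by (intro image_eqI[of _ _ 0]) auto
next
  fix a b assume "a \<in> (*) x ` I" "b \<in> (*) x ` I" "\<forall>x\<in>I. \<forall>y\<in>I. x + y \<in> I"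
  then show "a + b \<in> (*) x ` I" by (auto simp: distrib_left[symmetric])
next
  fix a c assume "a \<in> (*) x ` I" "\<forall>c. \<forall>x\<in>I. c * x \<in> I"
  then show "c * a \<in> (*) x ` I" by (auto simp: mult.left_commute[of c])
qed

lemma card_additive_fibres:
  fixes f :: "'a::ab_group_add \<Rightarrow> 'b::ab_group_add"
  assumes "finite I" and sub: "\<And>x y. x \<in> I \<Longrightarrow> y \<in> I \<Longrightarrow> x - y \<in> I"
    and add: "\<And>x y. x \<in> I \<Longrightarrow> y \<in> I \<Longrightarrow> f (x - y) = f x - f y"
    and b: "b \<in> f ` I"
  shows "card {x \<in> I. f x = b} = card {x \<in> I. f x = 0}"
proof -
  obtain a where a: "a \<in> I" "b = f a" using b by blast
  have 0: "0 \<in> I" using sub[OF a(1) a(1)] by simp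
  have neg: "- x \<in> I" if "x \<in> I" for x using sub[OF 0 that] by simp
  have plus: "x + y \<in> I" if "x \<in> I" "y \<in> I" for x y using sub[OF that(1) neg[OF that(2)]] by simp
  have fplus: "f (x + y) = f x + f y" if "x \<in> I" "y \<in> I" for x y
    using add[OF plus[OF that] that(2)] by simp
  have "bij_betw (\<lambda>x. x + a) {x \<in> I. f x = 0} {x \<in> I. f x = b}"
  proof (rule bij_betw_byWitness[where f' = "\<lambda>x. x - a"])
    show "(\<lambda>x. x + a) ` {x \<in> I. f x = 0} \<subseteq> {x \<in> I. f x = b}"
      using plus[OF _ a(1)] fplus[OF _ a(1)] a(2) by (simp add: image_subset_iff)
    show "(\<lambda>x. x - a) ` {x \<in> I. f x = b} \<subseteq> {x \<in> I. f x = 0}"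
      using sub[OF _ a(1)] add[OF _ a(1)] a(2) by (simp add: image_subset_iff)
  qed simp_all
  then show ?thesis by (rule bij_betw_same_card[symmetric])
qed

lemma card_additive_image:
  fixes f :: "'a::ab_group_add \<Rightarrow> 'b::ab_group_add"
  assumes fin: "finite I" and sub: "\<And>x y. x \<in> I \<Longrightarrow> y \<in> I \<Longrightarrow> x - y \<in> I"
    and add: "\<And>x y. x \<in> I \<Longrightarrow> y \<in> I \<Longrightarrow> f (x - y) = f x - f y"
  shows "card I = card (f ` I) * card {x \<in> I. f x = 0}"
proof -
  have "card I = (\<Sum>x\<in>I. 1)" by simp
  also have "\<dots> = (\<Sum>b\<in>f ` I. \<Sum>x\<in>{x\<in>I. f x = b}. 1)"
    by (rule sum.group[symmetric]) (use fin in auto)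
  also have "\<dots> = (\<Sum>b\<in>f ` I. card {x \<in> I. f x = 0})"
  proof (rule sum.cong[OF refl])
    fix b assume "b \<in> f ` I"
    from card_additive_fibres[of I f, OF fin sub add this]
    show "(\<Sum>x\<in>{x\<in>I. f x = b}. 1) = card {x \<in> I. f x = 0}" by simp
  qed
  finally show ?thesis by simp
qed

lemma ring_ideal_diff: "ring_ideal I \<Longrightarrow> x \<in> I \<Longrightarrow> y \<in> I \<Longrightarrow> x - y \<in> I"
proof -
  assume I: "ring_ideal I" "x \<in> I" "y \<in> I"
  have "x + (- 1) * y \<in> I" by (rule ring_ideal_add[OF I(1,2) ring_ideal_mult[OF I(1,3)]])
  then show ?thesis by simp
qed

lemma unit_inverse_cancel: "1 = z * w \<Longrightarrow> x * w * z = (x :: 'r::comm_ring_1)"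
proof -
  assume w: "1 = z * w"
  have "x * w * z = x * (z * w)" by (simp add: ac_simps)
  then show ?thesis by (simp flip: w)
qed

lemma unit_mult_iff: "(a * b :: 'r::comm_ring_1) dvd 1 \<longleftrightarrow> a dvd 1 \<and> b dvd 1"
proof
  assume "a * b dvd 1"
  then show "a dvd 1 \<and> b dvd 1" using dvd_mult_left dvd_mult_right by blast
next
  assume "a dvd 1 \<and> b dvd 1"
  then show "a * b dvd 1" using mult_dvd_mono[of a 1 b 1] by simp
qed

lemma unit_mult_cancel: "(a :: 'r::comm_ring_1) dvd 1 \<Longrightarrow> a * x = a * y \<Longrightarrow> x = y"
proof -
  assume "a dvd 1" and e: "a * x = a * y"
  then obtain b where b: "1 = a * b" by blast
  have "z = (a * z) * b" for z using unit_inverse_cancel[OF b, of z] by (simp add: ac_simps)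
  from this[of x] this[of y] show ?thesis by (simp add: e)
qed

locale finite_local_ring =
  fixes lam :: "'r::{finite, comm_ring_1} \<Rightarrow> complex"
  assumes local_ring: "\<exists>!I :: 'r set. max_ideal I"
    and two_unit: "(2 :: 'r) dvd 1"
    and min_ideal: "\<exists>!I :: 'r set. min_ideal I"
    and lam: "additive_char lam" "primitive_char lam"
begin

definition nonunits :: "'r set" where "nonunits = {z. \<not> z dvd 1}"

lemma max_ideal_eq: "max_ideal I \<Longrightarrow> I = nonunits" for I :: "'r set"
proof -
  assume I: "max_ideal I"
  have uniq: "J = I" if "max_ideal J" for J :: "'r set" using local_ring I that by (elim ex1E) metis
  show ?thesis
  proof (intro equalityI subsetI)
    fix z assume z: "z \<in> I"
    show "z \<in> nonunits"
    proof (rule ccontr)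
      assume "z \<notin> nonunits"
      then obtain w where w: "1 = z * w" unfolding nonunits_def by blast
      have "x \<in> I" for x
      proof -
        have "(x * w) * z \<in> I" using I z ring_ideal_mult[of I z "x * w"] by (simp add: max_ideal_def)
        then show ?thesis by (simp add: unit_inverse_cancel[OF w])
      qed
      then show False using I unfolding max_ideal_def by blast
    qed
  next
    fix z assume z: "z \<in> nonunits"
    let ?A = "{J :: 'r set. ring_ideal J \<and> J \<noteq> UNIV}"
    have "range (\<lambda>r. r * z) \<in> ?A"
    proof -
      have "1 \<notin> range (\<lambda>r. r * z)" using z unfolding nonunits_def
        by (auto simp: dvd_def mult.commute)
      then show ?thesis using ring_ideal_principal by blast
    qed
    then obtain J where J: "J \<in> ?A" "range (\<lambda>r. r * z) \<subseteq> J" "\<forall>K\<in>?A. J \<subseteq> K \<longrightarrow> J = K"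
      using finite_has_maximal2[of ?A "range (\<lambda>r. r * z)"] by auto
    have "max_ideal J" unfolding max_ideal_def using J by blast
    then have "J = I" by (rule uniq)
    moreover have "z \<in> J" using J(2) by (metis mult_1_left rangeI subsetD)
    ultimately show "z \<in> I" by simp
  qed
qed

lemma max_ideal_nonunits: "max_ideal nonunits"
  using local_ring max_ideal_eq by blast

lemma the_max_ideal: "(THE I :: 'r set. max_ideal I) = nonunits"
  by (rule the_equality[where P = max_ideal, OF max_ideal_nonunits max_ideal_eq])

lemma ring_ideal_nonunits: "ring_ideal nonunits"
  using max_ideal_nonunits unfolding max_ideal_def by blast

lemma unit_add_nonunit: "a dvd 1 \<Longrightarrow> \<not> b dvd 1 \<Longrightarrow> a + b dvd (1 :: 'r)"
proof (rule ccontr)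
  assume a: "a dvd 1" "\<not> b dvd 1" "\<not> a + b dvd (1 :: 'r)"
  then have "a + b - b \<in> nonunits"
    by (intro ring_ideal_diff[OF ring_ideal_nonunits]) (auto simp: nonunits_def)
  then show False using a by (simp add: nonunits_def)
qed

lemma nonunit_add: "\<not> a dvd 1 \<Longrightarrow> \<not> b dvd 1 \<Longrightarrow> \<not> a + b dvd (1 :: 'r)"
  using ring_ideal_add[OF ring_ideal_nonunits, of a b] by (simp add: nonunits_def)

lemma nonunit_sum: "finite A \<Longrightarrow> (\<And>i. i \<in> A \<Longrightarrow> \<not> f i dvd (1 :: 'r)) \<Longrightarrow> \<not> sum f A dvd 1"
  by (induction A rule: finite_induct) (auto simp: nonunit_add)

lemma one_minus_nonunit: "\<not> z dvd 1 \<Longrightarrow> 1 - z dvd (1 :: 'r)"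
  using unit_add_nonunit[of 1 "- z"] by simp

text \<open>This stands in for Nakayama's lemma: an ideal \<open>I\<close> with \<open>z I = I\<close> for a nonunit \<open>z\<close> is zero.\<close>

lemma nonunit_nilpotent: "\<not> z dvd 1 \<Longrightarrow> \<exists>k. z ^ k = (0 :: 'r)"
proof -
  assume z: "\<not> z dvd 1"
  have "\<exists>a b. z ^ a = z ^ b \<and> a < b"
  proof (rule ccontr)
    assume *: "\<not> ?thesis"
    have "inj (\<lambda>k. z ^ k)"
      by (rule linorder_injI) (use * in blast)
    then have "finite (UNIV :: nat set)" by (rule finite_imageD[rotated]) (rule finite)
    then show False by simp
  qed
  then obtain a b :: nat where ab: "z ^ a = z ^ b" "a < b" by blast
  have "z ^ b = z ^ (a + (b - a))" using ab(2) by simp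
  then have "z ^ b = z ^ a * z ^ (b - a)" unfolding power_add .
  then have "z ^ a = z ^ a * z ^ (b - a)" unfolding ab(1)[symmetric] .
  then have e: "(1 - z ^ (b - a)) * z ^ a = (1 - z ^ (b - a)) * 0"
    unfolding left_diff_distrib mult_1_left mult_zero_right by (simp add: mult.commute)
  have "\<not> z ^ (b - a) dvd 1"
  proof
    assume "z ^ (b - a) dvd 1"
    moreover have "z dvd z ^ (b - a)" using ab(2) by (intro dvd_power) simp
    ultimately show False using z dvd_trans by blast
  qed
  then show ?thesis using unit_mult_cancel[OF one_minus_nonunit e] by blast
qed

definition residue_card :: nat where "residue_card = card (residue_field :: 'r set set)"

lemma card_residue: "card (UNIV :: 'r set) = residue_card * card nonunits"
proof -
  let ?r = "{(x, y). x - y \<in> nonunits}"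
  have eq: "equiv UNIV ?r"
  proof (rule equivI)
    show "refl ?r" using ring_ideal_nonunits by (auto simp: refl_on_def ring_ideal_iff)
    show "sym ?r"
    proof (rule symI)
      fix x y assume "(x, y) \<in> ?r"
      then have "(-1) * (x - y) \<in> nonunits" using ring_ideal_mult[OF ring_ideal_nonunits, of "x - y" "-1"] by simp
      then show "(y, x) \<in> ?r" by simp
    qed
    show "trans ?r"
    proof (rule transI)
      fix x y z assume "(x, y) \<in> ?r" "(y, z) \<in> ?r"
      then have "(x - y) + (y - z) \<in> nonunits" using ring_ideal_add[OF ring_ideal_nonunits, of "x - y" "y - z"] by simp
      then show "(x, z) \<in> ?r" by simp
    qed
  qed auto
  have c: "card X = card nonunits" if XQ: "X \<in> UNIV // ?r" for X
  proof -
    obtain x where X: "X = ?r `` {x}" using XQ by (rule quotientE)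
    have "bij_betw (\<lambda>z. x - z) nonunits X"
      by (rule bij_betw_byWitness[where f' = "\<lambda>z. x - z"]) (auto simp: X)
    then show ?thesis by (metis bij_betw_same_card)
  qed
  have "card (UNIV :: 'r set) = card (\<Union> (UNIV // ?r))" using Union_quotient[OF eq] by simp
  also have "\<dots> = (\<Sum>X\<in>UNIV // ?r. card X)"
    by (rule card_Union_disjoint)
       (use quotient_disj[OF eq] in \<open>auto simp: pairwise_def disjnt_def intro: finite_subset\<close>)
  also have "\<dots> = residue_card * card nonunits"
    unfolding residue_card_def residue_field_def the_max_ideal using c by simp
  finally show ?thesis .
qed

lemma residue_card_gt_1: "residue_card > 1"
proof -
  have "nonunits \<subset> UNIV" using max_ideal_nonunits unfolding max_ideal_def by blast
  then have "card nonunits < card (UNIV :: 'r set)" by (simp add: psubset_card_mono)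
  then have "residue_card * card nonunits > 1 * card nonunits" using card_residue by simp
  then show ?thesis by (simp only: mult_less_cancel2)
qed

lemma min_ideal_socle:
  assumes c: "c \<noteq> (0 :: 'r)" "\<And>z. z \<in> nonunits \<Longrightarrow> z * c = 0"
  shows "min_ideal (range (\<lambda>r. r * c))"
  unfolding min_ideal_def
proof (intro conjI allI impI)
  show "ring_ideal (range (\<lambda>r. r * c))" by (rule ring_ideal_principal)
  have "c \<in> range (\<lambda>r. r * c)" by (rule range_eqI[of _ _ 1]) simp
  then show "range (\<lambda>r. r * c) \<noteq> {0}" using c(1) by blast
  fix J assume J: "ring_ideal J \<and> J \<subseteq> range (\<lambda>r. r * c)"
  show "J = {0} \<or> J = range (\<lambda>r. r * c)"
  proof (cases "J = {0}")
    case False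
    then obtain r where r: "r * c \<in> J" "r * c \<noteq> 0" using J ring_ideal_zero[of J] by blast
    then have "r dvd 1" using c(2)[of r] unfolding nonunits_def by blast
    then obtain s where s: "1 = r * s" by blast
    have "x * c \<in> J" for x
    proof -
      have "(x * s) * (r * c) \<in> J" using J r ring_ideal_mult[of J "r * c" "x * s"] by simp
      then have "(x * s * r) * c \<in> J" by (simp add: mult.assoc)
      then show ?thesis by (simp add: unit_inverse_cancel[OF s])
    qed
    then show ?thesis using J by blast
  qed simp
qed

text \<open>
  The elements killed by the maximal ideal form a line over the residue field, because each of
  them that is not zero generates a minimal ideal and there is only one of those.
\<close>

lemma socle_generated:
  assumes "c \<noteq> (0 :: 'r)" "\<And>z. z \<in> nonunits \<Longrightarrow> z * c = 0"
    and d: "\<And>z. z \<in> nonunits \<Longrightarrow> z * d = 0"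
  shows "\<exists>r. d = r * c"
proof (cases "d = 0")
  case False
  then have "range (\<lambda>r. r * d) = range (\<lambda>r. r * c)"
    using min_ideal_socle[OF assms(1,2)] min_ideal_socle[OF _ d] min_ideal by blast
  moreover have "d \<in> range (\<lambda>r. r * d)" by (rule range_eqI[of _ _ 1]) simp
  ultimately show ?thesis by blast
qed (auto intro: exI[of _ 0])

lemma annihilator_socle:
  assumes "c \<noteq> (0 :: 'r)" "\<And>z. z \<in> nonunits \<Longrightarrow> z * c = 0"
  shows "{r. r * c = 0} = nonunits"
proof -
  have "r \<in> nonunits" if "r * c = 0" for r
  proof (rule ccontr)
    assume "r \<notin> nonunits"
    then have "c = 0" using unit_mult_cancel[of r c 0] that by (simp add: nonunits_def)
    then show False using assms by simp
  qed
  then show ?thesis using assms by blast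
qed

text \<open>
  Multiplication by a nonunit \<open>z\<close> splits \<open>I\<close> into two smaller ideals, the image \<open>z I\<close> and the
  annihilator of \<open>z\<close> in \<open>I\<close>. This stops at ideals killed by all nonunits; they lie in the minimal
  ideal, so that they have one or \<open>residue_card\<close> elements.
\<close>

lemma card_ideal: "ring_ideal I \<Longrightarrow> \<exists>k. card I = residue_card ^ k" for I :: "'r set"
proof (induction "card I" arbitrary: I rule: less_induct)
  case less
  note I = less.prems
  have I0: "0 \<in> I" using I by (rule ring_ideal_zero)
  show ?case
  proof (cases "\<forall>z\<in>nonunits. \<forall>y\<in>I. z * y = 0")
    case True
    show ?thesis
    proof (cases "I = {0}")
      case True then show ?thesis by (auto intro: exI[of _ 0])
    next
      case False
      then obtain c where c: "c \<in> I" "c \<noteq> 0" using I0 by blast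
      have kill: "z * y = 0" if "z \<in> nonunits" "y \<in> I" for z y using True that by blast
      have Ic: "I = range (\<lambda>r. r * c)"
        using socle_generated[OF c(2) kill[OF _ c(1)] kill] ring_ideal_mult[OF I c(1)] by blast
      have "card (UNIV :: 'r set) = card I * card {r \<in> UNIV. r * c = 0}"
        unfolding Ic by (rule card_additive_image) (auto simp: algebra_simps)
      then have "residue_card * card nonunits = card I * card nonunits"
        using card_residue annihilator_socle[OF c(2) kill[OF _ c(1)]] by simp
      moreover have "card nonunits \<noteq> 0" using ring_ideal_nonunits by (auto simp: ring_ideal_iff)
      ultimately show ?thesis by (intro exI[of _ 1]) simp
    qed
  next
    case False
    then obtain z y where z: "z \<in> nonunits" "y \<in> I" "z * y \<noteq> 0" by blast
    let ?A = "{y \<in> I. z * y = 0}" and ?B = "(\<lambda>y. z * y) ` I"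
    have "card I = card ?B * card ?A"
      by (rule card_additive_image) (auto simp: ring_ideal_diff[OF I] algebra_simps)
    moreover have "card ?A < card I" using z by (intro psubset_card_mono) auto
    moreover have "card ?B < card I"
    proof (rule psubset_card_mono)
      have "?B \<subseteq> I" using ring_ideal_mult[OF I] by blast
      moreover have "?B \<noteq> I"
      proof
        assume B: "?B = I"
        have pow: "(\<lambda>y. z ^ k * y) ` I = I" for k
        proof (induction k)
          case (Suc k)
          have "(\<lambda>y. z ^ Suc k * y) ` I = (\<lambda>y. z ^ k * y) ` ((\<lambda>y. z * y) ` I)"
            by (simp add: image_image algebra_simps)
          then show ?case using B Suc by simp
        qed simp
        obtain k where "z ^ k = 0" using nonunit_nilpotent[of z] z(1) by (auto simp: nonunits_def)
        then have "I \<subseteq> {0}" using pow[of k] by auto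
        then show False using z by auto
      qed
      ultimately show "?B \<subset> I" by blast
    qed simp
    ultimately show ?thesis
      using less.hyps[of ?A] less.hyps[of ?B] ring_ideal_annihilator_in[OF I] ring_ideal_mult_image[OF I]
      by (metis power_add)
  qed
qed

end

section \<open>Quadratic Gauss sums\<close>

context finite_local_ring begin

lemma lam_add: "lam (x + y) = lam x * lam y"
  using lam(1) unfolding additive_char_def by blast

lemma lam_zero [simp]: "lam 0 = 1"
proof -
  have "lam 0 * lam 0 = lam 0 * 1" using lam_add[of 0 0] by simp
  moreover have "lam 0 \<noteq> 0" using lam(1) unfolding additive_char_def by blast
  ultimately show ?thesis by (auto simp only: mult_cancel_left)
qed

lemma lam_nz: "lam x \<noteq> 0"
  using lam(1) unfolding additive_char_def by blast

lemma lam_minus: "lam x * lam (- x) = 1"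
  using lam_add[of x "- x"] by simp

lemma lam_sum: "finite A \<Longrightarrow> lam (sum f A) = (\<Prod>i\<in>A. lam (f i))"
  by (induction A rule: finite_induct) (simp_all add: lam_add)

lemma two_cancel: "2 * x = 0 \<longleftrightarrow> x = (0 :: 'r)"
  using unit_mult_cancel[OF two_unit, of x 0] by auto

lemma sum_shift_ideal:
  fixes f :: "'r \<Rightarrow> complex"
  assumes I: "ring_ideal I" and a: "a \<in> I"
  shows "(\<Sum>y\<in>I. f (y + a)) = (\<Sum>y\<in>I. f y)"
  by (rule sum.reindex_bij_witness[where i = "\<lambda>y. y - a" and j = "\<lambda>y. y + a"])
     (use a in \<open>simp_all add: ring_ideal_diff[OF I] ring_ideal_add[OF I]\<close>)

text \<open>
  If \<open>lam\<close> is trivial on the ideal \<open>z I\<close>, then primitivity gives \<open>z I = 0\<close>. Otherwise a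
  translation multiplies the sum by a number different from \<open>1\<close>.
\<close>

lemma sum_lam_ideal:
  assumes I: "ring_ideal I"
  shows "(\<Sum>y\<in>I. lam (z * y)) = (if \<forall>y\<in>I. z * y = 0 then of_nat (card I) else 0)"
proof (cases "\<forall>y\<in>I. z * y = 0")
  case True then show ?thesis by simp
next
  case False
  have "\<exists>a\<in>I. lam (z * a) \<noteq> 1"
  proof (rule ccontr)
    assume "\<not> ?thesis"
    then have "(\<lambda>y. z * y) ` I \<subseteq> {x. lam x = 1}" by blast
    then have "(\<lambda>y. z * y) ` I = {0}"
      using lam(2) ring_ideal_mult_image[OF I, of z] unfolding primitive_char_def by blast
    then show False using False by blast
  qed
  then obtain a where a: "a \<in> I" "lam (z * a) \<noteq> 1" by blast
  let ?S = "\<Sum>y\<in>I. lam (z * y)"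
  have "?S = (\<Sum>y\<in>I. lam (z * (y + a)))" using sum_shift_ideal[OF I a(1), of "\<lambda>y. lam (z * y)"] by simp
  also have "\<dots> = ?S * lam (z * a)" by (simp add: distrib_left lam_add sum_distrib_right)
  finally have "?S * (lam (z * a) - 1) = 0" by (simp add: algebra_simps)
  then have "?S = 0" using a(2) by simp
  then show ?thesis unfolding if_not_P[OF False] .
qed

lemma sum_lam: "(\<Sum>r\<in>UNIV. lam (r * y)) = (if y = 0 then of_nat (card (UNIV :: 'r set)) else 0)"
proof -
  have "(\<forall>r. y * r = 0) \<longleftrightarrow> y = 0" by (metis mult_1_right mult_zero_left)
  then show ?thesis using sum_lam_ideal[OF ring_ideal_UNIV, of y] by (simp add: mult.commute)
qed

definition squares :: "'r set" where "squares = (\<lambda>w. w ^ 2) ` {u. u dvd 1}"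

lemma square_unit: "w dvd 1 \<Longrightarrow> w ^ 2 dvd (1 :: 'r)"
  by (simp add: power2_eq_square unit_mult_iff)

lemma two_square_roots:
  assumes "s dvd (1 :: 'r)"
  shows "{w. w dvd 1 \<and> w ^ 2 = s ^ 2} = {s, - s}" and "s \<noteq> - s"
proof -
  show "s \<noteq> - s"
  proof
    assume "s = - s"
    then have "2 * s = 0" by (metis add.right_inverse mult_2)
    then have "s = 0" using two_cancel by simp
    then show False using assms by simp
  qed
  show "{w. w dvd 1 \<and> w ^ 2 = s ^ 2} = {s, - s}"
  proof (intro equalityI subsetI)
    fix w assume "w \<in> {w. w dvd 1 \<and> w ^ 2 = s ^ 2}"
    then have w: "w dvd 1" "w ^ 2 - s ^ 2 = 0" by simp_all
    have w2: "(w - s) * (w + s) = 0" using w(2) by (simp add: power2_eq_square algebra_simps)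
    have "(w - s) + (w + s) = 2 * w" by simp
    then have "(w - s) + (w + s) dvd 1"
      using unit_mult_iff[of 2 w] two_unit w(1) by argo
    then consider "w - s dvd 1" | "w + s dvd 1" using nonunit_add by blast
    then show "w \<in> {s, - s}"
    proof cases
      case 1
      then have "w + s = 0" using unit_mult_cancel[of "w - s" "w + s" 0] w2 by simp
      then show ?thesis by (simp add: eq_neg_iff_add_eq_0)
    next
      case 2
      then have "w - s = 0" using unit_mult_cancel[of "w + s" "w - s" 0] w2 by (simp add: mult.commute)
      then show ?thesis by simp
    qed
  next
    fix w assume "w \<in> {s, - s}"
    then show "w \<in> {w. w dvd 1 \<and> w ^ 2 = s ^ 2}" using assms by auto
  qed
qed

lemma sum_over_squares:
  fixes f :: "'r \<Rightarrow> 'c::comm_semiring_1"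
  shows "(\<Sum>w | w dvd 1. f (w ^ 2)) = 2 * (\<Sum>s\<in>squares. f s)"
proof -
  have "(\<Sum>w | w dvd 1. f (w ^ 2)) = (\<Sum>s\<in>squares. \<Sum>w | w \<in> {w. w dvd 1} \<and> w ^ 2 = s. f (w ^ 2))"
    unfolding squares_def by (rule sum.image_gen) simp
  also have "\<dots> = (\<Sum>s\<in>squares. 2 * f s)"
  proof (rule sum.cong[OF refl])
    fix s assume "s \<in> squares"
    then obtain v where v: "v dvd 1" "s = v ^ 2" unfolding squares_def by blast
    have "{w. w \<in> {w. w dvd 1} \<and> w ^ 2 = s} = {v, - v}"
      unfolding mem_Collect_eq v(2) by (rule two_square_roots(1)[OF v(1)])
    then have "(\<Sum>w | w \<in> {w. w dvd 1} \<and> w ^ 2 = s. f (w ^ 2)) = (\<Sum>w\<in>{v, - v}. f (w ^ 2))"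
      by (rule sum.cong[OF _ refl])
    also have "\<dots> = f (v ^ 2) + f ((- v) ^ 2)"
      using two_square_roots(2)[OF v(1)] by (subst sum.insert) simp_all
    finally show "(\<Sum>w | w \<in> {w. w dvd 1} \<and> w ^ 2 = s. f (w ^ 2)) = 2 * f s"
      by (simp add: v(2) mult_2)
  qed
  finally show ?thesis by (simp add: sum_distrib_left)
qed

lemma squares_subset: "squares \<subseteq> {u. u dvd 1}"
  unfolding squares_def using square_unit by blast

lemma squares_mult: "s \<in> squares \<Longrightarrow> s' \<in> squares \<Longrightarrow> s * s' \<in> squares"
  unfolding squares_def
proof (elim imageE)
  fix w w' assume "w \<in> {u. u dvd 1}" "w' \<in> {u. u dvd 1}" "s = w ^ 2" "s' = w' ^ 2"
  then show "s * s' \<in> (\<lambda>w. w ^ 2) ` {u. u dvd 1}"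
    by (intro image_eqI[of _ _ "w * w'"]) (simp_all add: power_mult_distrib unit_mult_iff)
qed

lemma squares_cancel:
  assumes "t * s \<in> squares" "s \<in> squares"
  shows "t \<in> squares"
proof -
  obtain w where w: "w dvd 1" "s = w ^ 2" using assms(2) unfolding squares_def by blast
  then obtain v where v: "1 = w * v" by blast
  have "v dvd 1" using v by (intro dvdI[of _ _ w]) (simp add: mult.commute)
  then have "v ^ 2 \<in> squares" unfolding squares_def by blast
  then have "t * s * v ^ 2 \<in> squares" using assms(1) by (rule squares_mult[rotated])
  moreover have "t * s * v ^ 2 = t * (w * v) ^ 2" using w(2) by (simp add: power_mult_distrib mult.assoc)
  ultimately show ?thesis by (simp flip: v)
qed

text \<open>A unit has no square root or exactly two, so the squares are a subgroup of index two.\<close>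

lemma units_decomposition:
  assumes t: "t dvd 1" "t \<notin> squares"
  shows "squares \<inter> (\<lambda>s. t * s) ` squares = {}"
    and "squares \<union> (\<lambda>s. t * s) ` squares = {u. u dvd 1}"
proof -
  show disj: "squares \<inter> (\<lambda>s. t * s) ` squares = {}"
    using t(2) squares_cancel by blast
  have inj: "inj_on (\<lambda>s. t * s) squares"
    by (rule inj_onI) (rule unit_mult_cancel[OF t(1)])
  have "card {u :: 'r. u dvd 1} = 2 * card squares"
    using sum_over_squares[of "\<lambda>_. 1 :: nat"] by simp
  also have "\<dots> = card (squares \<union> (\<lambda>s. t * s) ` squares)"
    using disj by (simp add: card_Un_disjoint card_image[OF inj])
  finally show "squares \<union> (\<lambda>s. t * s) ` squares = {u. u dvd 1}"
    using squares_subset t(1) by (intro card_subset_eq) (auto simp: unit_mult_iff)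
qed

text \<open>
  As \<open>c\<close> is killed by the maximal ideal, these are multiples of Gauss sums of the residue field, and
  the sign is the classical one: squares and nonsquares together run through the units, over
  which a nontrivial character of the field sums to a value that the term \<open>r = 0\<close> cancels.
\<close>

lemma sum_lam_square_nonsquare:
  assumes t: "t dvd 1" "t \<notin> squares" and c: "c \<noteq> 0" "\<And>z. z \<in> nonunits \<Longrightarrow> z * c = 0"
  shows "(\<Sum>r\<in>UNIV. lam (t * r ^ 2 * c)) = - (\<Sum>r\<in>UNIV. lam (r ^ 2 * c))"
proof -
  have nu: "r * x * c = 0" "x * r * c = 0" if "r \<in> nonunits" for r x
    using c(2)[OF that] by (simp_all add: mult.assoc mult.left_commute[of r])
  have split: "(\<Sum>r\<in>UNIV. f r) = (\<Sum>r | r dvd 1. f r) + (\<Sum>r\<in>nonunits. f r)" for f :: "'r \<Rightarrow> complex"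
  proof -
    have "UNIV = {r :: 'r. r dvd 1} \<union> nonunits" by (auto simp: nonunits_def)
    moreover have "{r :: 'r. r dvd 1} \<inter> nonunits = {}" by (auto simp: nonunits_def)
    ultimately show ?thesis by (metis finite sum.union_disjoint)
  qed
  have inj: "inj_on (\<lambda>s. t * s) squares"
    by (rule inj_onI) (rule unit_mult_cancel[OF t(1)])
  have "(\<Sum>r\<in>UNIV. lam (t * r ^ 2 * c)) + (\<Sum>r\<in>UNIV. lam (r ^ 2 * c))
     = (\<Sum>w | w dvd 1. lam (t * w ^ 2 * c)) + (\<Sum>w | w dvd 1. lam (w ^ 2 * c)) + 2 * (\<Sum>r\<in>nonunits. 1)"
    by (simp add: split nu power2_eq_square mult.assoc[symmetric])
  also have "(\<Sum>w | w dvd 1. lam (w ^ 2 * c)) = 2 * (\<Sum>s\<in>squares. lam (s * c))"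
    using sum_over_squares[of "\<lambda>s. lam (s * c)"] by simp
  also have "(\<Sum>w | w dvd 1. lam (t * w ^ 2 * c)) = 2 * (\<Sum>s\<in>squares. lam (t * s * c))"
    using sum_over_squares[of "\<lambda>s. lam (t * s * c)"] by simp
  also have "(\<Sum>s\<in>squares. lam (t * s * c)) = (\<Sum>s\<in>(\<lambda>s. t * s) ` squares. lam (s * c))"
    by (simp add: sum.reindex[OF inj])
  also have "2 * \<dots> + 2 * (\<Sum>s\<in>squares. lam (s * c)) = 2 * (\<Sum>u | u dvd 1. lam (u * c))"
    unfolding units_decomposition(2)[OF t, symmetric]
    using units_decomposition(1)[OF t] by (subst sum.union_disjoint) (auto simp: algebra_simps)
  also have "\<dots> + 2 * (\<Sum>r\<in>nonunits. 1) = 2 * (\<Sum>u\<in>UNIV. lam (u * c))"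
    by (simp add: split c(2))
  also have "\<dots> = 0" using sum_lam c(1) by simp
  finally show ?thesis by (simp add: add_eq_0_iff2)
qed

text \<open>
  The sign \<open>G(t lam) / G(lam)\<close> is found by induction on ideals, which requires Gauss sums over all
  ideals \<open>L\<close> of the ring, not just over the ring itself.
\<close>

definition qsum :: "'r \<Rightarrow> 'r set \<Rightarrow> complex" where "qsum t L = (\<Sum>x\<in>L. lam (t * x ^ 2))"

text \<open>The radical of the bilinear form \<open>x y\<close> on \<open>L\<close> (and not the radical of the ideal \<open>L\<close>).\<close>

definition rad :: "'r set \<Rightarrow> 'r set" where "rad L = {x \<in> L. \<forall>y\<in>L. x * y = 0}"

lemma ring_ideal_rad: "ring_ideal L \<Longrightarrow> ring_ideal (rad L)"
  by (auto simp: ring_ideal_iff rad_def distrib_right mult.assoc)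

text \<open>
  This is \<open>\<bar>qsum 1 L\<bar>\<^sup>2\<close>. Since \<open>card L * card (rad L)\<close> is a power of the order of the residue field
  whose exponent has the parity of the length of \<open>L / rad L\<close>, the sum itself remembers this parity.
\<close>

lemma qsum_prod:
  assumes L: "ring_ideal L"
  shows "qsum 1 L * qsum (- 1) L = of_nat (card L * card (rad L))"
proof -
  have "qsum 1 L * qsum (- 1) L = (\<Sum>y\<in>L. \<Sum>x\<in>L. lam (x ^ 2) * lam (- (y ^ 2)))"
    unfolding qsum_def by (subst sum.swap) (simp add: sum_product)
  also have "\<dots> = (\<Sum>y\<in>L. \<Sum>x\<in>L. lam ((x + y) ^ 2) * lam (- (y ^ 2)))"
    by (intro sum.cong refl sum_shift_ideal[OF L, symmetric, of _ "\<lambda>x. lam (x ^ 2) * lam (- (y ^ 2))" for y])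
  also have "\<dots> = (\<Sum>y\<in>L. \<Sum>x\<in>L. lam (x ^ 2) * lam (2 * x * y))"
    by (intro sum.cong refl) (simp add: lam_add[symmetric] power2_sum)
  also have "\<dots> = (\<Sum>x\<in>L. lam (x ^ 2) * (\<Sum>y\<in>L. lam (2 * x * y)))"
    by (subst sum.swap) (simp add: sum_distrib_left)
  also have "\<dots> = (\<Sum>x\<in>L. if x \<in> rad L then of_nat (card L) else 0)"
  proof (intro sum.cong refl)
    fix x assume x: "x \<in> L"
    have "(\<forall>y\<in>L. 2 * x * y = 0) \<longleftrightarrow> x \<in> rad L"
      using x two_cancel by (simp add: rad_def mult.assoc)
    moreover have "x ^ 2 = 0" if "x \<in> rad L" using that by (simp add: rad_def power2_eq_square)
    ultimately show "lam (x ^ 2) * (\<Sum>y\<in>L. lam (2 * x * y)) = (if x \<in> rad L then of_nat (card L) else 0)"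
      by (simp add: sum_lam_ideal[OF L])
  qed
  also have "\<dots> = (\<Sum>x\<in>rad L. of_nat (card L))"
  proof -
    have "L \<inter> rad L = rad L" by (auto simp: rad_def)
    then show ?thesis using sum.inter_restrict[of L "\<lambda>_. of_nat (card L) :: complex" "rad L"] by simp
  qed
  finally show ?thesis by simp
qed

text \<open>
  Averaging over the translations by multiples of the isotropic vector \<open>x\<close> removes all terms that
  are not orthogonal to \<open>x\<close>.
\<close>

lemma qsum_isotropic:
  assumes L: "ring_ideal L" and x: "x \<in> L" "x * x = 0" and t: "t dvd 1"
  shows "qsum t L = qsum t {y \<in> L. x * y = 0}"
proof -
  let ?R = "of_nat (card (UNIV :: 'r set)) :: complex"
  have "?R * qsum t L = (\<Sum>r\<in>UNIV. \<Sum>y\<in>L. lam (t * (y + r * x) ^ 2))"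
  proof -
    have "(\<Sum>y\<in>L. lam (t * (y + r * x) ^ 2)) = qsum t L" for r
      unfolding qsum_def by (rule sum_shift_ideal[OF L ring_ideal_mult[OF L x(1)], of "\<lambda>y. lam (t * y ^ 2)"])
    then show ?thesis by simp
  qed
  also have "\<dots> = (\<Sum>y\<in>L. \<Sum>r\<in>UNIV. lam (t * (y + r * x) ^ 2))" by (rule sum.swap)
  also have "\<dots> = (\<Sum>y\<in>L. lam (t * y ^ 2) * (\<Sum>r\<in>UNIV. lam (r * (2 * (t * (x * y))))))"
  proof (intro sum.cong refl)
    fix y
    have "(y + r * x) ^ 2 = y ^ 2 + (2 * (r * (x * y)) + r * r * (x * x))" for r
      by (simp add: power2_eq_square algebra_simps)
    then have eq: "t * (y + r * x) ^ 2 = t * (y ^ 2 + 2 * (r * (x * y)))" for r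
      by (simp add: x(2))
    have "t * (y + r * x) ^ 2 = t * y ^ 2 + r * (2 * (t * (x * y)))" for r
      unfolding eq by (simp add: algebra_simps)
    then show "(\<Sum>r\<in>UNIV. lam (t * (y + r * x) ^ 2)) = lam (t * y ^ 2) * (\<Sum>r\<in>UNIV. lam (r * (2 * (t * (x * y)))))"
      by (simp add: lam_add sum_distrib_left)
  qed
  also have "\<dots> = (\<Sum>y\<in>L. if x * y = 0 then lam (t * y ^ 2) * ?R else 0)"
  proof (intro sum.cong refl)
    fix y
    have "2 * (t * (x * y)) = 0 \<longleftrightarrow> x * y = 0"
      unfolding two_cancel using unit_mult_cancel[OF t, of "x * y" 0] by fastforce
    then show "lam (t * y ^ 2) * (\<Sum>r\<in>UNIV. lam (r * (2 * (t * (x * y))))) = (if x * y = 0 then lam (t * y ^ 2) * ?R else 0)"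
      by (simp add: sum_lam)
  qed
  also have "\<dots> = (\<Sum>y\<in>{y \<in> L. x * y = 0}. lam (t * y ^ 2) * ?R)"
    by (rule sum.inter_filter[symmetric]) simp
  also have "\<dots> = ?R * qsum t {y \<in> L. x * y = 0}"
    by (simp add: qsum_def sum_distrib_left mult.commute)
  finally show ?thesis by simp
qed

text \<open>
  If every \<open>x y\<close> is a multiple of \<open>x x\<close>, then \<open>L\<close> is the sum of \<open>R x\<close> and the orthogonal complement
  of \<open>x\<close> in \<open>L\<close>; the map \<open>(r, y) \<mapsto> r x + y\<close> is \<open>K\<close>-to-one.
\<close>

lemma qsum_split:
  assumes L: "ring_ideal L" and x: "x \<in> L" and c: "c = x * x"
    and ex: "\<And>y. y \<in> L \<Longrightarrow> \<exists>r. x * y = r * c"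
  defines "L' \<equiv> {y \<in> L. x * y = 0}"
  obtains K where "card (UNIV :: 'r set) * card L' = card L * K" "K \<noteq> 0"
    "\<And>t. of_nat K * qsum t L = (\<Sum>r\<in>UNIV. lam (t * r ^ 2 * c)) * qsum t L'"
proof -
  let ?I = "(UNIV :: 'r set) \<times> L'"
  let ?f = "\<lambda>(r, y). r * x + y"
  have L': "ring_ideal L'" unfolding L'_def by (rule ring_ideal_annihilator_in[OF L])
  have fin: "finite ?I" by simp
  have sub: "p - p' \<in> ?I" if "p \<in> ?I" "p' \<in> ?I" for p p'
    using that ring_ideal_diff[OF L'] by (cases p; cases p') auto
  have add: "?f (p - p') = ?f p - ?f p'" for p p'
    by (cases p; cases p') (simp add: algebra_simps)
  have img: "?f ` ?I = L"
  proof (intro equalityI subsetI)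
    fix z assume "z \<in> ?f ` ?I"
    then show "z \<in> L" using ring_ideal_add[OF L ring_ideal_mult[OF L x]] by (auto simp: L'_def)
  next
    fix z assume z: "z \<in> L"
    then obtain r where r: "x * z = r * c" using ex by blast
    have "z - r * x \<in> L'"
      unfolding L'_def using ring_ideal_diff[OF L z ring_ideal_mult[OF L x]] r c by (simp add: algebra_simps)
    then show "z \<in> ?f ` ?I" by (intro image_eqI[of _ _ "(r, z - r * x)"]) auto
  qed
  let ?K = "card {p \<in> ?I. ?f p = 0}"
  show ?thesis
  proof (rule that[of ?K])
    show "card (UNIV :: 'r set) * card L' = card L * ?K"
      using card_additive_image[of ?I ?f, OF fin sub add] unfolding img by (simp add: card_cartesian_product)
    have "(0, 0) \<in> {p \<in> ?I. ?f p = 0}" using ring_ideal_zero[OF L'] by simp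
    then show "?K \<noteq> 0" using fin by (metis (no_types, lifting) card_0_eq empty_iff finite_Collect_conjI finite_code mem_Collect_eq)
    fix t
    have "(\<Sum>r\<in>UNIV. lam (t * r ^ 2 * c)) * qsum t L' = (\<Sum>p\<in>?I. lam (t * (?f p) ^ 2))"
    proof -
      have "lam (t * (r * x + y) ^ 2) = lam (t * r ^ 2 * c) * lam (t * y ^ 2)" if "y \<in> L'" for r y
      proof -
        have "(r * x + y) ^ 2 = r ^ 2 * c + 2 * r * (x * y) + y ^ 2"
          unfolding c by (simp add: power2_eq_square algebra_simps)
        then have "t * (r * x + y) ^ 2 = t * r ^ 2 * c + t * y ^ 2"
          using that by (simp add: L'_def distrib_left mult.assoc)
        then show ?thesis by (simp add: lam_add)
      qed
      then show ?thesis
        unfolding qsum_def sum_product sum.cartesian_product by (intro sum.cong) auto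
    qed
    also have "\<dots> = (\<Sum>z\<in>L. \<Sum>p | p \<in> ?I \<and> ?f p = z. lam (t * (?f p) ^ 2))"
      using sum.image_gen[OF fin, of "\<lambda>p. lam (t * (?f p) ^ 2)" ?f] unfolding img .
    also have "\<dots> = (\<Sum>z\<in>L. of_nat ?K * lam (t * z ^ 2))"
    proof (intro sum.cong refl)
      fix z assume "z \<in> L"
      then have "card {p \<in> ?I. ?f p = z} = ?K"
        using card_additive_fibres[of ?I ?f, OF fin sub add] unfolding img by blast
      moreover have "(\<Sum>p | p \<in> ?I \<and> ?f p = z. lam (t * (?f p) ^ 2)) = (\<Sum>p\<in>{p \<in> ?I. ?f p = z}. lam (t * z ^ 2))"
        by (intro sum.cong) auto
      ultimately show "(\<Sum>p | p \<in> ?I \<and> ?f p = z. lam (t * (?f p) ^ 2)) = of_nat ?K * lam (t * z ^ 2)"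
        by simp
    qed
    finally show "of_nat ?K * qsum t L = (\<Sum>r\<in>UNIV. lam (t * r ^ 2 * c)) * qsum t L'"
      by (simp add: qsum_def sum_distrib_left)
  qed
qed

lemma socle_gauss_prod:
  assumes c: "c \<noteq> 0" "\<And>z. z \<in> nonunits \<Longrightarrow> z * c = 0"
  shows "of_nat (card (UNIV :: 'r set) * card nonunits) =
    (\<Sum>r\<in>UNIV. lam (1 * r ^ 2 * c)) * (\<Sum>r\<in>UNIV. lam (- 1 * r ^ 2 * c))"
proof -
  have "(\<Sum>r\<in>UNIV. lam (1 * r ^ 2 * c)) * (\<Sum>r\<in>UNIV. lam (- 1 * r ^ 2 * c))
     = (\<Sum>s\<in>UNIV. \<Sum>r\<in>UNIV. lam (r ^ 2 * c) * lam (- (s ^ 2 * c)))"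
    by (subst sum.swap) (simp add: sum_product)
  also have "\<dots> = (\<Sum>s\<in>UNIV. \<Sum>r\<in>UNIV. lam ((r + s) ^ 2 * c) * lam (- (s ^ 2 * c)))"
    by (intro sum.cong refl sum_shift_ideal[OF ring_ideal_UNIV UNIV_I, symmetric, of "\<lambda>x. lam (x ^ 2 * c) * lam (- (y ^ 2 * c))" for y])
  also have "\<dots> = (\<Sum>s\<in>UNIV. \<Sum>r\<in>UNIV. lam (r ^ 2 * c) * lam (s * (2 * (r * c))))"
    by (intro sum.cong refl) (simp add: lam_add[symmetric] power2_sum algebra_simps)
  also have "\<dots> = (\<Sum>r\<in>UNIV. lam (r ^ 2 * c) * (\<Sum>s\<in>UNIV. lam (s * (2 * (r * c)))))"
    by (subst sum.swap) (simp add: sum_distrib_left)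
  also have "\<dots> = (\<Sum>r\<in>UNIV. if r \<in> nonunits then of_nat (card (UNIV :: 'r set)) else 0)"
  proof (intro sum.cong refl)
    fix r
    have "2 * (r * c) = 0 \<longleftrightarrow> r \<in> nonunits" using annihilator_socle[OF c] two_cancel by blast
    moreover have "r ^ 2 * c = 0" if "r \<in> nonunits" using c(2)[OF that] by (simp add: power2_eq_square mult.assoc)
    ultimately show "lam (r ^ 2 * c) * (\<Sum>s\<in>UNIV. lam (s * (2 * (r * c)))) = (if r \<in> nonunits then of_nat (card (UNIV :: 'r set)) else 0)"
      by (simp add: sum_lam)
  qed
  also have "\<dots> = of_nat (card (UNIV :: 'r set) * card nonunits)"
    by (simp add: sum.If_cases)
  finally show ?thesis by (rule sym)
qed

text \<open>
  The exponent \<open>k\<close> has the parity of the length of \<open>L / rad L\<close>. Passing to the complement of an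
  isotropic vector outside the radical changes neither sum, and hence not the parity. If there is
  no such vector, then a line over the residue field splits off; it changes the parity and, by
  \<open>sum_lam_square_nonsquare\<close>, contributes one sign.
\<close>

lemma qsum_nonsquare:
  assumes t: "t dvd 1" "t \<notin> squares"
  shows "ring_ideal L \<Longrightarrow> card L * card (rad L) = residue_card ^ k \<Longrightarrow> qsum t L = (- 1) ^ k * qsum 1 L"
proof (induction "card L" arbitrary: L k rule: less_induct)
  case less
  note L = less.prems(1)
  have one: "(1 :: 'r) dvd 1" by simp
  have smaller: "card {y \<in> L. x * y = 0} < card L" if "x \<in> L" "x \<notin> rad L" for x
    using that by (intro psubset_card_mono) (auto simp: rad_def)
  show ?case
  proof (cases "\<exists>x\<in>L. x * x = 0 \<and> x \<notin> rad L")
    case True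
    then obtain x where x: "x \<in> L" "x * x = 0" "x \<notin> rad L" by blast
    let ?L = "{y \<in> L. x * y = 0}"
    have L': "ring_ideal ?L" by (rule ring_ideal_annihilator_in[OF L])
    have S: "qsum s L = qsum s ?L" if "s dvd 1" for s by (rule qsum_isotropic[OF L x(1,2) that])
    have "(of_nat (card ?L * card (rad ?L)) :: complex) = of_nat (card L * card (rad L))"
      unfolding qsum_prod[OF L, symmetric] qsum_prod[OF L', symmetric] by (simp add: S)
    then have "card ?L * card (rad ?L) = residue_card ^ k" using less.prems(2) by (simp only: of_nat_eq_iff)
    then have "qsum t ?L = (- 1) ^ k * qsum 1 ?L" by (rule less.hyps[OF smaller[OF x(1,3)] L'])
    then show ?thesis by (simp only: S[OF t(1)] S[OF one])
  next
    case iso: False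
    show ?thesis
    proof (cases "L = rad L")
      case True
      have "x * x = 0" if "x \<in> L" for x
        using that True unfolding rad_def by blast
      then have S: "qsum s L = of_nat (card L)" for s by (simp add: qsum_def power2_eq_square)
      obtain j where j: "card L = residue_card ^ j" using card_ideal[OF L] by blast
      then have "residue_card ^ k = residue_card ^ (j + j)" using less.prems(2) True by (simp add: power_add)
      then have "k = j + j" using residue_card_gt_1 by (simp only: power_inject_exp)
      then show ?thesis by (simp add: S)
    next
      case False
      let ?A = "L - rad L"
      have "?A \<noteq> {}" using False by (auto simp: rad_def)
      \<comment> \<open>The generator of a minimal submodule above the radical: its square lies in the minimal ideal.\<close>
      then obtain x where "is_arg_min (\<lambda>y. card (range (\<lambda>r. r * y))) (\<lambda>y. y \<in> ?A) x"
        using ex_is_arg_min_if_finite[of ?A "\<lambda>y. card (range (\<lambda>r. r * y))"] by auto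
      then have x: "x \<in> ?A" "\<And>y. y \<in> ?A \<Longrightarrow> \<not> card (range (\<lambda>r. r * y)) < card (range (\<lambda>r. r * x))"
        unfolding is_arg_min_def by blast+
      define c where "c = x * x"
      have zx: "z * x \<in> rad L" if z: "z \<in> nonunits" for z
      proof (rule ccontr)
        assume "z * x \<notin> rad L"
        then have "z * x \<in> ?A" using x(1) ring_ideal_mult[OF L] by blast
        moreover have "range (\<lambda>r. r * (z * x)) \<subset> range (\<lambda>r. r * x)"
        proof
          show "range (\<lambda>r. r * (z * x)) \<subseteq> range (\<lambda>r. r * x)" by (auto simp flip: mult.assoc)
          show "range (\<lambda>r. r * (z * x)) \<noteq> range (\<lambda>r. r * x)"
          proof
            assume e: "range (\<lambda>r. r * (z * x)) = range (\<lambda>r. r * x)"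
            have "x \<in> range (\<lambda>r. r * x)" by (rule range_eqI[of _ _ 1]) simp
            then obtain r where r: "x = r * (z * x)" using e by blast
            then have "(1 - r * z) * x = (1 - r * z) * 0"
              unfolding left_diff_distrib mult_zero_right mult_1_left mult.assoc right_minus_eq .
            moreover have "\<not> r * z dvd 1" using z by (simp add: nonunits_def unit_mult_iff)
            ultimately have "x = 0" using unit_mult_cancel[OF one_minus_nonunit] by blast
            then show False using x(1) ring_ideal_zero[OF ring_ideal_rad[OF L]] by simp
          qed
        qed
        ultimately show False using x(2)[of "z * x"] psubset_card_mono[of "range (\<lambda>r. r * x)"] by simp
      qed
      have zxy: "z * (x * y) = 0" if "z \<in> nonunits" "y \<in> L" for z y
        using zx[OF that(1)] that(2) by (simp add: rad_def mult.assoc)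
      have xL: "x \<in> L" using x(1) by blast
      have c0: "c \<noteq> 0" unfolding c_def using iso x(1) by blast
      have zc: "z * c = 0" if "z \<in> nonunits" for z using zxy[OF that xL] by (simp add: c_def)
      have ex: "\<exists>r. x * y = r * c" if "y \<in> L" for y
        by (rule socle_generated[OF c0 zc]) (use zxy that in auto)
      let ?L = "{y \<in> L. x * y = 0}"
      have L': "ring_ideal ?L" by (rule ring_ideal_annihilator_in[OF L])
      obtain K where K: "card (UNIV :: 'r set) * card ?L = card L * K" "K \<noteq> 0"
        "\<And>t. of_nat K * qsum t L = (\<Sum>r\<in>UNIV. lam (t * r ^ 2 * c)) * qsum t ?L"
        using qsum_split[OF L xL c_def ex] by blast
      obtain a where a: "card L = residue_card ^ a" using card_ideal[OF L] by blast
      obtain e where e: "card nonunits = residue_card ^ e" using card_ideal[OF ring_ideal_nonunits] by blast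
      have R: "card (UNIV :: 'r set) = residue_card ^ (e + 1)" using card_residue e by simp
      obtain b b' where b: "card ?L = residue_card ^ b" and b': "card (rad ?L) = residue_card ^ b'"
        using card_ideal[OF L'] card_ideal[OF ring_ideal_rad[OF L']] by blast
      have IH: "qsum t ?L = (- 1) ^ (b + b') * qsum 1 ?L"
        by (rule less.hyps[OF smaller L']) (use x(1) b b' in \<open>simp_all add: power_add\<close>)
      have "of_nat K * qsum t L = - ((- 1) ^ (b + b')) * (of_nat K * qsum 1 L)"
        unfolding K(3) IH using sum_lam_square_nonsquare[OF t c0 zc] by simp
      also have "\<dots> = of_nat K * ((- 1) ^ (b + b' + 1) * qsum 1 L)" by simp
      finally have main: "qsum t L = (- 1) ^ (b + b' + 1) * qsum 1 L"
        using K(2) by (simp only: mult_cancel_left of_nat_eq_0_iff) simp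
      have arrange: "(f * s) * (g * s') = (f * g) * (s * s')" for f g s s' :: complex
        by (simp add: ac_simps)
      have "of_nat K * of_nat K * (qsum 1 L * qsum (- 1) L) = (of_nat K * qsum 1 L) * (of_nat K * qsum (- 1) L)"
        by simp
      also have "\<dots> = of_nat (card (UNIV :: 'r set) * card nonunits) * (qsum 1 ?L * qsum (- 1) ?L)"
        unfolding K(3) by (rule trans[OF arrange arg_cong[where f = "\<lambda>w. w * _", OF socle_gauss_prod[OF c0 zc, symmetric]]])
      finally have "(of_nat (K * K * residue_card ^ k) :: complex) = of_nat (residue_card ^ (e + 1) * residue_card ^ e * (residue_card ^ b * residue_card ^ b'))"
        unfolding qsum_prod[OF L] qsum_prod[OF L'] less.prems(2) b b' R e by simp
      then have "K * K * residue_card ^ k = residue_card ^ (e + 1) * residue_card ^ e * (residue_card ^ b * residue_card ^ b')" by (simp only: of_nat_eq_iff)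
      moreover have "(residue_card ^ a * K) * (residue_card ^ a * K) * residue_card ^ k = residue_card ^ a * residue_card ^ a * (K * K * residue_card ^ k)"
        by (simp only: ac_simps)
      moreover have "residue_card ^ a * K = residue_card ^ (e + 1) * residue_card ^ b" using K(1) unfolding a b R by simp
      ultimately have "residue_card ^ ((e + 1) + b + ((e + 1) + b) + k) = residue_card ^ (a + a + ((e + 1) + e + (b + b')))"
        by (simp only: power_add)
      then have "(e + 1) + b + ((e + 1) + b) + k = a + a + ((e + 1) + e + (b + b'))"
        using residue_card_gt_1 by (simp only: power_inject_exp)
      then have "even (b + b' + 1) \<longleftrightarrow> even k" by presburger
      then have "(- 1 :: complex) ^ (b + b' + 1) = (- 1) ^ k" by (simp only: uminus_power_if power_one)
      then show ?thesis using main by simp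
    qed
  qed
qed

lemma rad_UNIV: "rad UNIV = {0}"
  unfolding rad_def by (auto dest: spec[of _ 1])

lemma gauss_sum_neq_0: "gauss_sum lam \<noteq> 0"
proof
  assume "gauss_sum lam = 0"
  then have "qsum 1 UNIV = 0" by (simp add: qsum_def gauss_sum_def)
  then show False using qsum_prod[OF ring_ideal_UNIV] by (simp add: rad_UNIV)
qed

lemma square_iff: "(\<exists>t. t dvd 1 \<and> r = t ^ 2) \<longleftrightarrow> r \<in> squares"
  unfolding squares_def by blast

lemma quad_char_eq:
  assumes "card (UNIV :: 'r set) = residue_card ^ d"
  shows "quad_char (r :: 'r) = (if even d \<or> r \<in> squares then 1 else - 1)"
proof -
  have "d \<noteq> 0"
  proof
    assume "d = 0"
    then have "card (UNIV :: 'r set) = 1" using assms by simp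
    then have "(0 :: 'r) = 1" by (metis UNIV_I card_1_singletonE singletonD)
    then show False by simp
  qed
  then have "(THE d. d > 0 \<and> card (UNIV :: 'r set) = card (residue_field :: 'r set set) ^ d) = d"
    using assms residue_card_gt_1 unfolding residue_card_def by (intro the_equality) (auto simp: power_inject_exp)
  then show ?thesis unfolding quad_char_def square_iff Let_def by simp
qed

lemma quad_char_cases: "quad_char (r :: 'r) = 1 \<or> quad_char r = - 1"
  unfolding quad_char_def Let_def by auto

text \<open>
  For a nonsquare \<open>t\<close> this is the case \<open>L = R\<close> of \<open>qsum_nonsquare\<close>, whose radical is zero, so that
  the exponent is the \<open>d\<close> with \<open>\<bar>R\<bar> = q\<^sup>d\<close>.
\<close>

lemma gauss_sum_scaled:
  assumes t: "t dvd 1"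
  shows "(\<Sum>r\<in>UNIV. lam (t * r ^ 2)) = quad_char t * gauss_sum lam"
proof -
  obtain d where d: "card (UNIV :: 'r set) = residue_card ^ d" using card_ideal[OF ring_ideal_UNIV] by blast
  show ?thesis
  proof (cases "t \<in> squares")
    case True
    then obtain w where w: "w dvd 1" "t = w ^ 2" unfolding squares_def by blast
    have "inj (\<lambda>r. w * r)" by (rule injI) (rule unit_mult_cancel[OF w(1)])
    then have bij: "bij_betw (\<lambda>r. w * r) UNIV UNIV" by (simp add: bij_betw_def finite_UNIV_inj_surj)
    have "(\<Sum>r\<in>UNIV. lam (t * r ^ 2)) = gauss_sum lam"
      using sum.reindex_bij_betw[OF bij, of "\<lambda>r. lam (r ^ 2)"]
      by (simp add: gauss_sum_def w(2) power_mult_distrib)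
    then show ?thesis using True by (simp add: quad_char_eq[OF d])
  next
    case False
    have "qsum t UNIV = (- 1) ^ d * qsum 1 UNIV"
      by (rule qsum_nonsquare[OF t False ring_ideal_UNIV]) (simp add: rad_UNIV d)
    then show ?thesis using False by (simp add: qsum_def gauss_sum_def quad_char_eq[OF d])
  qed
qed

lemma quad_char_mult:
  assumes "a dvd (1 :: 'r)" "b dvd 1"
  shows "quad_char (a * b) = quad_char a * quad_char b"
proof -
  obtain d where d: "card (UNIV :: 'r set) = residue_card ^ d" using card_ideal[OF ring_ideal_UNIV] by blast
  have 1: "a * b \<in> squares" if ns: "a \<notin> squares" "b \<notin> squares"
  proof -
    have "a ^ 2 \<in> squares" using assms unfolding squares_def by blast
    obtain s where s: "b = a * s" "s \<in> squares"
      using units_decomposition(2)[OF assms(1) ns(1)] assms(2) ns(2) by blast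
    show ?thesis using squares_mult[OF \<open>a ^ 2 \<in> squares\<close> s(2)] by (simp add: s(1) power2_eq_square mult.assoc)
  qed
  have 2: "a * b \<in> squares \<longleftrightarrow> a \<in> squares" if "b \<in> squares"
    using squares_cancel squares_mult that by blast
  have 3: "a * b \<in> squares \<longleftrightarrow> b \<in> squares" if "a \<in> squares"
    using squares_cancel[of b a] squares_mult[of a b] that by (auto simp: mult.commute)
  show ?thesis using 1 2 3 by (auto simp: quad_char_eq[OF d])
qed

lemma quad_char_1: "quad_char (1 :: 'r) = 1"
  unfolding quad_char_def Let_def by (auto intro: exI[of _ 1])

end

section \<open>Generators of the symplectic group\<close>

locale symplectic_space = finite_local_ring lam
  for lam :: "'r::{finite, comm_ring_1} \<Rightarrow> complex" +
  fixes scale :: "'r \<Rightarrow> 'v::ab_group_add \<Rightarrow> 'v" (infixr "*s" 75)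
    and B :: "'v \<Rightarrow> 'v \<Rightarrow> 'r"
    and n :: nat
    and u v :: "nat \<Rightarrow> 'v"
  assumes module_scale: "Modules.module scale"
    and alternating: "alternating_form scale B"
    and basis: "symplectic_basis scale B n u v"
begin

sublocale Modules.module scale by (rule module_scale)

definition M :: "'v set" where "M = span (u ` {..<n})"
definition N :: "'v set" where "N = span (v ` {..<n})"

abbreviation "Spc \<equiv> carrier (Sp scale B)"

lemma hom_left: "module_hom scale (*) (\<lambda>x. B x y)"
  and hom_right: "module_hom scale (*) (B x)"
  and B_self [simp]: "B x x = 0"
  using alternating unfolding alternating_form_def by blast+

lemmas B_add_left = module_hom.add[OF hom_left]
  and B_add_right = module_hom.add[OF hom_right]
  and B_scale_left = module_hom.scale[OF hom_left]
  and B_scale_right = module_hom.scale[OF hom_right]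
  and B_zero_left [simp] = module_hom.zero[OF hom_left]
  and B_zero_right [simp] = module_hom.zero[OF hom_right]
  and B_minus_left = module_hom.neg[OF hom_left]
  and B_minus_right = module_hom.neg[OF hom_right]
  and B_diff_left = module_hom.diff[OF hom_left]
  and B_diff_right = module_hom.diff[OF hom_right]
  and B_sum_left = module_hom.sum[OF hom_left]
  and B_sum_right = module_hom.sum[OF hom_right]

lemmas B_linear = B_add_left B_add_right B_scale_left B_scale_right B_minus_left B_minus_right
  B_diff_left B_diff_right

lemma B_skew: "B x y = - B y x"
proof -
  have "B (x + y) (x + y) = B x x + B x y + (B y x + B y y)"
    by (simp only: B_add_left B_add_right add_ac)
  then have "B x y + B y x = 0" by simp
  then show ?thesis by (simp add: eq_neg_iff_add_eq_0)
qed

lemma B_uv: "i < n \<Longrightarrow> j < n \<Longrightarrow> B (u i) (v j) = (if i = j then 1 else 0)"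
  and B_uu: "i < n \<Longrightarrow> j < n \<Longrightarrow> B (u i) (u j) = 0"
  and B_vv: "i < n \<Longrightarrow> j < n \<Longrightarrow> B (v i) (v j) = 0"
  using basis unfolding symplectic_basis_def by blast+

definition prM :: "'v \<Rightarrow> 'v" where "prM x = (\<Sum>i<n. B x (v i) *s u i)"
definition prN :: "'v \<Rightarrow> 'v" where "prN x = (\<Sum>i<n. B (u i) x *s v i)"

lemma prM_add: "prM (x + y) = prM x + prM y"
  by (simp add: prM_def B_linear scale_left_distrib sum.distrib)

lemma prN_add: "prN (x + y) = prN x + prN y"
  by (simp add: prN_def B_linear scale_left_distrib sum.distrib)

lemma prM_scale: "prM (a *s x) = a *s prM x"
  by (simp add: prM_def B_linear scale_sum_right)

lemma prN_scale: "prN (a *s x) = a *s prN x"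
  by (simp add: prN_def B_linear scale_sum_right)

lemma sum_delta_scale:
  "j < n \<Longrightarrow> (\<And>i. i < n \<Longrightarrow> f i = (if i = j then 1 else 0)) \<Longrightarrow> (\<Sum>i<n. f i *s w i) = w j"
proof -
  assume j: "j < n" and f: "\<And>i. i < n \<Longrightarrow> f i = (if i = j then 1 else 0)"
  have "(\<Sum>i<n. f i *s w i) = (\<Sum>i<n. if i = j then w i else 0)"
    by (rule sum.cong) (auto simp: f)
  then show ?thesis using j by simp
qed

lemma decomp: "x = prM x + prN x"
proof -
  let ?A = "{x. x = prM x + prN x}"
  have "subspace ?A"
  proof (rule subspaceI)
    show "0 \<in> ?A" by (simp add: prM_def prN_def)
    fix x y c assume x: "x \<in> ?A" and y: "y \<in> ?A"
    have "prM (x + y) + prN (x + y) = (prM x + prN x) + (prM y + prN y)"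
      by (simp add: prM_add prN_add algebra_simps)
    then show "x + y \<in> ?A" using x y by simp
    have "prM (c *s x) + prN (c *s x) = c *s (prM x + prN x)"
      by (simp add: prM_scale prN_scale scale_right_distrib)
    then show "c *s x \<in> ?A" using x by simp
  qed
  moreover have "u j \<in> ?A" if "j < n" for j
  proof -
    have "prM (u j) = u j" unfolding prM_def by (rule sum_delta_scale) (use that B_uv in auto)
    moreover have "prN (u j) = 0" unfolding prN_def using that by (simp add: B_uu)
    ultimately show ?thesis by simp
  qed
  moreover have "v j \<in> ?A" if "j < n" for j
  proof -
    have "prN (v j) = v j" unfolding prN_def by (rule sum_delta_scale) (use that B_uv in auto)
    moreover have "prM (v j) = 0" unfolding prM_def using that by (simp add: B_vv)
    ultimately show ?thesis by simp
  qed
  ultimately have "span (case_sum u v ` ({..<n} <+> {..<n})) \<subseteq> ?A"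
    by (intro span_minimal) auto
  then show ?thesis using basis unfolding symplectic_basis_def basis_family_def by blast
qed

lemma prM_in [simp]: "prM x \<in> M"
  unfolding M_def prM_def by (intro span_sum span_scale span_base) auto

lemma prN_in [simp]: "prN x \<in> N"
  unfolding N_def prN_def by (intro span_sum span_scale span_base) auto

lemma subspace_M: "subspace M" and subspace_N: "subspace N"
  by (simp_all add: M_def N_def)

lemma N_zero [simp]: "0 \<in> N"
  and N_add: "x \<in> N \<Longrightarrow> y \<in> N \<Longrightarrow> x + y \<in> N"
  and N_diff: "x \<in> N \<Longrightarrow> y \<in> N \<Longrightarrow> x - y \<in> N"
  and N_minus: "x \<in> N \<Longrightarrow> - x \<in> N"
  by (fact subspace_0[OF subspace_N] subspace_add[OF subspace_N] subspace_diff[OF subspace_N] subspace_neg[OF subspace_N])+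

lemma M_scale: "x \<in> M \<Longrightarrow> a *s x \<in> M"
  and M_minus: "x \<in> M \<Longrightarrow> - x \<in> M"
  by (fact subspace_scale[OF subspace_M] subspace_neg[OF subspace_M])+

lemma M_iff: "x \<in> M \<longleftrightarrow> (\<forall>i<n. B (u i) x = 0)"
proof
  assume "x \<in> M"
  moreover have "M \<subseteq> {x. \<forall>i<n. B (u i) x = 0}"
    unfolding M_def by (intro span_minimal subspaceI) (auto simp: B_linear B_uu)
  ultimately show "\<forall>i<n. B (u i) x = 0" by blast
next
  assume "\<forall>i<n. B (u i) x = 0"
  then have "prN x = 0" by (simp add: prN_def)
  then show "x \<in> M" using decomp[of x] prM_in[of x] by simp
qed

lemma N_iff: "x \<in> N \<longleftrightarrow> (\<forall>i<n. B x (v i) = 0)"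
proof
  assume "x \<in> N"
  moreover have "N \<subseteq> {x. \<forall>i<n. B x (v i) = 0}"
    unfolding N_def by (intro span_minimal subspaceI) (auto simp: B_linear B_vv)
  ultimately show "\<forall>i<n. B x (v i) = 0" by blast
next
  assume "\<forall>i<n. B x (v i) = 0"
  then have "prM x = 0" by (simp add: prM_def)
  then show "x \<in> N" using decomp[of x] prN_in[of x] by simp
qed

lemma u_in: "i < n \<Longrightarrow> u i \<in> M" and v_in: "i < n \<Longrightarrow> v i \<in> N"
  unfolding M_def N_def by (auto intro: span_base)

lemma prN_of_N: "x \<in> N \<Longrightarrow> prN x = x" and prM_of_N: "x \<in> N \<Longrightarrow> prM x = 0"
proof -
  assume "x \<in> N"
  then show "prM x = 0" by (simp add: prM_def N_iff)
  then show "prN x = x" using decomp[of x] by simp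
qed

lemma prM_of_M: "x \<in> M \<Longrightarrow> prM x = x" and prN_of_M: "x \<in> M \<Longrightarrow> prN x = 0"
proof -
  assume "x \<in> M"
  then show "prN x = 0" by (simp add: prN_def M_iff)
  then show "prM x = x" using decomp[of x] by simp
qed

lemma B_prM: "B (prM x) y = (\<Sum>i<n. B x (v i) * B (u i) y)"
  by (simp add: prM_def B_sum_left B_scale_left)

lemma B_prN: "B (prN x) y = (\<Sum>i<n. B (u i) x * B (v i) y)"
  by (simp add: prN_def B_sum_left B_scale_left)

lemma B_MM: "x \<in> M \<Longrightarrow> y \<in> M \<Longrightarrow> B x y = 0"
  using B_prM[of x y] by (simp add: prM_of_M M_iff)

lemma B_NN: "x \<in> N \<Longrightarrow> y \<in> N \<Longrightarrow> B x y = 0"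
  using B_prN[of x y] by (simp add: prN_of_N N_iff) (simp add: B_skew[of "v _"])

lemma B_coord: "B x y = (\<Sum>i<n. B x (v i) * B (u i) y - B (u i) x * B y (v i))"
proof -
  have "B x y = B (prM x) y + B (prN x) y" using decomp[of x] B_add_left by metis
  also have "\<dots> = (\<Sum>i<n. B x (v i) * B (u i) y + B (u i) x * B (v i) y)"
    by (simp add: B_prM B_prN sum.distrib)
  also have "\<dots> = (\<Sum>i<n. B x (v i) * B (u i) y - B (u i) x * B y (v i))"
    by (intro sum.cong refl) (simp add: B_skew[of "v _" y])
  finally show ?thesis .
qed

lemma eq_by_coords: "(\<And>i. i < n \<Longrightarrow> B x (v i) = B y (v i)) \<Longrightarrow> (\<And>i. i < n \<Longrightarrow> B (u i) x = B (u i) y) \<Longrightarrow> x = y"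
  using decomp[of x] decomp[of y] by (simp add: prM_def prN_def)

lemma Sp_carrier: "g \<in> Spc \<longleftrightarrow> module_hom scale scale g \<and> bij g \<and> (\<forall>x y. B (g x) (g y) = B x y)"
  by (simp add: Sp_def)

lemma Sp_mult [simp]: "g \<otimes>\<^bsub>Sp scale B\<^esub> h = g \<circ> h"
  by (simp add: Sp_def)

lemma Sp_add: "g \<in> Spc \<Longrightarrow> g (x + y) = g x + g y"
  and Sp_minus: "g \<in> Spc \<Longrightarrow> g (- x) = - g x"
  and Sp_scale: "g \<in> Spc \<Longrightarrow> g (a *s x) = a *s g x"
  and Sp_sum: "g \<in> Spc \<Longrightarrow> g (sum f A) = (\<Sum>i\<in>A. g (f i))"
  and Sp_B: "g \<in> Spc \<Longrightarrow> B (g x) (g y) = B x y"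
  and Sp_inj: "g \<in> Spc \<Longrightarrow> inj g"
  and Sp_surj: "g \<in> Spc \<Longrightarrow> surj g"
  unfolding Sp_carrier
  by (auto simp: module_hom.add module_hom.neg module_hom.scale module_hom.sum bij_def)

lemma SpI:
  assumes "\<And>x y. g (x + y) = g x + g y" "\<And>a x. g (a *s x) = a *s g x"
    and "\<And>x. h (g x) = x" "\<And>x. g (h x) = x" "\<And>x y. B (g x) (g y) = B x y"
  shows "g \<in> Spc"
  unfolding Sp_carrier
proof (intro conjI allI)
  show "module_hom scale scale g"
    by (rule module_hom.intro[OF module_scale module_scale]) (unfold_locales, fact+)
  show "bij g" using assms(3,4) by (intro bij_betw_byWitness[where f' = h]) auto
qed fact

lemma Sp_comp: "g \<in> Spc \<Longrightarrow> h \<in> Spc \<Longrightarrow> g \<circ> h \<in> Spc"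
  unfolding Sp_carrier by (auto simp: bij_comp module_hom_compose)

lemma Sp_id: "id \<in> Spc"
  unfolding Sp_carrier by (auto simp: module_hom_id)

lemma Sp_expand: "g \<in> Spc \<Longrightarrow> g x = (\<Sum>i<n. B x (v i) *s g (u i)) + (\<Sum>i<n. B (u i) x *s g (v i))"
proof -
  assume g: "g \<in> Spc"
  have "g x = g (prM x + prN x)" using decomp[of x] by simp
  then show ?thesis by (simp add: prM_def prN_def Sp_add[OF g] Sp_sum[OF g] Sp_scale[OF g])
qed

text \<open>The element \<open>s\<close> of the symplectic group; see \<open>sp_flip_eq\<close>.\<close>

definition flip :: "'v \<Rightarrow> 'v" where
  "flip x = (\<Sum>i<n. B x (v i) *s v i) - (\<Sum>i<n. B (u i) x *s u i)"

lemma sum_delta_mult: "j < n \<Longrightarrow> (\<Sum>i<n. f i * (if i = j then 1 else 0 :: 'r)) = f j"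
  by (simp add: if_distrib cong: if_cong)

lemma u_flip: "j < n \<Longrightarrow> B (u j) (flip x) = B x (v j)"
proof -
  assume j: "j < n"
  have "B (u j) (flip x) = (\<Sum>i<n. B x (v i) * B (u j) (v i)) - (\<Sum>i<n. B (u i) x * B (u j) (u i))"
    by (simp add: flip_def B_diff_right B_sum_right B_scale_right)
  also have "\<dots> = (\<Sum>i<n. B x (v i) * (if i = j then 1 else 0))"
  proof -
    have "(\<Sum>i<n. B (u i) x * B (u j) (u i)) = 0" using j by (simp add: B_uu)
    moreover have "(\<Sum>i<n. B x (v i) * B (u j) (v i)) = (\<Sum>i<n. B x (v i) * (if i = j then 1 else 0))"
      using j by (intro sum.cong) (auto simp: B_uv)
    ultimately show ?thesis by simp
  qed
  finally show ?thesis using sum_delta_mult[OF j] by simp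
qed

lemma flip_v: "j < n \<Longrightarrow> B (flip x) (v j) = - B (u j) x"
proof -
  assume j: "j < n"
  have "B (flip x) (v j) = (\<Sum>i<n. B x (v i) * B (v i) (v j)) - (\<Sum>i<n. B (u i) x * B (u i) (v j))"
    by (simp add: flip_def B_diff_left B_sum_left B_scale_left)
  also have "\<dots> = - (\<Sum>i<n. B (u i) x * (if i = j then 1 else 0))"
  proof -
    have "(\<Sum>i<n. B x (v i) * B (v i) (v j)) = 0" using j by (simp add: B_vv)
    moreover have "(\<Sum>i<n. B (u i) x * B (u i) (v j)) = (\<Sum>i<n. B (u i) x * (if i = j then 1 else 0))"
      using j by (intro sum.cong) (auto simp: B_uv)
    ultimately show ?thesis by simp
  qed
  finally show ?thesis using sum_delta_mult[OF j] by simp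
qed

lemma flip_flip: "flip (flip x) = - x"
  by (rule eq_by_coords) (simp_all add: u_flip flip_v B_linear)

lemma flip_minus: "flip (- x) = - flip x"
  by (rule eq_by_coords) (simp_all add: u_flip flip_v B_linear)

lemma flip_in_Sp: "flip \<in> Spc"
proof (rule SpI[where h = "\<lambda>x. - flip x"])
  show "flip (x + y) = flip x + flip y" for x y
    by (rule eq_by_coords) (simp_all add: u_flip flip_v B_linear)
  show "flip (a *s x) = a *s flip x" for a x
    by (rule eq_by_coords) (simp_all add: u_flip flip_v B_linear)
  show "B (flip x) (flip y) = B x y" for x y
  proof -
    have "B (flip x) (flip y)
        = (\<Sum>i<n. B (flip x) (v i) * B (u i) (flip y) - B (u i) (flip x) * B (flip y) (v i))"
      by (rule B_coord)
    also have "\<dots> = (\<Sum>i<n. B x (v i) * B (u i) y - B (u i) x * B y (v i))"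
      by (intro sum.cong refl) (simp add: u_flip flip_v)
    also have "\<dots> = B x y" by (rule B_coord[symmetric])
    finally show ?thesis .
  qed
qed (simp_all add: flip_flip flip_minus)

lemma flip_u: "i < n \<Longrightarrow> flip (u i) = v i" and flip_of_v: "i < n \<Longrightarrow> flip (v i) = - u i"
  by (rule eq_by_coords; auto simp: u_flip flip_v B_linear B_uu B_uv B_vv)+

lemma sp_flip_eq: "sp_flip scale B n u v = flip"
  unfolding sp_flip_def
proof (rule the_equality)
  show "flip \<in> Spc \<and> (\<forall>i<n. flip (u i) = v i \<and> flip (v i) = - u i)"
    using flip_in_Sp flip_u flip_of_v by blast
  fix g assume g: "g \<in> Spc \<and> (\<forall>i<n. g (u i) = v i \<and> g (v i) = - u i)"
  show "g = flip"
  proof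
    fix x
    have "g x = (\<Sum>i<n. B x (v i) *s g (u i)) + (\<Sum>i<n. B (u i) x *s g (v i))"
      using g by (intro Sp_expand) blast
    also have "\<dots> = (\<Sum>i<n. B x (v i) *s v i) + (\<Sum>i<n. - (B (u i) x *s u i))"
      using g by simp
    finally show "g x = flip x" by (simp add: flip_def sum_negf)
  qed
qed

lemma flip_N: "x \<in> N \<Longrightarrow> flip x \<in> M" and flip_M: "x \<in> M \<Longrightarrow> flip x \<in> N"
  by (simp_all add: M_iff N_iff u_flip flip_v)

definition transvection :: "'r \<Rightarrow> 'v \<Rightarrow> 'v \<Rightarrow> 'v" where
  "transvection a w x = x + (a * B w x) *s w"

lemma transvection_inverse: "transvection a w (transvection (- a) w x) = x"
  by (simp add: transvection_def B_linear algebra_simps)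

lemma transvection_in_Sp: "transvection a w \<in> Spc"
proof (rule SpI[where h = "transvection (- a) w"])
  show "transvection a w (x + y) = transvection a w x + transvection a w y" for x y
    by (simp add: transvection_def B_linear algebra_simps)
  show "transvection a w (b *s x) = b *s transvection a w x" for b x
    by (simp add: transvection_def B_linear algebra_simps)
  show "B (transvection a w x) (transvection a w y) = B x y" for x y
    by (simp add: transvection_def B_linear B_skew[of x w] algebra_simps)
  show "transvection (- a) w (transvection a w x) = x" for x
    using transvection_inverse[of "- a" w x] by simp
qed (rule transvection_inverse)

lemma transvection_conj: "g \<in> Spc \<Longrightarrow> g (transvection a w x) = transvection a (g w) (g x)"
  by (simp add: transvection_def Sp_add Sp_scale Sp_B)

text \<open>
  For \<open>p\<close> and \<open>q\<close> in \<open>M\<close> this is an element of \<open>Sp_fix scale B M\<close>. If \<open>B p x = 1\<close>, then the image of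
  \<open>x\<close> can be prescribed modulo \<open>p\<close> through \<open>q\<close>, and its coefficient at \<open>p\<close> is adjusted through \<open>b\<close>.
\<close>

definition shear :: "'v \<Rightarrow> 'v \<Rightarrow> 'r \<Rightarrow> 'v \<Rightarrow> 'v" where
  "shear p q b x = x + (B p x *s q + B q x *s p + (b * B p x) *s p)"

lemma shear_inverse:
  assumes "p \<in> M" "q \<in> M" shows "shear p q b (shear p (- q) (- b) x) = x"
  using B_MM[OF assms] B_MM[OF assms(2,1)]
  by (simp add: shear_def B_linear algebra_simps)

lemma shear_in_Sp_fix:
  assumes pq: "p \<in> M" "q \<in> M" shows "shear p q b \<in> Sp_fix scale B M"
proof -
  have 0: "B p q = 0" "B q p = 0" using B_MM pq by auto
  have "shear p q b \<in> Spc"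
  proof (rule SpI[where h = "shear p (- q) (- b)"])
    show "shear p q b (x + y) = shear p q b x + shear p q b y" for x y
      by (simp add: shear_def B_linear algebra_simps)
    show "shear p q b (c *s x) = c *s shear p q b x" for c x
      by (simp add: shear_def B_linear algebra_simps)
    show "B (shear p q b x) (shear p q b y) = B x y" for x y
      by (simp add: shear_def B_linear 0 B_skew[of x p] B_skew[of x q] algebra_simps)
    show "shear p (- q) (- b) (shear p q b x) = x" for x
      using shear_inverse[OF pq(1) M_minus[OF pq(2)], of "- b" x] by simp
    show "shear p q b (shear p (- q) (- b) x) = x" for x
      by (rule shear_inverse[OF pq])
  qed
  moreover have "shear p q b x = x" if "x \<in> M" for x
    using B_MM[OF pq(1) that] B_MM[OF pq(2) that] by (simp add: shear_def)
  ultimately show ?thesis unfolding Sp_fix_def by blast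
qed

lemma transvection_in_Sp_fix: "w \<in> M \<Longrightarrow> transvection a w \<in> Sp_fix scale B M"
  unfolding Sp_fix_def using transvection_in_Sp B_MM by (auto simp: transvection_def)

lemma Sp_fix_subset: "t \<in> Sp_fix scale B M \<Longrightarrow> t \<in> Spc"
  unfolding Sp_fix_def by blast

text \<open>
  The symplectic group is generated, even as a monoid, by the flip and the pointwise stabilizer
  of \<open>M\<close>; this is stated as an induction principle, \<open>Sp_induct\<close>. A transvection along a vector of
  \<open>M\<close> fixes \<open>M\<close> pointwise. Every unimodular vector is moved into \<open>M\<close> by the generators, so all
  transvections along unimodular vectors are generated. These suffice to carry any symplectic
  basis to the given one, one hyperbolic pair at a time.
\<close>

context
  fixes Q :: "('v \<Rightarrow> 'v) \<Rightarrow> bool"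
  assumes Q_fix: "\<And>t. t \<in> Sp_fix scale B M \<Longrightarrow> Q t"
    and Q_flip: "Q flip"
    and Q_comp: "\<And>g h. g \<in> Spc \<Longrightarrow> h \<in> Spc \<Longrightarrow> Q g \<Longrightarrow> Q h \<Longrightarrow> Q (g \<circ> h)"
begin

lemma Q_flip_inverse: "Q (\<lambda>x. - flip x)" and flip_inverse_in_Sp: "(\<lambda>x. - flip x) \<in> Spc"
proof -
  have "(\<lambda>x. - flip x) = flip \<circ> (flip \<circ> flip)" by (simp add: fun_eq_iff flip_flip flip_minus)
  then show "Q (\<lambda>x. - flip x)" "(\<lambda>x. - flip x) \<in> Spc"
    using Q_flip flip_in_Sp by (auto intro: Q_comp Sp_comp)
qed

lemma Q_conj:
  assumes "g \<in> Spc" "h \<in> Spc" "\<And>x. g (h x) = x" "Q g" "Q h" "Q (transvection r w)"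
  shows "Q (transvection r (g w))"
proof -
  have "transvection r (g w) = g \<circ> (transvection r w \<circ> h)"
    using assms(3) by (simp add: fun_eq_iff transvection_conj[OF assms(1)])
  then show ?thesis using assms by (simp add: Q_comp Sp_comp transvection_in_Sp)
qed

lemma Q_transvection_N: "w \<in> N \<Longrightarrow> Q (transvection r w)"
proof -
  assume w: "w \<in> N"
  have "Q (transvection r (flip (- flip w)))"
    by (rule Q_conj[OF flip_in_Sp flip_inverse_in_Sp _ Q_flip Q_flip_inverse Q_fix])
       (simp_all add: flip_flip flip_minus transvection_in_Sp_fix M_minus flip_N w)
  then show ?thesis by (simp add: flip_minus flip_flip)
qed

text \<open>If \<open>x = a + c\<close> with \<open>a\<close> in \<open>M\<close> and \<open>c\<close> in \<open>N\<close>, then \<open>B p c = 1\<close> allows a shear to move \<open>x\<close> to \<open>c\<close>.\<close>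

lemma Q_transvection_paired:
  assumes p: "p \<in> M" "B p x = 1"
  shows "Q (transvection r x)"
proof -
  define a c where "a = prM x" and "c = prN x"
  have x: "x = a + c" unfolding a_def c_def by (rule decomp)
  have a: "a \<in> M" and c: "c \<in> N" by (simp_all add: a_def c_def)
  have pc: "B p c = 1" using p B_MM[OF p(1) a] by (simp add: x B_add_right)
  let ?t = "shear p (- a) (B a c)" and ?t' = "shear p a (- B a c)"
  have "?t' c = x" by (simp add: shear_def pc x B_minus_left algebra_simps)
  moreover have "Q (transvection r (?t' c))"
  proof (rule Q_conj[where g = ?t' and h = ?t and w = c])
    show "?t' (?t y) = y" for y using shear_inverse[OF p(1) a, of "- B a c" y] by simp
    show "?t' \<in> Spc" "?t \<in> Spc" "Q ?t" "Q ?t'"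
      using shear_in_Sp_fix[OF p(1)] a M_minus Q_fix Sp_fix_subset by blast+
    show "Q (transvection r c)" by (rule Q_transvection_N[OF c])
  qed
  ultimately show ?thesis by simp
qed

text \<open>
  A vector \<open>y\<close> with \<open>B y x = 1\<close> has a component in \<open>M\<close> or one in \<open>N\<close> whose product with \<open>x\<close> is a
  unit. The flip reduces the second case to the first.
\<close>

lemma Q_transvection:
  assumes "B y x = 1"
  shows "Q (transvection r x)"
proof -
  have paired: "Q (transvection r z)" if "p \<in> M" "B p z dvd 1" for p z
  proof -
    obtain e where e: "1 = B p z * e" using \<open>B p z dvd 1\<close> by blast
    show ?thesis
      by (rule Q_transvection_paired[OF M_scale[OF \<open>p \<in> M\<close>], of e]) (simp add: B_scale_left e mult.commute)
  qed
  have "B (prM y) x + B (prN y) x dvd 1"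
    using assms decomp[of y] B_add_left[of "prM y" "prN y" x] by simp
  then consider "B (prM y) x dvd 1" | "B (prN y) x dvd 1" using nonunit_add by blast
  then show ?thesis
  proof cases
    case 1 then show ?thesis by (rule paired[OF prM_in])
  next
    case 2
    then have "Q (transvection r (flip x))"
      by (intro paired[OF flip_N[OF prN_in]]) (simp add: Sp_B[OF flip_in_Sp])
    then have "Q (transvection r (- flip (flip x)))"
      by (rule Q_conj[OF flip_inverse_in_Sp flip_in_Sp _ Q_flip_inverse Q_flip, rotated])
         (simp add: flip_flip)
    then show ?thesis by (simp add: flip_flip)
  qed
qed

text \<open>The transvection along \<open>y - x\<close> with the inverse of \<open>B y x\<close> as coefficient carries \<open>x\<close> to \<open>y\<close>.\<close>

lemma transvection_step:
  assumes "B x y dvd 1"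
  obtains t where "t \<in> Spc" "t x = y" "\<And>z. B (y - x) z = 0 \<Longrightarrow> t z = z"
    "\<And>g. g \<in> Spc \<Longrightarrow> Q (t \<circ> g) \<Longrightarrow> Q g"
proof -
  obtain e where e: "1 = B x y * e" using assms by blast
  let ?w = "y - x"
  let ?t = "transvection (- e) ?w" and ?t' = "transvection e ?w"
  have w: "B (e *s x) ?w = 1" using e by (simp add: B_linear mult.commute)
  show ?thesis
  proof (rule that[of ?t])
    show "?t \<in> Spc" by (rule transvection_in_Sp)
    have "- e * B ?w x = 1" using e by (simp add: B_linear B_skew[of y x] mult.commute)
    then show "?t x = y" by (simp add: transvection_def)
    show "?t z = z" if "B ?w z = 0" for z using that by (simp add: transvection_def)
    fix g assume g: "g \<in> Spc" "Q (?t \<circ> g)"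
    have "g = ?t' \<circ> (?t \<circ> g)" by (simp add: fun_eq_iff transvection_inverse)
    moreover have "Q (?t' \<circ> (?t \<circ> g))"
      by (intro Q_comp Sp_comp transvection_in_Sp g Q_transvection[OF w])
    ultimately show "Q g" by simp
  qed
qed

text \<open>
  The images of \<open>u k\<close> and then of \<open>v k\<close> are moved back by transvections along differences of
  vectors that are orthogonal to the earlier basis vectors. If the product of the two vectors is
  not a unit, an intermediate vector is inserted; it exists because in a local ring the sum of a
  unit and a nonunit is a unit.
\<close>

lemma Q_step:
  assumes k: "k < n"
    and IH: "\<And>g. g \<in> Spc \<Longrightarrow> (\<forall>i\<le>k. g (u i) = u i \<and> g (v i) = v i) \<Longrightarrow> Q g"
  shows "g \<in> Spc \<Longrightarrow> \<forall>i<k. g (u i) = u i \<and> g (v i) = v i \<Longrightarrow> Q g"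
proof -
  define F where "F g \<longleftrightarrow> g \<in> Spc \<and> (\<forall>i<k. g (u i) = u i \<and> g (v i) = v i)" for g
  define perp where "perp z \<longleftrightarrow> (\<forall>i<k. B z (u i) = 0 \<and> B z (v i) = 0)" for z
  have uv: "B (u k) (v k) = 1" using k by (simp add: B_uv)
  have perp_u: "perp (u k)" using k by (simp add: perp_def B_uu B_uv)
  have perp_v: "perp (v k)" using k by (simp add: perp_def B_vv B_skew[of "v k" "u _"] B_uv)
  have perp_F: "perp (g z)" if "F g" "perp z" for g z
    unfolding perp_def
  proof (intro allI impI)
    fix i assume i: "i < k"
    have g: "g \<in> Spc" "g (u i) = u i" "g (v i) = v i" using \<open>F g\<close> i by (simp_all add: F_def)
    have "B z (u i) = 0" "B z (v i) = 0" using \<open>perp z\<close> i by (simp_all add: perp_def)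
    then show "B (g z) (u i) = 0 \<and> B (g z) (v i) = 0"
      using Sp_B[OF g(1), of z "u i"] Sp_B[OF g(1), of z "v i"] unfolding g(2,3) by simp
  qed
  have perp_add: "perp (z + w)" if "perp z" "perp w" for z w
    using that by (simp add: perp_def B_add_left)
  have F_step: "F (t \<circ> g)" if "F g" "t \<in> Spc" "perp x" "perp y" "\<And>z. B (y - x) z = 0 \<Longrightarrow> t z = z" for g t x y
    using that by (simp add: F_def perp_def Sp_comp B_diff_left)
  have L1: "Q g" if g: "F g" "g (u k) = u k" "g (v k) = v k" for g
    using IH[of g] g unfolding F_def by (metis le_neq_implies_less)
  have L2: "Q g" if g: "F g" "g (u k) = u k" "B (g (v k)) (v k) dvd 1" for g
  proof -
    obtain t where t: "t \<in> Spc" "t (g (v k)) = v k" "\<And>z. B (v k - g (v k)) z = 0 \<Longrightarrow> t z = z"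
      "\<And>g. g \<in> Spc \<Longrightarrow> Q (t \<circ> g) \<Longrightarrow> Q g"
      using transvection_step[OF g(3)] by blast
    have "B (g (u k)) (g (v k)) = 1" using g(1) uv by (simp add: F_def Sp_B)
    then have "B (v k - g (v k)) (u k) = 0"
      using g(2) uv by (simp add: B_diff_right B_skew[of _ "u k"])
    then have "Q (t \<circ> g)"
      using F_step[OF g(1) t(1) perp_F[OF g(1) perp_v] perp_v t(3)] g(2) t(2,3) by (intro L1) auto
    then show ?thesis using t(4) g(1) unfolding F_def by blast
  qed
  have L3: "Q g" if g: "F g" "g (u k) = u k" for g
  proof (cases "B (g (v k)) (v k) dvd 1")
    case True then show ?thesis using L2 g by blast
  next
    case False
    have *: "B (u k) (g (v k)) = 1" using g Sp_B[of g "u k" "v k"] uv by (simp add: F_def)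
    have "B (g (v k)) (u k + v k) dvd 1"
      using unit_add_nonunit[OF _ False, of "- 1"] * by (simp add: B_add_right B_skew[of "g (v k)" "u k"])
    then obtain t where t: "t \<in> Spc" "t (g (v k)) = u k + v k" "\<And>z. B (u k + v k - g (v k)) z = 0 \<Longrightarrow> t z = z"
      "\<And>g. g \<in> Spc \<Longrightarrow> Q (t \<circ> g) \<Longrightarrow> Q g"
      using transvection_step by blast
    have "B (u k + v k - g (v k)) (u k) = 0"
      using * uv by (simp add: B_diff_right B_add_right B_skew[of _ "u k"])
    then have "Q (t \<circ> g)"
      using F_step[OF g(1) t(1) perp_F[OF g(1) perp_v] perp_add[OF perp_u perp_v] t(3)] g(2) t(2,3) uv
      by (intro L2) (auto simp: B_add_left)
    then show ?thesis using t(4) g(1) unfolding F_def by blast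
  qed
  have L4: "Q g" if g: "F g" "B (g (u k)) (u k) dvd 1" for g
  proof -
    obtain t where t: "t \<in> Spc" "t (g (u k)) = u k" "\<And>z. B (u k - g (u k)) z = 0 \<Longrightarrow> t z = z"
      "\<And>g. g \<in> Spc \<Longrightarrow> Q (t \<circ> g) \<Longrightarrow> Q g"
      using transvection_step[OF g(2)] by blast
    have "Q (t \<circ> g)"
      using F_step[OF g(1) t(1) perp_F[OF g(1) perp_u] perp_u t(3)] t(2) by (intro L3) auto
    then show ?thesis using t(4) g(1) unfolding F_def by blast
  qed
  have L5: "Q g" if g: "F g" for g
  proof -
    have 1: "B (g (u k)) (g (v k)) = 1" using g uv by (simp add: F_def Sp_B)
    have "\<exists>z. perp z \<and> B (g (u k)) z dvd 1 \<and> B z (u k) dvd 1"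
    proof (cases "B (g (u k)) (v k) dvd 1")
      case True
      then show ?thesis using perp_v uv by (intro exI[of _ "v k"]) (simp add: B_skew[of "v k"])
    next
      case a: False
      show ?thesis
      proof (cases "B (g (v k)) (u k) dvd 1")
        case True
        then show ?thesis using perp_F[OF g perp_v] 1 by (intro exI[of _ "g (v k)"]) simp
      next
        case b: False
        have "B (g (u k)) (g (v k) + v k) dvd 1"
          using unit_add_nonunit[OF _ a, of 1] 1 by (simp add: B_add_right)
        moreover have "B (g (v k) + v k) (u k) dvd 1"
          using unit_add_nonunit[OF _ b, of "- 1"] uv
          by (simp add: B_add_left B_skew[of "v k"] add.commute)
        ultimately show ?thesis using perp_add[OF perp_F[OF g perp_v] perp_v] by blast
      qed
    qed
    then obtain z where z: "perp z" "B (g (u k)) z dvd 1" "B z (u k) dvd 1" by blast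
    obtain t where t: "t \<in> Spc" "t (g (u k)) = z" "\<And>w. B (z - g (u k)) w = 0 \<Longrightarrow> t w = w"
      "\<And>g. g \<in> Spc \<Longrightarrow> Q (t \<circ> g) \<Longrightarrow> Q g"
      using transvection_step[OF z(2)] by blast
    have "Q (t \<circ> g)"
      using F_step[OF g t(1) perp_F[OF g perp_u] z(1) t(3)] t(2) z(3) by (intro L4) auto
    then show ?thesis using t(4) g unfolding F_def by blast
  qed
  show "g \<in> Spc \<Longrightarrow> \<forall>i<k. g (u i) = u i \<and> g (v i) = v i \<Longrightarrow> Q g"
    using L5 unfolding F_def by blast
qed

lemma Sp_induct:
  assumes "g \<in> Spc" shows "Q g"
proof -
  have "\<forall>g\<in>Spc. (\<forall>i<n - j. g (u i) = u i \<and> g (v i) = v i) \<longrightarrow> Q g" if "j \<le> n" for j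
    using that
  proof (induction j)
    case 0
    have "g = id" if "g \<in> Spc" "\<forall>i<n. g (u i) = u i \<and> g (v i) = v i" for g
    proof
      fix x
      have "g x = prM x + prN x" using Sp_expand[OF that(1), of x] that(2) by (simp add: prM_def prN_def)
      then show "g x = id x" using decomp[of x] by simp
    qed
    moreover have "Q id" by (rule Q_fix) (simp add: Sp_fix_def Sp_id)
    ultimately show ?case by auto
  next
    case (Suc j)
    have "{..n - Suc j} = {..<n - j}" using Suc.prems by auto
    then have "(\<forall>i\<le>n - Suc j. P i) \<longleftrightarrow> (\<forall>i<n - j. P i)" for P by (simp flip: atMost_iff lessThan_iff)
    then show ?case using Q_step[of "n - Suc j"] Suc by auto
  qed
  from this[of n] show ?thesis using assms by simp
qed

end

end

section \<open>Determinants on even and odd functions\<close>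

text \<open>
  Operators on the functions on a finite set that is stable under \<open>x \<mapsto> - x\<close>, with the origin as
  the only fixed point. The set is enumerated, so that operators are square matrices.
\<close>

locale symmetric_set =
  fixes N :: "'v::ab_group_add set"
  assumes finite_N: "finite N" and zero_in: "0 \<in> N"
    and minus_in: "\<And>x. x \<in> N \<Longrightarrow> - x \<in> N"
    and minus_fixed: "\<And>x. x \<in> N \<Longrightarrow> - x = x \<Longrightarrow> x = 0"
begin

definition m :: nat where "m = card N"
definition nu :: "nat \<Rightarrow> 'v" where "nu = (SOME f. bij_betw f {..<m} N)"
definition idx :: "'v \<Rightarrow> nat" where "idx = inv_into {..<m} nu"

definition op :: "('v \<Rightarrow> 'v \<Rightarrow> complex) \<Rightarrow> complex mat" where
  "op K = mat m m (\<lambda>(i, j). K (nu i) (nu j))"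

lemma bij_nu: "bij_betw nu {..<m} N"
proof -
  have "\<exists>f. bij_betw f {..<m} N"
    using ex_bij_betw_nat_finite[OF finite_N] by (simp add: m_def atLeast0LessThan)
  then show ?thesis unfolding nu_def by (rule someI_ex)
qed

lemma nu_in: "i < m \<Longrightarrow> nu i \<in> N"
  using bij_betwE[OF bij_nu] by blast

lemma idx_less: "x \<in> N \<Longrightarrow> idx x < m"
  unfolding idx_def using inv_into_into[of x nu "{..<m}"] bij_nu by (auto simp: bij_betw_def)

lemma nu_idx: "x \<in> N \<Longrightarrow> nu (idx x) = x"
  unfolding idx_def using bij_nu by (intro f_inv_into_f) (auto simp: bij_betw_def)

lemma idx_nu: "i < m \<Longrightarrow> idx (nu i) = i"
  unfolding idx_def using bij_nu by (intro inv_into_f_f) (auto simp: bij_betw_def)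

lemma nu_eq_iff: "i < m \<Longrightarrow> j < m \<Longrightarrow> nu i = nu j \<longleftrightarrow> i = j"
  using idx_nu by metis

lemma op_carrier [simp]: "op K \<in> carrier_mat m m"
  by (simp add: op_def)

lemma square_mat [simp]:
  fixes A :: "complex mat"
  assumes "A \<in> carrier_mat m m"
  shows "C \<in> carrier_mat m m \<Longrightarrow> A * C \<in> carrier_mat m m"
    and "A * 0\<^sub>m m m = 0\<^sub>m m m" and "0\<^sub>m m m * A = 0\<^sub>m m m"
    and "A + 0\<^sub>m m m = A" and "0\<^sub>m m m + A = A"
    and "A * 1\<^sub>m m = A" and "1\<^sub>m m * A = A"
  using assms by auto

lemma op_entry: "x \<in> N \<Longrightarrow> y \<in> N \<Longrightarrow> op K $$ (idx x, idx y) = K x y"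
  by (simp add: op_def idx_less nu_idx)

lemma op_cong: "(\<And>x y. x \<in> N \<Longrightarrow> y \<in> N \<Longrightarrow> K x y = L x y) \<Longrightarrow> op K = op L"
  unfolding op_def by (rule cong_mat) (auto simp: nu_in)

lemma op_eqD: "op K = op L \<Longrightarrow> x \<in> N \<Longrightarrow> y \<in> N \<Longrightarrow> K x y = L x y"
  using op_entry by metis

lemma op_surj: "A \<in> carrier_mat m m \<Longrightarrow> A = op (\<lambda>x y. A $$ (idx x, idx y))"
  unfolding op_def by (rule eq_matI) (auto simp: idx_nu)

lemma op_mult: "op K * op L = op (\<lambda>x y. \<Sum>z\<in>N. K x z * L z y)"
proof (rule eq_matI)
  fix i j assume "i < dim_row (op (\<lambda>x y. \<Sum>z\<in>N. K x z * L z y))" "j < dim_col (op (\<lambda>x y. \<Sum>z\<in>N. K x z * L z y))"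
  then have ij: "i < m" "j < m" by (simp_all add: op_def)
  have "(op K * op L) $$ (i, j) = (\<Sum>k<m. K (nu i) (nu k) * L (nu k) (nu j))"
    using ij by (simp add: op_def scalar_prod_def atLeast0LessThan)
  also have "\<dots> = (\<Sum>z\<in>N. K (nu i) z * L z (nu j))"
    by (rule sum.reindex_bij_betw[OF bij_nu, of "\<lambda>z. K (nu i) z * L z (nu j)"])
  finally show "(op K * op L) $$ (i, j) = op (\<lambda>x y. \<Sum>z\<in>N. K x z * L z y) $$ (i, j)"
    using ij by (simp add: op_def)
qed (simp_all add: op_def)

lemma op_add: "op K + op L = op (\<lambda>x y. K x y + L x y)"
  by (rule eq_matI) (auto simp: op_def)

lemma op_smult: "c \<cdot>\<^sub>m op K = op (\<lambda>x y. c * K x y)"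
  by (rule eq_matI) (auto simp: op_def)

definition diag :: "('v \<Rightarrow> complex) \<Rightarrow> 'v \<Rightarrow> 'v \<Rightarrow> complex" where
  "diag d = (\<lambda>x y. if x = y then d y else 0)"

definition perm :: "('v \<Rightarrow> 'v) \<Rightarrow> 'v \<Rightarrow> 'v \<Rightarrow> complex" where
  "perm f = (\<lambda>x y. if x = f y then 1 else 0)"

lemma op_one: "op (diag (\<lambda>_. 1)) = 1\<^sub>m m"
  by (rule eq_matI) (auto simp: op_def diag_def nu_eq_iff)

lemma mult_diag: "op K * op (diag d) = op (\<lambda>x y. K x y * d y)"
  unfolding op_mult diag_def
  by (rule op_cong) (simp add: if_distrib finite_N cong: if_cong)

lemma diag_mult: "op (diag d) * op K = op (\<lambda>x y. d x * K x y)"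
  unfolding op_mult diag_def
  by (rule op_cong) (simp add: if_distrib if_distribR finite_N cong: if_cong)

lemma mult_perm:
  assumes "\<And>y. y \<in> N \<Longrightarrow> f y \<in> N"
  shows "op K * op (perm f) = op (\<lambda>x y. K x (f y))"
  unfolding op_mult perm_def
  by (rule op_cong) (simp add: if_distrib finite_N assms cong: if_cong)

lemma perm_mult:
  assumes "\<And>x. x \<in> N \<Longrightarrow> g x \<in> N" "\<And>x. x \<in> N \<Longrightarrow> f (g x) = x" "\<And>x. x \<in> N \<Longrightarrow> g (f x) = x"
  shows "op (perm f) * op K = op (\<lambda>x y. K (g x) y)"
  unfolding op_mult perm_def
proof (rule op_cong)
  fix x y assume x: "x \<in> N"
  have "(\<Sum>z\<in>N. (if x = f z then 1 else 0) * K z y) = (\<Sum>z\<in>N. if z = g x then K z y else 0)"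
    by (rule sum.cong) (use x assms in auto)
  then show "(\<Sum>z\<in>N. (if x = f z then 1 else 0) * K z y) = K (g x) y"
    using x assms(1) by (simp add: finite_N)
qed

lemma perm_comp: "(\<And>y. y \<in> N \<Longrightarrow> g y \<in> N) \<Longrightarrow> op (perm f) * op (perm g) = op (perm (\<lambda>x. f (g x)))"
  by (simp add: mult_perm) (simp add: perm_def)

definition even_op :: "complex mat \<Rightarrow> bool" where
  "even_op A \<longleftrightarrow> A \<in> carrier_mat m m \<and>
     (\<forall>x\<in>N. \<forall>y\<in>N. A $$ (idx (- x), idx (- y)) = A $$ (idx x, idx y))"

lemma even_op_iff: "even_op (op K) \<longleftrightarrow> (\<forall>x\<in>N. \<forall>y\<in>N. K (- x) (- y) = K x y)"
  unfolding even_op_def by (simp add: op_entry minus_in)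

lemma even_opE:
  assumes "even_op A"
  obtains K where "A = op K" "\<And>x y. x \<in> N \<Longrightarrow> y \<in> N \<Longrightarrow> K (- x) (- y) = K x y"
proof -
  have "A = op (\<lambda>x y. A $$ (idx x, idx y))" using assms op_surj unfolding even_op_def by blast
  then show ?thesis by (rule that) (use assms in \<open>simp add: even_op_def\<close>)
qed

lemma even_op_carrier: "even_op A \<Longrightarrow> A \<in> carrier_mat m m"
  by (simp add: even_op_def)

lemma sum_minus: "(\<Sum>z\<in>N. f (- z)) = (\<Sum>z\<in>N. f z)"
  by (rule sum.reindex_bij_witness[where i = uminus and j = uminus]) (auto simp: minus_in)

lemma even_op_mult: "even_op A \<Longrightarrow> even_op C \<Longrightarrow> even_op (A * C)"
proof (elim even_opE)
  fix K L assume K: "A = op K" "\<And>x y. x \<in> N \<Longrightarrow> y \<in> N \<Longrightarrow> K (- x) (- y) = K x y"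
    and L: "C = op L" "\<And>x y. x \<in> N \<Longrightarrow> y \<in> N \<Longrightarrow> L (- x) (- y) = L x y"
  have "(\<Sum>z\<in>N. K (- x) z * L z (- y)) = (\<Sum>z\<in>N. K x z * L z y)" if "x \<in> N" "y \<in> N" for x y
    unfolding sum_minus[of "\<lambda>z. K (- x) z * L z (- y)", symmetric]
    by (intro sum.cong refl) (simp add: K L that)
  then show ?thesis by (simp add: K L op_mult even_op_iff)
qed

definition proj :: "complex \<Rightarrow> complex mat" where
  "proj s = op (\<lambda>x y. ((if x = y then 1 else 0) + s * (if x = - y then 1 else 0)) / 2)"

lemma proj_carrier [simp]: "proj s \<in> carrier_mat m m"
  by (simp add: proj_def)

lemma mult_proj: "op K * proj s = op (\<lambda>x y. (K x y + s * K x (- y)) / 2)"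
  unfolding proj_def op_mult
proof (rule op_cong)
  fix x y assume y: "y \<in> N"
  have "(\<Sum>z\<in>N. K x z * (((if z = y then 1 else 0) + s * (if z = - y then 1 else 0)) / 2))
      = (\<Sum>z\<in>N. (if z = y then K x z / 2 else 0)) + (\<Sum>z\<in>N. if z = - y then s * K x z / 2 else 0)"
    unfolding sum.distrib[symmetric] by (rule sum.cong) (auto simp: field_simps)
  also have "\<dots> = (K x y + s * K x (- y)) / 2"
    using y by (simp add: finite_N minus_in field_simps)
  finally show "(\<Sum>z\<in>N. K x z * (((if z = y then 1 else 0) + s * (if z = - y then 1 else 0)) / 2))
      = (K x y + s * K x (- y)) / 2" .
qed

lemma proj_mult: "proj s * op K = op (\<lambda>x y. (K x y + s * K (- x) y) / 2)"
  unfolding proj_def op_mult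
proof (rule op_cong)
  fix x y assume x: "x \<in> N"
  have "(\<Sum>z\<in>N. (((if x = z then 1 else 0) + s * (if x = - z then 1 else 0)) / 2) * K z y)
      = (\<Sum>z\<in>N. (if z = x then K z y / 2 else 0)) + (\<Sum>z\<in>N. if z = - x then s * K z y / 2 else 0)"
    unfolding sum.distrib[symmetric] by (rule sum.cong) (auto simp: field_simps)
  also have "\<dots> = (K x y + s * K (- x) y) / 2"
    using x by (simp add: finite_N minus_in field_simps)
  finally show "(\<Sum>z\<in>N. (((if x = z then 1 else 0) + s * (if x = - z then 1 else 0)) / 2) * K z y)
      = (K x y + s * K (- x) y) / 2" .
qed

lemma proj_idem: "s * s = 1 \<Longrightarrow> proj s * proj s = proj s"
  and proj_orth: "s * s = 1 \<Longrightarrow> proj s * proj (- s) = 0\<^sub>m m m"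
  and proj_sum: "proj s + proj (- s) = 1\<^sub>m m"
proof -
  have 0: "0\<^sub>m m m = op (\<lambda>_ _. 0)" by (rule eq_matI) (auto simp: op_def)
  have *: "proj s' * proj t = op (\<lambda>x y. (((if x = y then 1 else 0) + s * (if x = - y then 1 else 0)) / 2
     + t * (((if x = - y then 1 else 0) + s * (if x = y then 1 else 0)) / 2)) / 2)"
  if "s' = s" for s' t
    unfolding that proj_def[of s] mult_proj by simp
  show "proj s * proj s = proj s" if s: "s * s = 1"
    unfolding *[OF refl] unfolding proj_def by (rule op_cong) (use s in \<open>simp add: field_simps\<close>)
  show "proj s * proj (- s) = 0\<^sub>m m m" if s: "s * s = 1"
    unfolding *[OF refl] 0 by (rule op_cong) (use s in \<open>simp add: field_simps\<close>)
  show "proj s + proj (- s) = 1\<^sub>m m"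
    unfolding proj_def op_add op_one[symmetric] diag_def
    by (rule op_cong) (simp add: field_simps)
qed

lemma proj_commute: "even_op A \<Longrightarrow> s * s = 1 \<Longrightarrow> A * proj s = proj s * A"
proof (elim even_opE)
  fix K assume A: "A = op K" and K: "\<And>x y. x \<in> N \<Longrightarrow> y \<in> N \<Longrightarrow> K (- x) (- y) = K x y"
  have "K x (- y) = K (- x) y" if "x \<in> N" "y \<in> N" for x y
    using K[of x "- y"] that by (simp add: minus_in)
  then show "A * proj s = proj s * A" unfolding A mult_proj proj_mult by (intro op_cong) simp
qed

text \<open>
  The operator that acts as \<open>A\<close> on the \<open>s\<close>-eigenspace of \<open>x \<mapsto> - x\<close> and as the identity on the
  other one; its determinant is the determinant of \<open>A\<close> on that eigenspace.
\<close>

definition part :: "complex \<Rightarrow> complex mat \<Rightarrow> complex mat" where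
  "part s A = A * proj s + proj (- s)"

lemma part_carrier [simp]: "A \<in> carrier_mat m m \<Longrightarrow> part s A \<in> carrier_mat m m"
  by (simp add: part_def)

lemma part_mult:
  assumes A: "even_op A" and C: "even_op C" and s: "s * s = 1"
  shows "part s (A * C) = part s A * part s C"
proof -
  let ?P = "proj s" and ?Q = "proj (- s)"
  note cA = even_op_carrier[OF A] and cC = even_op_carrier[OF C]
  have s': "(- s) * (- s) = 1" using s by simp
  note [simp] = cA cC
  have "part s A * part s C = (A * ?P) * (C * ?P + ?Q) + ?Q * (C * ?P + ?Q)"
    unfolding part_def by (rule add_mult_distrib_mat[of _ m m _ _ m]) auto
  also have "(A * ?P) * (C * ?P + ?Q) = (A * ?P) * (C * ?P) + (A * ?P) * ?Q"
    by (rule mult_add_distrib_mat[of _ m m _ m]) auto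
  also have "?Q * (C * ?P + ?Q) = ?Q * (C * ?P) + ?Q * ?Q"
    by (rule mult_add_distrib_mat[of _ m m _ m]) auto
  also have "(A * ?P) * (C * ?P) = A * (?P * (C * ?P))" by (rule assoc_mult_mat[of _ m m _ m _ m]) auto
  also have "?P * (C * ?P) = ?P * (?P * C)" using proj_commute[OF C s] by simp
  also have "\<dots> = (?P * ?P) * C" by (rule assoc_mult_mat[of _ m m _ m _ m, symmetric]) auto
  also have "\<dots> = C * ?P" using proj_idem[OF s] proj_commute[OF C s] by simp
  also have "A * (C * ?P) = (A * C) * ?P" by (rule assoc_mult_mat[of _ m m _ m _ m, symmetric]) auto
  also have "(A * ?P) * ?Q = A * (?P * ?Q)" by (rule assoc_mult_mat[of _ m m _ m _ m]) auto
  also have "\<dots> = 0\<^sub>m m m" using proj_orth[OF s] by simp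
  also have "?Q * (C * ?P) = (?Q * C) * ?P" by (rule assoc_mult_mat[of _ m m _ m _ m, symmetric]) auto
  also have "\<dots> = (C * ?Q) * ?P" using proj_commute[OF C s'] by simp
  also have "\<dots> = C * (?Q * ?P)" by (rule assoc_mult_mat[of _ m m _ m _ m]) auto
  also have "\<dots> = 0\<^sub>m m m" using proj_orth[OF s'] by simp
  also have "?Q * ?Q = ?Q" by (rule proj_idem[OF s'])
  also have "(A * C) * ?P + 0\<^sub>m m m + (0\<^sub>m m m + ?Q) = part s (A * C)"
    unfolding part_def by simp
  finally show ?thesis by (rule sym)
qed

lemma part_parts:
  assumes A: "even_op A" and s: "s * s = 1"
  shows "part s A * part (- s) A = A"
proof -
  let ?P = "proj s" and ?Q = "proj (- s)"
  note cA = even_op_carrier[OF A]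
  have s': "(- s) * (- s) = 1" using s by simp
  note [simp] = cA
  have "part s A * part (- s) A = (A * ?P) * (A * ?Q + ?P) + ?Q * (A * ?Q + ?P)"
    unfolding part_def minus_minus by (rule add_mult_distrib_mat[of _ m m _ _ m]) auto
  also have "(A * ?P) * (A * ?Q + ?P) = (A * ?P) * (A * ?Q) + (A * ?P) * ?P"
    by (rule mult_add_distrib_mat[of _ m m _ m]) auto
  also have "?Q * (A * ?Q + ?P) = ?Q * (A * ?Q) + ?Q * ?P"
    by (rule mult_add_distrib_mat[of _ m m _ m]) auto
  also have "(A * ?P) * (A * ?Q) = A * (?P * (A * ?Q))" by (rule assoc_mult_mat[of _ m m _ m _ m]) auto
  also have "?P * (A * ?Q) = ?P * (?Q * A)" using proj_commute[OF A s'] by simp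
  also have "\<dots> = (?P * ?Q) * A" by (rule assoc_mult_mat[of _ m m _ m _ m, symmetric]) auto
  also have "\<dots> = 0\<^sub>m m m" using proj_orth[OF s] by simp
  also have "A * 0\<^sub>m m m = 0\<^sub>m m m" by simp
  also have "(A * ?P) * ?P = A * (?P * ?P)" by (rule assoc_mult_mat[of _ m m _ m _ m]) auto
  also have "?P * ?P = ?P" by (rule proj_idem[OF s])
  also have "?Q * (A * ?Q) = ?Q * (?Q * A)" using proj_commute[OF A s'] by simp
  also have "\<dots> = (?Q * ?Q) * A" by (rule assoc_mult_mat[of _ m m _ m _ m, symmetric]) auto
  also have "\<dots> = A * ?Q" using proj_idem[OF s'] proj_commute[OF A s'] by simp
  also have "?Q * ?P = 0\<^sub>m m m" using proj_orth[OF s'] by simp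
  also have "0\<^sub>m m m + A * ?P + (A * ?Q + 0\<^sub>m m m) = A * (?P + ?Q)"
    by (simp add: mult_add_distrib_mat[of _ m m _ m])
  also have "\<dots> = A" using proj_sum by simp
  finally show ?thesis .
qed

definition regular :: "complex mat \<Rightarrow> bool" where
  "regular A \<longleftrightarrow> even_op A \<and> det A \<noteq> 0"

text \<open>
  The quotient of the determinants on the even and on the odd functions. The space of even
  functions has one dimension more, whence \<open>delta (c A) = c * delta A\<close> (\<open>delta_smult\<close>). Hence
  \<open>delta\<close> singles out one operator among the multiples of a given one, in a multiplicative way.
\<close>

definition delta :: "complex mat \<Rightarrow> complex" where
  "delta A = det (part 1 A) / det (part (- 1) A)"

lemma regular_carrier: "regular A \<Longrightarrow> A \<in> carrier_mat m m"
  by (simp add: regular_def even_op_carrier)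

lemma regular_mult: "regular A \<Longrightarrow> regular C \<Longrightarrow> regular (A * C)"
  by (simp add: regular_def even_op_mult det_mult[of _ m] even_op_carrier)

lemma det_parts: "even_op A \<Longrightarrow> det (part 1 A) * det (part (- 1) A) = det A"
  using part_parts[of A 1] det_mult[of "part 1 A" m "part (- 1) A"] by (simp add: even_op_carrier)

lemma det_part_neq_0: "regular A \<Longrightarrow> det (part 1 A) \<noteq> 0 \<and> det (part (- 1) A) \<noteq> 0"
  using det_parts[of A] unfolding regular_def by auto

lemma delta_neq_0: "regular A \<Longrightarrow> delta A \<noteq> 0"
  using det_part_neq_0 by (simp add: delta_def)

lemma delta_mult: "regular A \<Longrightarrow> regular C \<Longrightarrow> delta (A * C) = delta A * delta C"
  by (simp add: delta_def regular_def part_mult det_mult[of _ m] even_op_carrier)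

text \<open>A choice of one element from each pair \<open>{x, - x}\<close>, encoded by signs.\<close>

definition sgn_of :: "'v \<Rightarrow> complex" where
  "sgn_of x = (if x = 0 \<or> idx x < idx (- x) then 1 else - 1)"

lemma sgn_square: "sgn_of x * sgn_of x = 1"
  by (simp add: sgn_of_def)

lemma sgn_zero: "sgn_of 0 = 1"
  by (simp add: sgn_of_def)

lemma sgn_minus: "x \<in> N \<Longrightarrow> x \<noteq> 0 \<Longrightarrow> sgn_of (- x) = - sgn_of x"
proof -
  assume x: "x \<in> N" "x \<noteq> 0"
  have "idx x \<noteq> idx (- x)"
    using nu_idx[OF x(1)] nu_idx[OF minus_in[OF x(1)]] minus_fixed[OF x(1)] x(2) by metis
  then show ?thesis using x by (auto simp: sgn_of_def)
qed

definition twist :: "('v \<Rightarrow> 'v \<Rightarrow> complex) \<Rightarrow> 'v \<Rightarrow> 'v \<Rightarrow> complex" where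
  "twist K = (\<lambda>x y. sgn_of x * K x y * sgn_of y)"

definition fixes_origin :: "('v \<Rightarrow> 'v \<Rightarrow> complex) \<Rightarrow> bool" where
  "fixes_origin K \<longleftrightarrow> (\<forall>x\<in>N. x \<noteq> 0 \<longrightarrow> K x 0 = 0 \<and> K 0 x = 0)"

lemma part_op: "part s (op K) = op (\<lambda>x y. (K x y + s * K x (- y)) / 2 +
    ((if x = y then 1 else 0) - s * (if x = - y then 1 else 0)) / 2)"
  unfolding part_def mult_proj unfolding proj_def op_add by (rule op_cong) simp

lemma det_diag_origin: "det (op (diag (\<lambda>x. if x = 0 then c else 1))) = c"
proof -
  have "op (diag (\<lambda>x. if x = 0 then c else 1)) = multrow_mat m (idx 0) c"
  proof -
    have "nu j = 0 \<longleftrightarrow> idx 0 = j" if "j < m" for j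
      using idx_nu[OF that] nu_idx[OF zero_in] by auto
    then show ?thesis
      unfolding multrow_mat_def by (intro eq_matI) (auto simp: op_def diag_def nu_eq_iff)
  qed
  then show ?thesis using det_multrow_mat[OF idx_less[OF zero_in], of c] by simp
qed

text \<open>
  Conjugation by the signs exchanges the even and the odd functions that vanish at the origin;
  the factor is the contribution of the origin.
\<close>

lemma det_part_twist:
  assumes K: "fixes_origin K"
  shows "det (part 1 (op K)) = K 0 0 * det (part (- 1) (op (twist K)))"
proof -
  let ?D = "diag (\<lambda>x. if x = 0 then K 0 0 else 1)" and ?E = "diag sgn_of"
  let ?P = "\<lambda>x y. (K x y + K x (- y)) / 2 + ((if x = y then 1 else 0) - (if x = - y then 1 else 0)) / 2"
  let ?T = "\<lambda>x y. (twist K x y - twist K x (- y)) / 2 + ((if x = y then 1 else 0) + (if x = - y then 1 else 0)) / 2"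
  have T: "part (- 1) (op (twist K)) = op ?T" unfolding part_op by (rule op_cong) simp
  have P: "part 1 (op K) = op ?P" unfolding part_op by (rule op_cong) simp
  have eq: "op ?P = op ?D * (op ?E * (op ?T * op ?E))"
    unfolding mult_diag diag_mult
  proof (rule op_cong)
    fix x y assume xy: "x \<in> N" "y \<in> N"
    consider "x = 0" "y = 0" | "x = 0" "y \<noteq> 0" | "x \<noteq> 0" "y = 0" | "x \<noteq> 0" "y \<noteq> 0" by blast
    then show "?P x y = (if x = 0 then K 0 0 else 1) * (sgn_of x * (?T x y * sgn_of y))"
    proof cases
      case 1 then show ?thesis by (simp add: twist_def sgn_zero)
    next
      case 2 then show ?thesis using K xy minus_in by (simp add: twist_def fixes_origin_def)
    next
      case 3 then show ?thesis using K xy by (simp add: twist_def fixes_origin_def)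
    next
      case 4
      have sy: "sgn_of (- y) = - sgn_of y" using sgn_minus 4 xy by blast
      have *: "sgn_of x * sgn_of y = 1" if "x = y" using that sgn_square by simp
      have **: "sgn_of x * sgn_of y = - 1" if "x = - y"
        using that sy sgn_square[of y] by (simp add: mult.commute)
      have sx2: "sgn_of x * (sgn_of x * w) = w" for w using sgn_square[of x] by (simp add: mult.assoc[symmetric])
      have sy2: "sgn_of y * (sgn_of y * w) = w" for w using sgn_square[of y] by (simp add: mult.assoc[symmetric])
      have "sgn_of x * (?T x y * sgn_of y) =
         (K x y + K x (- y)) / 2 + ((if x = y then 1 else 0) + (if x = - y then 1 else 0)) / 2 * (sgn_of x * sgn_of y)"
        unfolding twist_def sy by (simp add: algebra_simps add_divide_distrib sx2 sy2 sgn_square)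
      also have "((if x = y then 1 else 0) + (if x = - y then 1 else 0)) / 2 * (sgn_of x * sgn_of y)
         = ((if x = y then 1 else 0) - (if x = - y then 1 else 0 :: complex)) / 2"
        using * ** minus_fixed[OF xy(2)] 4(2) by auto
      finally show ?thesis using 4 by simp
    qed
  qed
  have "op ?E * op ?E = 1\<^sub>m m" unfolding mult_diag op_one[symmetric]
    by (rule op_cong) (simp add: diag_def sgn_square)
  then have EE: "det (op ?E) * det (op ?E) = 1" using det_mult[of "op ?E" m "op ?E"] by simp
  have "det (op ?P) = K 0 0 * (det (op ?E) * (det (op ?T) * det (op ?E)))"
    unfolding eq by (simp add: det_mult[of _ m] det_diag_origin)
  also have "\<dots> = K 0 0 * det (op ?T) * (det (op ?E) * det (op ?E))" by (simp only: ac_simps)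
  finally show ?thesis unfolding P T EE by simp
qed

lemma twist_twist: "twist (twist K) = K"
proof (intro ext)
  fix x y
  have "twist (twist K) x y = (sgn_of x * sgn_of x) * K x y * (sgn_of y * sgn_of y)"
    by (simp add: twist_def)
  then show "twist (twist K) x y = K x y" by (simp add: sgn_square)
qed

lemma delta_twist_inverse:
  assumes "fixes_origin K" "K 0 0 = 1" "regular (op K)"
  shows "delta (op (twist K)) * delta (op K) = 1"
proof -
  have "fixes_origin (twist K)" using assms(1) by (simp add: fixes_origin_def twist_def)
  then have 1: "det (part 1 (op (twist K))) = det (part (- 1) (op K))"
    using det_part_twist[of "twist K"] assms(2) by (simp add: twist_twist) (simp add: twist_def sgn_zero)
  have 2: "det (part 1 (op K)) = det (part (- 1) (op (twist K)))"
    using det_part_twist[OF assms(1)] assms(2) by simp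
  show ?thesis
    using det_part_neq_0[OF assms(3)] unfolding delta_def 1 2 by simp
qed

lemma det_diag: "det (op (diag d)) = (\<Prod>x\<in>N. d x)"
proof -
  have "det (op (diag d)) = (\<Prod>i = 0..<m. d (nu i))"
  proof -
    have "det (op (diag d)) = prod_list (diag_mat (op (diag d)))"
      by (rule det_upper_triangular[of _ m]) (auto simp: op_def diag_def nu_eq_iff)
    also have "\<dots> = (\<Prod>i = 0..<m. d (nu i))"
      unfolding prod_list_diag_prod by (rule prod.cong) (auto simp: op_def diag_def)
    finally show ?thesis .
  qed
  also have "\<dots> = (\<Prod>x\<in>N. d x)"
    using prod.reindex_bij_betw[OF bij_nu, of d] by (simp add: atLeast0LessThan)
  finally show ?thesis .
qed

lemma regular_diag:
  assumes "\<And>x. x \<in> N \<Longrightarrow> d (- x) = d x" "\<And>x. x \<in> N \<Longrightarrow> d x \<noteq> 0"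
  shows "regular (op (diag d))"
  using assms by (simp add: regular_def even_op_iff det_diag finite_N) (simp add: diag_def)

lemma delta_diag:
  assumes d: "\<And>x. x \<in> N \<Longrightarrow> d (- x) = d x" "\<And>x. x \<in> N \<Longrightarrow> d x \<noteq> 0"
  shows "delta (op (diag d)) = d 0"
proof -
  have "twist (diag d) = diag d" by (simp add: twist_def diag_def fun_eq_iff sgn_square mult.commute[of "d _"] flip: mult.assoc)
  moreover have "fixes_origin (diag d)" by (simp add: fixes_origin_def diag_def)
  ultimately have "det (part 1 (op (diag d))) = d 0 * det (part (- 1) (op (diag d)))"
    using det_part_twist[of "diag d"] by (simp add: diag_def)
  then show ?thesis using det_part_neq_0[OF regular_diag[of d, OF d]] by (simp add: delta_def)
qed

lemma scalar_op: "c \<cdot>\<^sub>m 1\<^sub>m m = op (diag (\<lambda>_. c))"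
  unfolding op_one[symmetric] op_smult by (rule op_cong) (simp add: diag_def)

lemma regular_scalar: "c \<noteq> 0 \<Longrightarrow> regular (c \<cdot>\<^sub>m 1\<^sub>m m)"
  unfolding scalar_op by (rule regular_diag) auto

lemma delta_scalar: "c \<noteq> 0 \<Longrightarrow> delta (c \<cdot>\<^sub>m 1\<^sub>m m) = c"
  unfolding scalar_op by (rule delta_diag) auto

lemma smult_as_mult: "(A :: complex mat) \<in> carrier_mat m m \<Longrightarrow> c \<cdot>\<^sub>m A = (c \<cdot>\<^sub>m 1\<^sub>m m) * A"
  by (simp add: mult_smult_assoc_mat[of "1\<^sub>m m" m m A m])

lemma regular_smult: "regular A \<Longrightarrow> c \<noteq> 0 \<Longrightarrow> regular (c \<cdot>\<^sub>m A)"
  by (subst smult_as_mult) (simp_all add: regular_carrier regular_mult regular_scalar)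

lemma delta_smult: "regular A \<Longrightarrow> c \<noteq> 0 \<Longrightarrow> delta (c \<cdot>\<^sub>m A) = c * delta A"
  by (subst smult_as_mult) (simp_all add: regular_carrier delta_mult regular_scalar delta_scalar)

lemma delta_one: "delta (1\<^sub>m m) = 1"
  unfolding op_one[symmetric] by (rule delta_diag; simp)+

lemma regularI:
  assumes "even_op A" "C \<in> carrier_mat m m" "A * C = 1\<^sub>m m"
  shows "regular A"
proof -
  have "det A * det C = 1" using det_mult[of A m C] assms by (simp add: even_op_carrier)
  then show ?thesis using assms(1) by (auto simp: regular_def)
qed

lemma inverse_mat:
  fixes A :: "complex mat"
  assumes A: "A \<in> carrier_mat m m" and d: "det A \<noteq> 0"
  obtains C where "C \<in> carrier_mat m m" "A * C = 1\<^sub>m m" "C * A = 1\<^sub>m m"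
  using det_non_zero_imp_unit[OF A d] that unfolding Units_def by (auto simp: ring_mat_simps)

lemma regular_perm:
  assumes f: "bij_betw f N N" "\<And>x. x \<in> N \<Longrightarrow> f (- x) = - f x"
  shows "regular (op (perm f))"
proof -
  let ?g = "inv_into N f"
  have fg: "f (?g x) = x" "?g x \<in> N" if "x \<in> N" for x
    using f(1) that by (auto simp: bij_betw_def f_inv_into_f inv_into_into)
  show ?thesis
  proof (rule regularI[of _ "op (perm ?g)"])
    show "even_op (op (perm f))" using f by (auto simp: even_op_iff perm_def)
    show "op (perm f) * op (perm ?g) = 1\<^sub>m m"
    proof -
      have "op (perm f) * op (perm ?g) = op (perm (\<lambda>x. f (?g x)))"
        by (rule perm_comp) (rule fg(2))
      also have "\<dots> = op (diag (\<lambda>_. 1))" by (rule op_cong) (simp add: perm_def diag_def fg)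
      finally show ?thesis unfolding op_one .
    qed
  qed simp
qed

text \<open>
  The twist multiplies the operator of a permutation by a diagonal matrix of signs, on which
  \<open>delta\<close> is \<open>1\<close>; but it also inverts \<open>delta\<close>.
\<close>

lemma delta_perm_square:
  assumes f: "bij_betw f N N" "\<And>x. x \<in> N \<Longrightarrow> f (- x) = - f x"
  shows "delta (op (perm f)) * delta (op (perm f)) = 1"
proof -
  have "f (- 0) = - f 0" using f(2) zero_in by blast
  then have f0: "f 0 = 0" using minus_fixed[of "f 0"] f(1) zero_in by (metis bij_betwE minus_zero)
  have fN: "f x \<in> N" if "x \<in> N" for x using f(1) that bij_betwE by blast
  have f_nz: "f x \<noteq> 0" if "x \<in> N" "x \<noteq> 0" for x
    using f(1) f0 that zero_in unfolding bij_betw_def inj_on_def by metis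
  let ?d = "\<lambda>y. sgn_of (f y) * sgn_of y"
  have d: "?d (- y) = ?d y" "?d y \<noteq> 0" if "y \<in> N" for y
  proof -
    show "?d (- y) = ?d y"
      by (cases "y = 0") (simp_all add: f(2) that sgn_minus fN f_nz)
    show "?d y \<noteq> 0" by (simp add: sgn_of_def)
  qed
  have fo: "fixes_origin (perm f)"
    using f_nz f0 by (auto simp: fixes_origin_def perm_def)
  have "op (twist (perm f)) = op (perm f) * op (diag ?d)"
    unfolding mult_diag by (rule op_cong) (auto simp: twist_def perm_def)
  then have "delta (op (twist (perm f))) = delta (op (perm f)) * delta (op (diag ?d))"
    using delta_mult[OF regular_perm[OF f] regular_diag[of ?d]] d by auto
  also have "delta (op (diag ?d)) = 1"
    using delta_diag[of ?d] d by (simp add: f0 sgn_zero)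
  finally show ?thesis
    using delta_twist_inverse[OF fo _ regular_perm[OF f]] f0 by (simp add: perm_def)
qed

end

section \<open>Intertwining operators\<close>

context symplectic_space begin

lemma u_sum: "i < n \<Longrightarrow> B (u i) (\<Sum>j<n. f j *s v j) = f i"
proof -
  assume i: "i < n"
  have "B (u i) (\<Sum>j<n. f j *s v j) = (\<Sum>j<n. f j * (if j = i then 1 else 0))"
    using i by (simp add: B_sum_right B_scale_right) (intro sum.cong, auto simp: B_uv)
  then show ?thesis using sum_delta_mult[OF i] by simp
qed

lemma bij_coords:
  "bij_betw (\<lambda>x. \<lambda>i\<in>{..<n}. B (u i) x) N (PiE {..<n} (\<lambda>_. UNIV))"
proof (rule bij_betw_byWitness[where f' = "\<lambda>f. \<Sum>i<n. f i *s v i"])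
  show "\<forall>x\<in>N. (\<Sum>i<n. (\<lambda>i\<in>{..<n}. B (u i) x) i *s v i) = x"
    using prN_of_N by (auto simp: prN_def)
  show "\<forall>f\<in>PiE {..<n} (\<lambda>_. UNIV). (\<lambda>i\<in>{..<n}. B (u i) (\<Sum>i<n. f i *s v i)) = f"
  proof
    fix f :: "nat \<Rightarrow> 'r" assume f: "f \<in> PiE {..<n} (\<lambda>_. UNIV)"
    show "(\<lambda>i\<in>{..<n}. B (u i) (\<Sum>i<n. f i *s v i)) = f"
      using f u_sum by (intro extensionalityI[of _ "{..<n}"]) (auto simp: PiE_def)
  qed
  show "(\<lambda>x. \<lambda>i\<in>{..<n}. B (u i) x) ` N \<subseteq> PiE {..<n} (\<lambda>_. UNIV)"
    by (intro image_subsetI) (simp add: restrict_PiE_iff)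
  show "(\<lambda>f. \<Sum>i<n. f i *s v i) ` PiE {..<n} (\<lambda>_. UNIV) \<subseteq> N"
    unfolding N_def by (intro image_subsetI span_sum span_scale span_base) auto
qed

lemma finite_N: "finite N"
  using bij_betw_finite[OF bij_coords] by (simp add: finite_PiE)

lemma sum_N_prod: "(\<Sum>x\<in>N. \<Prod>i<n. f i (B (u i) x)) = (\<Prod>i<n. \<Sum>r\<in>UNIV. f i r)"
  for f :: "nat \<Rightarrow> 'r \<Rightarrow> complex"
proof -
  have "(\<Prod>i<n. \<Sum>r\<in>UNIV. f i r) = (\<Sum>g\<in>PiE {..<n} (\<lambda>_. UNIV). \<Prod>i<n. f i (g i))"
    by (rule prod_sum_PiE) auto
  also have "\<dots> = (\<Sum>x\<in>N. \<Prod>i<n. f i ((\<lambda>i\<in>{..<n}. B (u i) x) i))"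
    by (rule sum.reindex_bij_betw[OF bij_coords, symmetric])
  also have "\<dots> = (\<Sum>x\<in>N. \<Prod>i<n. f i (B (u i) x))"
    by (intro sum.cong prod.cong) auto
  finally show ?thesis by simp
qed

lemma double_eq_0: "x + x = 0 \<Longrightarrow> x = (0 :: 'v)"
proof -
  assume x: "x + x = 0"
  obtain e where e: "(1 :: 'r) = 2 * e" using two_unit by blast
  have "x = (2 * e) *s x" by (simp flip: e)
  also have "2 * e = e + e" by (rule mult_2)
  also have "(e + e) *s x = e *s (x + x)" by (simp only: scale_left_distrib scale_right_distrib)
  finally show "x = 0" by (simp add: x)
qed

sublocale symmetric_set N
proof
  show "finite N" by (rule finite_N)
  show "0 \<in> N" by (rule N_zero)
  show "- x \<in> N" if "x \<in> N" for x using that by (rule N_minus)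
  show "x = 0" if "x \<in> N" "- x = x" for x
  proof (rule double_eq_0)
    show "x + x = 0" using that(2) by (metis add.right_inverse)
  qed
qed

lemma N_eqI: "x \<in> N \<Longrightarrow> y \<in> N \<Longrightarrow> (\<And>i. i < n \<Longrightarrow> B (u i) x = B (u i) y) \<Longrightarrow> x = y"
  by (rule eq_by_coords) (auto simp: N_iff)

definition dot :: "'v \<Rightarrow> 'v \<Rightarrow> 'r" where "dot z y = (\<Sum>i<n. B (u i) z * B (u i) y)"

lemma B_flip: "y \<in> N \<Longrightarrow> z \<in> N \<Longrightarrow> B (flip y) z = - dot z y"
  using B_coord[of "flip y" z] by (simp add: dot_def flip_v N_iff sum_negf mult.commute)

lemma prN_Sp_fix: "t \<in> Sp_fix scale B M \<Longrightarrow> prN (t x) = prN x"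
proof -
  assume t: "t \<in> Sp_fix scale B M"
  have "B (u i) (t x) = B (u i) x" if "i < n" for i
    using Sp_B[of t "u i" x] t u_in[OF that] by (simp add: Sp_fix_def)
  then show ?thesis by (simp add: prN_def)
qed

text \<open>
  The Schroedinger representation of the Heisenberg group: \<open>heis x\<close> translates by the component of
  \<open>x\<close> in \<open>N\<close>. With the phase written symmetrically in the source \<open>y\<close> and the target \<open>z\<close>, intertwining
  \<open>heis x\<close> with \<open>heis (g x)\<close> needs no correction by the cocycle of the group.
\<close>

definition heis :: "'v \<Rightarrow> complex mat" where
  "heis x = op (\<lambda>z y. if z = y + prN x then lam (B x (y + z)) else 0)"

lemma heis_carrier [simp]: "heis x \<in> carrier_mat m m"
  by (simp add: heis_def)

lemma mult_heis: "op K * heis x = op (\<lambda>z y. K z (y + prN x) * lam (B x (y + (y + prN x))))"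
  unfolding heis_def op_mult
proof (rule op_cong)
  fix z y assume y: "y \<in> N"
  have "(\<Sum>w\<in>N. K z w * (if w = y + prN x then lam (B x (y + w)) else 0))
      = (\<Sum>w\<in>N. if w = y + prN x then K z w * lam (B x (y + w)) else 0)"
    by (intro sum.cong) auto
  then show "(\<Sum>w\<in>N. K z w * (if w = y + prN x then lam (B x (y + w)) else 0))
      = K z (y + prN x) * lam (B x (y + (y + prN x)))"
    using y by (simp add: finite_N N_add)
qed

lemma heis_mult: "heis x * op K = op (\<lambda>z y. lam (B x (z - prN x + z)) * K (z - prN x) y)"
  unfolding heis_def op_mult
proof (rule op_cong)
  fix z y assume z: "z \<in> N"
  have "(\<Sum>w\<in>N. (if z = w + prN x then lam (B x (w + z)) else 0) * K w y)
      = (\<Sum>w\<in>N. if w = z - prN x then lam (B x (w + z)) * K w y else 0)"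
    by (intro sum.cong) auto
  then show "(\<Sum>w\<in>N. (if z = w + prN x then lam (B x (w + z)) else 0) * K w y)
      = lam (B x (z - prN x + z)) * K (z - prN x) y"
    using z by (simp add: finite_N N_diff)
qed

lemma lam_all_eq: "(\<And>r. lam (r * a) = lam (r * b)) \<Longrightarrow> a = b"
proof -
  assume eq: "\<And>r. lam (r * a) = lam (r * b)"
  have "lam (r * (a - b)) = 1" for r
  proof -
    have "lam (r * (a - b)) = lam (r * a) * lam (- (r * b))"
      by (simp add: right_diff_distrib flip: lam_add)
    then show ?thesis by (simp add: eq lam_minus)
  qed
  then have "(\<Sum>r\<in>UNIV. lam (r * (a - b))) = of_nat (card (UNIV :: 'r set))" by simp
  then have "a - b = 0" unfolding sum_lam by (auto split: if_splits)
  then show "a = b" by simp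
qed

text \<open>
  Schur's lemma. Commuting with the multiplication operators \<open>heis x\<close> for \<open>x\<close> in \<open>M\<close> forces a
  diagonal matrix, commuting with the translations a constant one.
\<close>

lemma heis_commutant:
  assumes A: "A \<in> carrier_mat m m" and comm: "\<And>x. A * heis x = heis x * A"
  shows "\<exists>c. A = c \<cdot>\<^sub>m 1\<^sub>m m"
proof -
  obtain K where K: "A = op K" using op_surj[OF A] by blast
  have eq: "K z (y + prN x) * lam (B x (y + (y + prN x))) = lam (B x (z - prN x + z)) * K (z - prN x) y"
    if "z \<in> N" "y \<in> N" for x z y
    using op_eqD[OF comm[of x, unfolded K mult_heis heis_mult] that] .
  have off: "K z y = 0" if zy: "z \<in> N" "y \<in> N" "z \<noteq> y" for z y
  proof (rule ccontr)
    assume nz: "K z y \<noteq> 0"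
    have "B (u i) z = B (u i) y" if i: "i < n" for i
    proof -
      have "lam (r * (2 * B (u i) z)) = lam (r * (2 * B (u i) y))" for r
      proof -
        have "prN (r *s u i) = 0" using u_in[OF i] by (simp add: prN_scale prN_of_M)
        then have "K z y * lam (B (r *s u i) (y + y)) = lam (B (r *s u i) (z + z)) * K z y"
          using eq[OF zy(1,2), of "r *s u i"] by simp
        then have "lam (B (r *s u i) (y + y)) = lam (B (r *s u i) (z + z))"
          using nz by simp
        then show ?thesis by (simp add: B_linear algebra_simps)
      qed
      then have "2 * B (u i) z = 2 * B (u i) y" by (rule lam_all_eq)
      then show ?thesis by (rule unit_mult_cancel[OF two_unit])
    qed
    then show False using N_eqI[OF zy(1,2)] zy(3) by blast
  qed
  have on: "K x x = K 0 0" if x: "x \<in> N" for x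
    using eq[OF x N_zero, of x] by (simp add: prN_of_N[OF x] B_add_right B_NN[OF x x])
  then have "A = op (diag (\<lambda>_. K 0 0))"
    unfolding K
  proof (intro op_cong)
    fix z y assume "z \<in> N" "y \<in> N"
    then show "K z y = diag (\<lambda>_. K 0 0) z y" using off[of z y] on[of y] by (simp add: diag_def)
  qed
  then have "A = K 0 0 \<cdot>\<^sub>m 1\<^sub>m m" by (simp only: scalar_op)
  then show ?thesis ..
qed

text \<open>
  The intertwiners for \<open>g\<close>, which \<open>heis_commutant\<close> determines up to a scalar, normalized by \<open>delta\<close>.
  Evenness is part of \<open>regular\<close>; it passes to products, so it is only checked on generators.
\<close>

definition weil :: "('v \<Rightarrow> 'v) \<Rightarrow> complex mat \<Rightarrow> bool" where
  "weil g A \<longleftrightarrow> regular A \<and> delta A = 1 \<and> (\<forall>x. A * heis x = heis (g x) * A)"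

lemma weil_carrier: "weil g A \<Longrightarrow> A \<in> carrier_mat m m"
  by (simp add: weil_def regular_carrier)

lemma weil_mult:
  assumes "weil g A" "weil h C" shows "weil (g \<circ> h) (A * C)"
proof -
  note [simp] = weil_carrier[OF assms(1)] weil_carrier[OF assms(2)]
  have "(A * C) * heis x = heis (g (h x)) * (A * C)" for x
  proof -
    have "(A * C) * heis x = A * (C * heis x)" by (rule assoc_mult_mat[of _ m m _ m _ m]) auto
    also have "\<dots> = A * (heis (h x) * C)" using assms(2) by (simp add: weil_def)
    also have "\<dots> = (A * heis (h x)) * C" by (rule assoc_mult_mat[of _ m m _ m _ m, symmetric]) auto
    also have "\<dots> = (heis (g (h x)) * A) * C" using assms(1) by (simp add: weil_def)
    also have "\<dots> = heis (g (h x)) * (A * C)" by (rule assoc_mult_mat[of _ m m _ m _ m]) auto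
    finally show ?thesis .
  qed
  then show ?thesis using assms by (simp add: weil_def regular_mult delta_mult)
qed

lemma weil_unique:
  assumes "weil g A" "weil g A'" shows "A = A'"
proof -
  note c [simp] = weil_carrier[OF assms(1)] weil_carrier[OF assms(2)]
  obtain C where C [simp]: "C \<in> carrier_mat m m" and AC: "A * C = 1\<^sub>m m" and CA: "C * A = 1\<^sub>m m"
    using inverse_mat[OF c(1)] assms(1) by (auto simp: weil_def regular_def)
  have "(C * A') * heis x = heis x * (C * A')" for x
  proof -
    have "heis x * C = (C * A) * (heis x * C)" using CA by simp
    also have "\<dots> = C * (A * (heis x * C))" by (rule assoc_mult_mat[of _ m m _ m _ m]) auto
    also have "A * (heis x * C) = (A * heis x) * C" by (rule assoc_mult_mat[of _ m m _ m _ m, symmetric]) auto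
    also have "\<dots> = (heis (g x) * A) * C" using assms(1) by (simp add: weil_def)
    also have "\<dots> = heis (g x) * (A * C)" by (rule assoc_mult_mat[of _ m m _ m _ m]) auto
    also have "\<dots> = heis (g x)" using AC by simp
    finally have 1: "heis x * C = C * heis (g x)" .
    have "(C * A') * heis x = C * (A' * heis x)" by (rule assoc_mult_mat[of _ m m _ m _ m]) auto
    also have "\<dots> = C * (heis (g x) * A')" using assms(2) by (simp add: weil_def)
    also have "\<dots> = (C * heis (g x)) * A'" by (rule assoc_mult_mat[of _ m m _ m _ m, symmetric]) auto
    also have "\<dots> = (heis x * C) * A'" unfolding 1 ..
    also have "\<dots> = heis x * (C * A')" by (rule assoc_mult_mat[of _ m m _ m _ m]) auto
    finally show ?thesis .
  qed
  then obtain k where k: "C * A' = k \<cdot>\<^sub>m 1\<^sub>m m"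
    using heis_commutant[of "C * A'"] by auto
  have "A' = (A * C) * A'" using AC by simp
  also have "\<dots> = A * (C * A')" by (rule assoc_mult_mat[of _ m m _ m _ m]) auto
  also have "\<dots> = k \<cdot>\<^sub>m (A * 1\<^sub>m m)" unfolding k by (rule mult_smult_distrib[of _ m m _ m]) auto
  finally have A': "A' = k \<cdot>\<^sub>m A" by simp
  have "k \<noteq> 0"
  proof
    assume "k = 0"
    have "m > 0" unfolding m_def using finite_N N_zero by (metis card_gt_0_iff empty_iff)
    then have "det A' = 0" unfolding A' det_smult using carrier_matD(2)[OF c(1)] \<open>k = 0\<close> by simp
    then show False using assms(2) by (simp add: weil_def regular_def)
  qed
  then have "k = 1" using assms delta_smult[of A k] unfolding weil_def A' by simp
  then show ?thesis unfolding A' by (intro eq_matI) auto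
qed

definition fix_op :: "('v \<Rightarrow> 'v) \<Rightarrow> complex mat" where
  "fix_op t = op (diag (\<lambda>y. lam (B (t y) y)))"

text \<open>On diagonal operators \<open>delta\<close> is the value at the origin, here \<open>lam 0 = 1\<close>.\<close>

lemma weil_fix:
  assumes t: "t \<in> Sp_fix scale B M"
  shows "weil t (fix_op t)"
proof -
  note tS = Sp_fix_subset[OF t]
  have d: "lam (B (t (- y)) (- y)) = lam (B (t y) y)" for y
    by (simp add: Sp_minus[OF tS] B_linear)
  have "fix_op t * heis x = heis (t x) * fix_op t" for x
  proof -
    let ?b = "prN x"
    have tM: "t y - y \<in> M" if "y \<in> N" for y
    proof -
      have "prN (t y - y) = 0" using prN_Sp_fix[OF t, of y] prN_add[of "t y - y" y] by simp
      then show ?thesis using decomp[of "t y - y"] prM_in[of "t y - y"] by simp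
    qed
    have "t x - x = t ?b - ?b"
    proof -
      have "t (prM x) = prM x" using t by (simp add: Sp_fix_def)
      then have "t x = prM x + t ?b" using decomp[of x] Sp_add[OF tS, of "prM x" ?b] by simp
      then show ?thesis using decomp[of x] by (metis add_diff_cancel_left)
    qed
    then have tx: "t x = x + (t ?b - ?b)" by (metis add_diff_cancel_left' diff_add_cancel add.commute)
    have sym: "B (t y) w = B (t w) y" if "y \<in> N" "w \<in> N" for y w
    proof -
      have MM: "B (t y - y) (t w - w) = 0" by (rule B_MM[OF tM tM]) fact+
      have tt: "B (t y) (t w) = 0" using B_NN[OF that] by (simp add: Sp_B[OF tS])
      have "B (t y) w + B y (t w) = 0"
        using MM unfolding B_diff_left B_diff_right tt B_NN[OF that] by (simp add: add_eq_0_iff2)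
      then show ?thesis using B_skew[of y "t w"] by simp
    qed
    have key: "B (t (y + ?b)) (y + ?b) + B x (y + (y + ?b)) = B (t x) (y + (y + ?b)) + B (t y) y" if y: "y \<in> N" for y
    proof -
      have "B (t x) (y + (y + ?b)) = B x (y + (y + ?b)) + B (t ?b) (y + (y + ?b))"
        unfolding arg_cong[OF tx, of "\<lambda>w. B w (y + (y + ?b))"]
        using B_NN[OF prN_in[of x] N_add[OF y N_add[OF y prN_in[of x]]]]
        by (simp add: B_add_left B_diff_left)
      moreover have "B (t (y + ?b)) (y + ?b) = B (t y) y + B (t ?b) (y + (y + ?b))"
        using sym[OF y prN_in[of x]] by (simp add: Sp_add[OF tS] B_linear)
      ultimately show ?thesis by simp
    qed
    have "fix_op t * heis x = op (\<lambda>z y. lam (B (t z) z) * (if z = y + ?b then lam (B x (y + z)) else 0))"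
      unfolding fix_op_def heis_def by (rule diag_mult)
    also have "\<dots> = op (\<lambda>z y. (if z = y + prN (t x) then lam (B (t x) (y + z)) else 0) * lam (B (t y) y))"
    proof (rule op_cong)
      fix z y assume "y \<in> N"
      then show "lam (B (t z) z) * (if z = y + ?b then lam (B x (y + z)) else 0)
          = (if z = y + prN (t x) then lam (B (t x) (y + z)) else 0) * lam (B (t y) y)"
        using key by (simp add: prN_Sp_fix[OF t] flip: lam_add)
    qed
    also have "\<dots> = heis (t x) * fix_op t"
      unfolding fix_op_def heis_def by (rule mult_diag[symmetric])
    finally show ?thesis .
  qed
  then show ?thesis
    unfolding weil_def fix_op_def using regular_diag[of "\<lambda>y. lam (B (t y) y)"] delta_diag[of "\<lambda>y. lam (B (t y) y)"]
    by (simp add: d lam_nz)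
qed

definition gauss_const :: complex where "gauss_const = inverse (gauss_sum lam ^ n)"

definition fourier :: "complex mat" where
  "fourier = op (\<lambda>z y. gauss_const * lam (- 2 * dot z y))"

lemma gauss_const_nz: "gauss_const \<noteq> 0"
  by (simp add: gauss_const_def gauss_sum_neq_0)

lemma dot_minus: "dot (- z) y = - dot z y" "dot z (- y) = - dot z y"
  by (simp_all add: dot_def B_linear sum_negf)

lemma even_fourier: "even_op fourier"
  unfolding fourier_def even_op_iff by (simp add: dot_minus)

lemma heis_fourier: "fourier * heis x = heis (flip x) * fourier"
proof -
  let ?a = "prM x" and ?b = "prN x"
  have x: "x = ?a + ?b" by (rule decomp)
  have fl: "flip x = flip ?a + flip ?b" using Sp_add[OF flip_in_Sp, of ?a ?b] x by simp
  have prN_flip: "prN (flip x) = flip ?a"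
    by (subst fl) (simp add: prN_add prN_of_N[OF flip_M[OF prM_in]] prN_of_M[OF flip_N[OF prN_in]])
  have key: "2 * B (flip (y + ?b)) z + B x (y + (y + ?b))
      = B (flip x) (z - flip ?a + z) + 2 * B (flip y) (z - flip ?a)"
    if y: "y \<in> N" and z: "z \<in> N" for y z
  proof -
    note faN = flip_M[OF prM_in[of x]]
    have 1: "B x w = B ?a w" if "w \<in> N" for w
      using x B_add_left[of ?a ?b w] B_NN[OF prN_in that] by simp
    have 2: "B (flip x) w = B (flip ?b) w" if "w \<in> N" for w
      unfolding fl using B_add_left[of "flip ?a" "flip ?b" w] B_NN[OF faN that] by simp
    have 3: "B (flip w) (flip ?a) = B w ?a" for w by (rule Sp_B[OF flip_in_Sp])
    have "B x (y + (y + ?b)) = B ?a y + B ?a y + B ?a ?b"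
      using 1[OF N_add[OF y N_add[OF y prN_in]]] by (simp add: B_add_right)
    moreover have "B (flip x) (z - flip ?a + z) = B (flip ?b) z + B (flip ?b) z - B ?b ?a"
      using 2[OF N_add[OF N_diff[OF z faN] z]] by (simp add: B_linear 3)
    ultimately show ?thesis
      by (simp add: Sp_add[OF flip_in_Sp] B_linear 3 B_skew[of ?b ?a] B_skew[of y ?a] algebra_simps)
  qed
  have eq: "- 2 * dot z w = 2 * B (flip w) z" if "z \<in> N" "w \<in> N" for z w
    using B_flip[OF that(2,1)] by simp
  show ?thesis
    unfolding fourier_def mult_heis heis_mult
  proof (rule op_cong)
    fix z y assume z: "z \<in> N" and y: "y \<in> N"
    have "lam (- 2 * dot z (y + ?b)) * lam (B x (y + (y + ?b)))
        = lam (B (flip x) (z - prN (flip x) + z)) * lam (- 2 * dot (z - prN (flip x)) y)"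
      unfolding prN_flip eq[OF z N_add[OF y prN_in]] eq[OF N_diff[OF z flip_M[OF prM_in]] y]
      unfolding lam_add[symmetric] key[OF y z] ..
    then show "gauss_const * lam (- 2 * dot z (y + ?b)) * lam (B x (y + (y + ?b)))
        = lam (B (flip x) (z - prN (flip x) + z)) * (gauss_const * lam (- 2 * dot (z - prN (flip x)) y))"
      by (simp only: ac_simps)
  qed
qed

definition quad :: "(nat \<Rightarrow> 'r) \<Rightarrow> 'v \<Rightarrow> 'r" where "quad a y = (\<Sum>i<n. a i * B (u i) y ^ 2)"

definition scl :: "(nat \<Rightarrow> 'r) \<Rightarrow> 'v \<Rightarrow> 'v" where "scl a y = (\<Sum>i<n. (a i * B (u i) y) *s v i)"

lemma scl_in: "scl a y \<in> N"
  unfolding scl_def N_def by (intro span_sum span_scale span_base) auto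

lemma u_scl: "i < n \<Longrightarrow> B (u i) (scl a y) = a i * B (u i) y"
  unfolding scl_def by (rule u_sum)

lemma scl_scl: "y \<in> N \<Longrightarrow> (\<And>i. i < n \<Longrightarrow> a i * a' i = 1) \<Longrightarrow> scl a (scl a' y) = y"
  by (rule N_eqI) (simp_all add: scl_in u_scl flip: mult.assoc)

lemma gauss_shifted:
  assumes "a * a' = (1 :: 'r)"
  shows "(\<Sum>r\<in>UNIV. lam (a' * r ^ 2 - 2 * (r * s))) = lam (- (a * s ^ 2)) * (\<Sum>r\<in>UNIV. lam (a' * r ^ 2))"
proof -
  have "(\<Sum>r\<in>UNIV. lam (a' * r ^ 2 - 2 * (r * s)))
      = (\<Sum>r\<in>UNIV. lam (a' * (r + a * s) ^ 2 - 2 * ((r + a * s) * s)))"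
    using sum_shift_ideal[OF ring_ideal_UNIV UNIV_I, of "\<lambda>r. lam (a' * r ^ 2 - 2 * (r * s))" "a * s"] by simp
  also have "\<dots> = (\<Sum>r\<in>UNIV. lam (- (a * s ^ 2) + a' * r ^ 2))"
  proof (intro sum.cong refl arg_cong[where f = lam])
    fix r
    have "a' * (r + a * s) ^ 2 = a' * r ^ 2 + 2 * ((a * a') * (r * s)) + (a * a') * (a * s ^ 2)"
      by (simp add: power2_eq_square algebra_simps)
    then show "a' * (r + a * s) ^ 2 - 2 * ((r + a * s) * s) = - (a * s ^ 2) + a' * r ^ 2"
      unfolding assms by (simp add: power2_eq_square algebra_simps)
  qed
  finally show ?thesis by (simp only: lam_add sum_distrib_left)
qed

text \<open>
  With \<open>t\<close> the element of \<open>Sp_fix scale B M\<close> given by a diagonal form \<open>a\<close>, \<open>t'\<close> that of the inverse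
  form and \<open>s\<close> the flip, \<open>t s t' s t\<close> is \<open>s\<close> up to an element of the Levi subgroup. For the operators,
  completing the square turns the sum over \<open>N\<close> into a product of Gauss sums, and the
  normalizing factor of the Fourier transform leaves the product of their signs.
\<close>

lemma braid:
  assumes aa: "\<And>i. i < n \<Longrightarrow> a i * a' i = 1"
  defines "T \<equiv> \<lambda>a. op (diag (\<lambda>y. lam (quad a y)))"
  shows "T a * (fourier * (T a' * (fourier * T a)))
    = (\<Prod>i<n. quad_char (a' i)) \<cdot>\<^sub>m (op (perm (scl a')) * fourier)"
proof -
  let ?c = "gauss_const"
  let ?K = "\<lambda>z y. lam (quad a z) * (\<Sum>w\<in>N. ?c * lam (- 2 * dot z w) *
      (lam (quad a' w) * (?c * lam (- 2 * dot w y) * lam (quad a y))))"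
  have L: "T a * (fourier * (T a' * (fourier * T a))) = op ?K"
  proof -
    have "fourier * T a = op (\<lambda>w y. ?c * lam (- 2 * dot w y) * lam (quad a y))"
      unfolding T_def fourier_def by (rule mult_diag)
    then have "T a' * (fourier * T a) = op (\<lambda>w y. lam (quad a' w) * (?c * lam (- 2 * dot w y) * lam (quad a y)))"
      unfolding T_def by (simp only: diag_mult)
    then show ?thesis
      unfolding T_def fourier_def by (simp only: op_mult[where L = "\<lambda>w y. _ w * (_ w y * _ y)"] diag_mult)
  qed
  have aa': "a' i * a i = 1" if "i < n" for i using aa[OF that] by (simp add: mult.commute)
  have pc: "op (perm (scl a')) * fourier = op (\<lambda>z y. ?c * lam (- 2 * dot (scl a z) y))"
    unfolding fourier_def
    by (rule perm_mult) (use scl_in scl_scl[OF _ aa] scl_scl[OF _ aa'] in auto)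
  have "?K z y = (\<Prod>i<n. quad_char (a' i)) * (?c * lam (- 2 * dot (scl a z) y))" if "z \<in> N" "y \<in> N" for z y
  proof -
    let ?z = "\<lambda>i. B (u i) z" and ?y = "\<lambda>i. B (u i) y"
    have "(\<Sum>w\<in>N. ?c * lam (- 2 * dot z w) * (lam (quad a' w) * (?c * lam (- 2 * dot w y) * lam (quad a y))))
       = ?c * ?c * lam (quad a y) * (\<Sum>w\<in>N. lam (- 2 * dot z w) * lam (quad a' w) * lam (- 2 * dot w y))"
      unfolding sum_distrib_left by (intro sum.cong refl) (simp only: ac_simps)
    also have "(\<Sum>w\<in>N. lam (- 2 * dot z w) * lam (quad a' w) * lam (- 2 * dot w y))
       = (\<Sum>w\<in>N. \<Prod>i<n. lam (a' i * B (u i) w ^ 2 - 2 * (B (u i) w * (?z i + ?y i))))"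
    proof (intro sum.cong refl)
      fix w
      have "- 2 * dot z w + quad a' w + - 2 * dot w y
          = (\<Sum>i<n. a' i * B (u i) w ^ 2 - 2 * (B (u i) w * (?z i + ?y i)))"
        unfolding dot_def quad_def sum_distrib_left sum.distrib[symmetric]
        by (intro sum.cong refl) (simp add: algebra_simps)
      then show "lam (- 2 * dot z w) * lam (quad a' w) * lam (- 2 * dot w y)
          = (\<Prod>i<n. lam (a' i * B (u i) w ^ 2 - 2 * (B (u i) w * (?z i + ?y i))))"
        by (simp only: lam_add[symmetric] lam_sum[OF finite_lessThan, symmetric])
    qed
    also have "\<dots> = (\<Prod>i<n. \<Sum>r\<in>UNIV. lam (a' i * r ^ 2 - 2 * (r * (?z i + ?y i))))"
      by (rule sum_N_prod[of "\<lambda>i r. lam (a' i * r ^ 2 - 2 * (r * (?z i + ?y i)))"])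
    also have "\<dots> = (\<Prod>i<n. lam (- (a i * (?z i + ?y i) ^ 2)) * (quad_char (a' i) * gauss_sum lam))"
    proof (intro prod.cong refl)
      fix i assume "i \<in> {..<n}"
      then have i: "i < n" by simp
      have "a' i dvd 1" using aa'[OF i] by (metis dvd_triv_left)
      then show "(\<Sum>r\<in>UNIV. lam (a' i * r ^ 2 - 2 * (r * (?z i + ?y i))))
          = lam (- (a i * (?z i + ?y i) ^ 2)) * (quad_char (a' i) * gauss_sum lam)"
        by (simp only: gauss_shifted[OF aa[OF i]] gauss_sum_scaled)
    qed
    also have "\<dots> = lam (\<Sum>i<n. - (a i * (?z i + ?y i) ^ 2)) * ((\<Prod>i<n. quad_char (a' i)) * gauss_sum lam ^ n)"
      by (simp add: prod.distrib lam_sum)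
    finally have "?K z y = lam (quad a z) * (?c * ?c * lam (quad a y) *
        (lam (\<Sum>i<n. - (a i * (?z i + ?y i) ^ 2)) * ((\<Prod>i<n. quad_char (a' i)) * gauss_sum lam ^ n)))"
      by simp
    also have "\<dots> = (?c * gauss_sum lam ^ n) * (\<Prod>i<n. quad_char (a' i)) *
        (?c * (lam (quad a z) * lam (quad a y) * lam (\<Sum>i<n. - (a i * (?z i + ?y i) ^ 2))))"
      by (simp only: ac_simps)
    also have "?c * gauss_sum lam ^ n = 1" by (simp add: gauss_const_def gauss_sum_neq_0)
    also have "lam (quad a z) * lam (quad a y) * lam (\<Sum>i<n. - (a i * (?z i + ?y i) ^ 2))
        = lam (- 2 * dot (scl a z) y)"
    proof -
      have "quad a z + quad a y + (\<Sum>i<n. - (a i * (?z i + ?y i) ^ 2))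
          = (\<Sum>i<n. - 2 * (a i * ?z i * ?y i))"
        unfolding quad_def sum.distrib[symmetric]
        by (intro sum.cong refl) (simp add: power2_eq_square algebra_simps)
      also have "\<dots> = - 2 * dot (scl a z) y"
        unfolding dot_def sum_distrib_left by (intro sum.cong refl) (simp add: u_scl)
      finally show ?thesis by (simp only: lam_add[symmetric])
    qed
    finally show ?thesis by simp
  qed
  then show ?thesis unfolding L pc op_smult by (intro op_cong) simp
qed

lemma regular_quad: "regular (op (diag (\<lambda>y. lam (quad a y))))"
  and delta_quad: "delta (op (diag (\<lambda>y. lam (quad a y)))) = 1"
proof -
  have "quad a (- y) = quad a y" for y by (simp add: quad_def B_linear)
  then show "regular (op (diag (\<lambda>y. lam (quad a y))))" "delta (op (diag (\<lambda>y. lam (quad a y)))) = 1"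
    using regular_diag[of "\<lambda>y. lam (quad a y)"] delta_diag[of "\<lambda>y. lam (quad a y)"] lam_nz
    by (simp_all add: quad_def power2_eq_square)
qed

lemma regular_fourier: "regular fourier"
proof -
  let ?k = "gauss_const * gauss_const * of_nat (card (UNIV :: 'r set)) ^ n"
  have "fourier * fourier = ?k \<cdot>\<^sub>m op (perm uminus)"
    unfolding fourier_def op_mult op_smult
  proof (rule op_cong)
    fix z y assume zy: "z \<in> N" "y \<in> N"
    have "(\<Sum>w\<in>N. gauss_const * lam (- 2 * dot z w) * (gauss_const * lam (- 2 * dot w y)))
        = gauss_const * gauss_const * (\<Sum>w\<in>N. \<Prod>i<n. lam (B (u i) w * (- 2 * (B (u i) z + B (u i) y))))"
      unfolding sum_distrib_left
    proof (intro sum.cong refl)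
      fix w
      have "- 2 * dot z w + - 2 * dot w y = (\<Sum>i<n. B (u i) w * (- 2 * (B (u i) z + B (u i) y)))"
        unfolding dot_def sum_distrib_left sum.distrib[symmetric]
        by (intro sum.cong refl) (simp add: algebra_simps)
      then have "lam (- 2 * dot z w) * lam (- 2 * dot w y) = (\<Prod>i<n. lam (B (u i) w * (- 2 * (B (u i) z + B (u i) y))))"
        by (simp only: lam_add[symmetric] lam_sum[OF finite_lessThan, symmetric])
      then show "gauss_const * lam (- 2 * dot z w) * (gauss_const * lam (- 2 * dot w y))
          = gauss_const * gauss_const * (\<Prod>i<n. lam (B (u i) w * (- 2 * (B (u i) z + B (u i) y))))"
        by (simp only: ac_simps)
    qed
    also have "(\<Sum>w\<in>N. \<Prod>i<n. lam (B (u i) w * (- 2 * (B (u i) z + B (u i) y))))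
        = (\<Prod>i<n. \<Sum>r\<in>UNIV. lam (r * (- 2 * (B (u i) z + B (u i) y))))"
      by (rule sum_N_prod[of "\<lambda>i r. lam (r * (- 2 * (B (u i) z + B (u i) y)))"])
    also have "\<dots> = (if z = - y then of_nat (card (UNIV :: 'r set)) ^ n else 0)"
    proof (cases "z = - y")
      case True then show ?thesis by (simp add: B_minus_right)
    next
      case False
      have "\<exists>i<n. B (u i) z + B (u i) y \<noteq> 0"
      proof (rule ccontr)
        assume "\<not> ?thesis"
        then have "B (u i) z = B (u i) (- y)" if "i < n" for i
          using that by (simp add: B_minus_right eq_neg_iff_add_eq_0)
        then show False using N_eqI[of z "- y"] zy N_minus False by blast
      qed
      then obtain i where i: "i < n" "B (u i) z + B (u i) y \<noteq> 0" by blast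
      have "(\<Sum>r\<in>UNIV. lam (r * (- 2 * (B (u i) z + B (u i) y)))) = 0"
      proof -
        have "- 2 * (B (u i) z + B (u i) y) \<noteq> 0"
          using two_cancel[of "B (u i) z + B (u i) y"] i(2)
          by (simp only: mult_minus_left neg_equal_0_iff_equal not_False_eq_True)
        then show ?thesis unfolding sum_lam by (simp only: if_False)
      qed
      then show ?thesis using i(1) False by (auto intro: prod_zero)
    qed
    finally show "(\<Sum>w\<in>N. gauss_const * lam (- 2 * dot z w) * (gauss_const * lam (- 2 * dot w y))) = ?k * perm uminus z y"
      by (simp add: perm_def)
  qed
  moreover have "regular (?k \<cdot>\<^sub>m op (perm uminus))"
  proof (intro regular_smult regular_perm)
    show "bij_betw uminus N N" by (rule bij_betw_byWitness[where f' = uminus]) (auto simp: N_minus)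
  qed (simp_all add: gauss_const_nz)
  ultimately have "det (fourier * fourier) \<noteq> 0" by (simp add: regular_def)
  then have "det fourier \<noteq> 0" using det_mult[of fourier m fourier] even_op_carrier[OF even_fourier] by auto
  then show ?thesis using even_fourier by (simp add: regular_def)
qed

lemma delta_braid:
  assumes aa: "\<And>i. i < n \<Longrightarrow> a i * a' i = 1"
  shows "delta fourier = (\<Prod>i<n. quad_char (a' i)) * delta (op (perm (scl a')))"
proof -
  let ?T = "\<lambda>a. op (diag (\<lambda>y. lam (quad a y)))"
  have aa': "a' i * a i = 1" if "i < n" for i using aa[OF that] by (simp add: mult.commute)
  have bij: "bij_betw (scl a') N N"
    by (rule bij_betw_byWitness[where f' = "scl a"]) (use scl_in scl_scl[OF _ aa] scl_scl[OF _ aa'] in auto)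
  have min: "scl a' (- y) = - scl a' y" for y by (simp add: scl_def B_linear sum_negf)
  have rp: "regular (op (perm (scl a')))" by (rule regular_perm[OF bij min])
  have nz: "(\<Prod>i<n. quad_char (a' i)) \<noteq> (0 :: complex)"
    using quad_char_cases by (auto simp: prod_zero_iff) (metis one_neq_neg_one zero_neq_neg_one zero_neq_one)
  have b: "?T a * (fourier * (?T a' * (fourier * ?T a)))
      = (\<Prod>i<n. quad_char (a' i)) \<cdot>\<^sub>m (op (perm (scl a')) * fourier)"
    by (rule braid[OF aa])
  have "delta (?T a * (fourier * (?T a' * (fourier * ?T a)))) = delta fourier * delta fourier"
    by (simp add: delta_mult regular_mult regular_quad delta_quad regular_fourier)
  moreover have "delta ((\<Prod>i<n. quad_char (a' i)) \<cdot>\<^sub>m (op (perm (scl a')) * fourier))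
      = (\<Prod>i<n. quad_char (a' i)) * (delta (op (perm (scl a'))) * delta fourier)"
    by (simp add: delta_smult delta_mult regular_mult regular_fourier rp nz)
  ultimately have "delta fourier * delta fourier = ((\<Prod>i<n. quad_char (a' i)) * delta (op (perm (scl a')))) * delta fourier"
    by (simp only: b mult.assoc)
  then show ?thesis using delta_neq_0[OF regular_fourier] by (simp only: mult_cancel_right) simp
qed

text \<open>For \<open>a = 1\<close> the relation is \<open>t s t s t = s\<close>, so \<open>delta\<close> of the Fourier transform is its own square.\<close>

lemma delta_fourier: "delta fourier = 1"
proof -
  have "op (perm (scl (\<lambda>_. 1))) = 1\<^sub>m m"
    unfolding op_one[symmetric]
    by (rule op_cong) (auto simp: perm_def diag_def scl_def prN_of_N[unfolded prN_def])
  then show ?thesis using delta_braid[of "\<lambda>_. 1" "\<lambda>_. 1"] by (simp add: quad_char_1 delta_one)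
qed

lemma weil_flip: "weil flip fourier"
  unfolding weil_def using regular_fourier delta_fourier heis_fourier by blast

lemma weil_exists: "g \<in> Spc \<Longrightarrow> \<exists>A. weil g A"
  using Sp_induct[of "\<lambda>g. \<exists>A. weil g A"] weil_fix weil_flip weil_mult by blast

end

section \<open>The Levi subgroup\<close>

context symplectic_space begin

definition act :: "'r mat \<Rightarrow> 'v \<Rightarrow> 'v" where
  "act A y = (\<Sum>i<n. (\<Sum>j<n. A $$ (i, j) * B (u j) y) *s v i)"

lemma u_act: "i < n \<Longrightarrow> B (u i) (act A y) = (\<Sum>j<n. A $$ (i, j) * B (u j) y)"
  unfolding act_def by (rule u_sum)

lemma act_in: "act A y \<in> N"
  unfolding act_def N_def by (intro span_sum span_scale span_base) auto

lemma mult_entry: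
  "A \<in> carrier_mat n n \<Longrightarrow> C \<in> carrier_mat n n \<Longrightarrow> i < n \<Longrightarrow> j < n \<Longrightarrow>
    (A * C) $$ (i, j) = (\<Sum>k<n. A $$ (i, k) * C $$ (k, j))" for A C :: "'r mat"
  by (auto simp: scalar_prod_def atLeast0LessThan)

lemma act_mult:
  assumes "A \<in> carrier_mat n n" "C \<in> carrier_mat n n"
  shows "act (A * C) y = act A (act C y)"
proof (rule N_eqI)
  fix i assume i: "i < n"
  have "B (u i) (act (A * C) y) = (\<Sum>j<n. (\<Sum>k<n. A $$ (i, k) * C $$ (k, j)) * B (u j) y)"
    unfolding u_act[OF i] by (intro sum.cong refl) (use i assms in \<open>simp add: mult_entry del: index_mult_mat\<close>)
  also have "\<dots> = (\<Sum>k<n. A $$ (i, k) * (\<Sum>j<n. C $$ (k, j) * B (u j) y))"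
    unfolding sum_distrib_left sum_distrib_right by (subst sum.swap) (simp add: mult.assoc)
  also have "\<dots> = B (u i) (act A (act C y))"
    unfolding u_act[OF i] by (intro sum.cong refl) (simp add: u_act)
  finally show "B (u i) (act (A * C) y) = B (u i) (act A (act C y))" .
qed (rule act_in)+

lemma act_one: "y \<in> N \<Longrightarrow> act (1\<^sub>m n) y = y"
proof (rule N_eqI)
  fix i assume i: "i < n"
  have "(\<Sum>j<n. 1\<^sub>m n $$ (i, j) * B (u j) y) = (\<Sum>j<n. if j = i then B (u j) y else 0)"
    using i by (intro sum.cong) auto
  then show "B (u i) (act (1\<^sub>m n) y) = B (u i) y" using i by (simp add: u_act)
qed (simp_all add: act_in)

lemma act_minus: "act A (- y) = - act A y"
  by (simp add: act_def B_minus_right sum_negf)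

definition unit_mat :: "'r mat \<Rightarrow> bool" where
  "unit_mat A \<longleftrightarrow> A \<in> carrier_mat n n \<and> (\<exists>C\<in>carrier_mat n n. C * A = 1\<^sub>m n)"

lemma unit_mat_carrier: "unit_mat A \<Longrightarrow> A \<in> carrier_mat n n"
  by (simp add: unit_mat_def)

lemma unit_mat_mult: "unit_mat A \<Longrightarrow> unit_mat C \<Longrightarrow> unit_mat (A * C)"
proof -
  assume "unit_mat A" "unit_mat C"
  then obtain A' C' where c: "A \<in> carrier_mat n n" "C \<in> carrier_mat n n" "A' \<in> carrier_mat n n" "C' \<in> carrier_mat n n"
    and i: "A' * A = 1\<^sub>m n" "C' * C = 1\<^sub>m n" unfolding unit_mat_def by blast
  have "(C' * A') * (A * C) = C' * (A' * (A * C))" using c by (intro assoc_mult_mat[of _ n n _ n _ n]) auto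
  also have "A' * (A * C) = (A' * A) * C" using c by (intro assoc_mult_mat[of _ n n _ n _ n, symmetric]) auto
  also have "\<dots> = C" using i c by simp
  finally have "(C' * A') * (A * C) = 1\<^sub>m n" using i by simp
  then show ?thesis unfolding unit_mat_def using c mult_carrier_mat by blast
qed

lemma unit_mat_one: "unit_mat (1\<^sub>m n)"
  unfolding unit_mat_def by (auto intro!: bexI[of _ "1\<^sub>m n"])

lemma unit_mat_det: "unit_mat A \<Longrightarrow> det A dvd 1"
proof -
  assume "unit_mat A"
  then obtain C where "A \<in> carrier_mat n n" "C \<in> carrier_mat n n" "C * A = 1\<^sub>m n" unfolding unit_mat_def by blast
  then have "det C * det A = 1" using det_mult[of C n A] by simp
  then show ?thesis by (intro dvdI[of _ _ "det C"]) (simp add: mult.commute)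
qed

lemma bij_act: "unit_mat A \<Longrightarrow> bij_betw (act A) N N"
proof -
  assume "unit_mat A"
  then obtain C where c: "A \<in> carrier_mat n n" "C \<in> carrier_mat n n" "C * A = 1\<^sub>m n" unfolding unit_mat_def by blast
  have "act C (act A y) = y" if "y \<in> N" for y
    using act_mult[OF c(2,1), of y] c(3) act_one[OF that] by simp
  then have "inj_on (act A) N" by (metis inj_onI)
  moreover have "act A ` N \<subseteq> N" using act_in by blast
  ultimately show ?thesis using endo_inj_surj[OF finite_N] by (simp add: bij_betw_def)
qed

definition levi_sign :: "'r mat \<Rightarrow> complex" where "levi_sign A = delta (op (perm (act A)))"

lemma levi_sign_mult: "unit_mat A \<Longrightarrow> unit_mat C \<Longrightarrow> levi_sign (A * C) = levi_sign A * levi_sign C"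
proof -
  assume A: "unit_mat A" and C: "unit_mat C"
  have "op (perm (act A)) * op (perm (act C)) = op (perm (\<lambda>x. act A (act C x)))"
    by (rule perm_comp) (rule act_in)
  also have "(\<lambda>x. act A (act C x)) = act (A * C)"
    using act_mult[OF unit_mat_carrier[OF A] unit_mat_carrier[OF C]] by (simp add: fun_eq_iff)
  finally show ?thesis
    unfolding levi_sign_def using delta_mult[OF regular_perm[OF bij_act[OF A] act_minus] regular_perm[OF bij_act[OF C] act_minus]]
    by simp
qed

lemma levi_sign_square: "unit_mat A \<Longrightarrow> levi_sign A * levi_sign A = 1"
  unfolding levi_sign_def by (rule delta_perm_square[OF bij_act act_minus])

text \<open>
  Invertible matrices on whose permutation operator \<open>delta\<close> is the quadratic character of the
  determinant. It turns out that all invertible matrices have this property.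
\<close>

definition sign_mat :: "'r mat \<Rightarrow> bool" where
  "sign_mat A \<longleftrightarrow> unit_mat A \<and> levi_sign A = quad_char (det A)"

lemma sign_mat_mult: "sign_mat A \<Longrightarrow> sign_mat C \<Longrightarrow> sign_mat (A * C)"
  unfolding sign_mat_def
  by (simp add: unit_mat_mult levi_sign_mult det_mult[OF unit_mat_carrier unit_mat_carrier] quad_char_mult unit_mat_det)

lemma quad_char_square: "quad_char a * quad_char a = 1" for a :: 'r
  using quad_char_cases[of a] by auto

text \<open>Both sides of the defining equation are multiplicative signs, and so equal to \<open>1\<close> on squares.\<close>

lemma sign_mat_square: "unit_mat A \<Longrightarrow> sign_mat (A * A)"
  unfolding sign_mat_def
  by (simp add: unit_mat_mult levi_sign_mult det_mult[OF unit_mat_carrier unit_mat_carrier] quad_char_mult unit_mat_det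
      levi_sign_square quad_char_square)

lemma sign_mat_one: "sign_mat (1\<^sub>m n)"
  using sign_mat_square[OF unit_mat_one] by simp

lemma sign_mat_cancel:
  assumes "sign_mat H'" "H' * H = 1\<^sub>m n" "H \<in> carrier_mat n n" "A \<in> carrier_mat n n" "sign_mat (H * A)"
  shows "sign_mat A"
proof -
  have c: "H' \<in> carrier_mat n n" using assms(1) unit_mat_carrier by (simp add: sign_mat_def)
  have "H' * (H * A) = (H' * H) * A" using c assms(3,4) by (intro assoc_mult_mat[of _ n n _ n _ n, symmetric]) auto
  also have "\<dots> = A" using assms(2,4) by simp
  finally show ?thesis using sign_mat_mult[OF assms(1,5)] by simp
qed

text \<open>The elementary matrix that differs from the identity by \<open>x\<close> in column \<open>k\<close>.\<close>

definition col_add :: "nat \<Rightarrow> (nat \<Rightarrow> 'r) \<Rightarrow> 'r mat" where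
  "col_add k x = mat n n (\<lambda>(i, j). (if i = j then 1 else 0) + (if j = k then x i else 0))"

lemma col_add_carrier [simp]: "col_add k x \<in> carrier_mat n n"
  by (simp add: col_add_def)

lemma col_add_mult:
  assumes A: "A \<in> carrier_mat n n" and k: "k < n" and ij: "i < n" "j < n"
  shows "(col_add k x * A) $$ (i, j) = A $$ (i, j) + x i * A $$ (k, j)"
proof -
  have "(col_add k x * A) $$ (i, j)
      = (\<Sum>l<n. (if l = i then A $$ (l, j) else 0) + (if l = k then x i * A $$ (l, j) else 0))"
    unfolding mult_entry[OF col_add_carrier A ij]
    by (intro sum.cong refl) (use ij in \<open>auto simp: col_add_def algebra_simps\<close>)
  then show ?thesis using ij k by (simp add: sum.distrib)
qed

lemma col_add_add:
  assumes k: "k < n" and y: "y k = 0"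
  shows "col_add k x * col_add k y = col_add k (\<lambda>i. x i + y i)"
proof (rule eq_matI)
  fix i j assume "i < dim_row (col_add k (\<lambda>i. x i + y i))" "j < dim_col (col_add k (\<lambda>i. x i + y i))"
  then have "i < n" "j < n" by (simp_all add: col_add_def)
  then show "(col_add k x * col_add k y) $$ (i, j) = col_add k (\<lambda>i. x i + y i) $$ (i, j)"
    unfolding col_add_mult[OF col_add_carrier k \<open>i < n\<close> \<open>j < n\<close>] using k y by (auto simp: col_add_def)
qed (simp_all add: col_add_def)

lemma col_add_zero: "(\<And>i. i < n \<Longrightarrow> x i = 0) \<Longrightarrow> col_add k x = 1\<^sub>m n"
  by (rule eq_matI) (auto simp: col_add_def)

lemma col_add_inverse:
  assumes "k < n" "x k = 0"
  shows "col_add k (\<lambda>i. - x i) * col_add k x = 1\<^sub>m n"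
  using col_add_add[of k x "\<lambda>i. - x i", OF assms] by (simp add: col_add_zero)

text \<open>As \<open>2\<close> is a unit, the matrix is the square of the one for \<open>x / 2\<close>.\<close>

lemma sign_mat_col_add:
  assumes "k < n" "x k = 0"
  shows "sign_mat (col_add k x)"
proof -
  obtain e where e: "(1 :: 'r) = 2 * e" using two_unit by blast
  let ?E = "col_add k (\<lambda>i. e * x i)"
  have "unit_mat ?E"
    unfolding unit_mat_def using col_add_inverse[of k "\<lambda>i. e * x i"] assms by (auto intro!: bexI[of _ "col_add k (\<lambda>i. - (e * x i))"])
  moreover have "?E * ?E = col_add k x"
  proof -
    have half: "e * a + e * a = a" for a :: 'r
    proof -
      have "e * a + e * a = (2 * e) * a" by (simp add: mult.assoc)
      then show ?thesis by (simp flip: e)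
    qed
    show ?thesis using col_add_add[of k "\<lambda>i. e * x i" "\<lambda>i. e * x i"] assms unfolding half by simp
  qed
  ultimately show ?thesis using sign_mat_square by metis
qed

lemma multrow_carrier [simp]: "multrow_mat n k b \<in> carrier_mat n n"
  by (simp add: multrow_mat_def)

lemma multrow_mult:
  fixes b :: 'r
  assumes A: "A \<in> carrier_mat n n" and ij: "i < n" "j < n"
  shows "(multrow_mat n k b * A) $$ (i, j) = (if i = k then b else 1) * A $$ (i, j)"
proof -
  have "(multrow_mat n k b * A) $$ (i, j) = (\<Sum>l<n. if l = i then (if i = k then b else 1) * A $$ (l, j) else 0)"
    unfolding mult_entry[OF multrow_carrier A ij]
    by (intro sum.cong refl) (use ij in \<open>auto simp: multrow_mat_def\<close>)
  then show ?thesis using ij by simp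
qed

lemma multrow_inverse: "k < n \<Longrightarrow> b * b' = (1 :: 'r) \<Longrightarrow> multrow_mat n k b * multrow_mat n k b' = 1\<^sub>m n"
proof (rule eq_matI)
  fix i j assume "b * b' = 1" "i < dim_row (1\<^sub>m n)" "j < dim_col (1\<^sub>m n)"
  then show "(multrow_mat n k b * multrow_mat n k b') $$ (i, j) = 1\<^sub>m n $$ (i, j)"
    by (subst multrow_mult) (auto simp: multrow_mat_def)
qed (simp_all add: multrow_mat_def)

text \<open>Here \<open>delta_braid\<close> applies: the quotient of Gauss sums produces the quadratic character.\<close>

lemma sign_mat_multrow:
  assumes k: "k < n" and b: "b * b' = (1 :: 'r)"
  shows "sign_mat (multrow_mat n k b)"
proof -
  let ?a' = "\<lambda>i. if i = k then b else 1" and ?a = "\<lambda>i. if i = k then b' else 1"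
  have b': "b' * b = 1" using b by (simp add: mult.commute)
  have "unit_mat (multrow_mat n k b)"
    unfolding unit_mat_def using multrow_inverse[OF k b'] by (auto intro!: bexI[of _ "multrow_mat n k b'"])
  moreover have "levi_sign (multrow_mat n k b) = quad_char b"
  proof -
    have "act (multrow_mat n k b) y = scl ?a' y" for y
    proof (rule N_eqI[OF act_in scl_in])
      fix i assume i: "i < n"
      have "(\<Sum>j<n. multrow_mat n k b $$ (i, j) * B (u j) y) = (\<Sum>j<n. if j = i then ?a' j * B (u j) y else 0)"
        by (intro sum.cong refl) (use i in \<open>auto simp: multrow_mat_def\<close>)
      then show "B (u i) (act (multrow_mat n k b) y) = B (u i) (scl ?a' y)"
        using i by (simp add: u_act u_scl)
    qed
    then have "act (multrow_mat n k b) = scl ?a'" by blast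
    then have "1 = (\<Prod>i<n. quad_char (?a' i)) * levi_sign (multrow_mat n k b)"
      using delta_braid[of ?a ?a'] b' delta_fourier by (simp add: levi_sign_def)
    also have "(\<Prod>i<n. quad_char (?a' i)) = (\<Prod>i<n. if i = k then quad_char b else (1 :: complex))"
      by (intro prod.cong refl) (simp add: quad_char_1)
    also have "\<dots> = quad_char b" using k by simp
    finally have "quad_char b * levi_sign (multrow_mat n k b) = quad_char b * quad_char b"
      by (simp add: quad_char_square)
    moreover have "quad_char b \<noteq> (0 :: complex)" using quad_char_cases[of b] by auto
    ultimately show ?thesis by simp
  qed
  ultimately show ?thesis unfolding sign_mat_def det_multrow_mat[OF k] by blast
qed

text \<open>
  Gaussian elimination: if the columns before \<open>k\<close> are those of the identity, then column \<open>k\<close> has a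
  unit on or below the diagonal, because row \<open>k\<close> of the inverse vanishes before the diagonal and a
  sum of nonunits is not a unit.
\<close>

lemma unit_mat_sign_mat:
  assumes "unit_mat A" shows "sign_mat A"
proof -
  have "\<forall>A. unit_mat A \<longrightarrow> (\<forall>i<n. \<forall>j<n - l. A $$ (i, j) = (if i = j then 1 else 0)) \<longrightarrow> sign_mat A" if "l \<le> n" for l
    using that
  proof (induction l)
    case 0
    show ?case
    proof (intro allI impI)
      fix A assume "unit_mat A" "\<forall>i<n. \<forall>j<n - 0. A $$ (i, j) = (if i = j then 1 else 0)"
      then have "A = 1\<^sub>m n" by (intro eq_matI) (auto simp: unit_mat_def)
      then show "sign_mat A" using sign_mat_one by simp
    qed
  next
    case (Suc l)
    define k where "k = n - Suc l"
    have k: "k < n" and nl: "n - l = Suc k" using Suc.prems by (auto simp: k_def)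
    have IH: "sign_mat A" if "unit_mat A" "\<And>i j. i < n \<Longrightarrow> j \<le> k \<Longrightarrow> A $$ (i, j) = (if i = j then 1 else 0)" for A
      using Suc that by (simp add: nl less_Suc_eq_le)
    let ?id = "\<lambda>A. \<forall>i<n. \<forall>j<k. A $$ (i, j) = (if i = j then 1 else (0 :: 'r))"
    have pivot: "sign_mat A" if A: "unit_mat A" "?id A" and piv: "A $$ (k, k) dvd 1" for A
    proof -
      note cA = unit_mat_carrier[OF A(1)]
      obtain b where b: "1 = A $$ (k, k) * b" using piv by blast
      have b1: "b * A $$ (k, k) = 1" "A $$ (k, k) * b = 1" using b by (simp_all add: mult.commute)
      let ?D = "multrow_mat n k b" and ?x = "\<lambda>i. if i = k then 0 else - A $$ (i, k)"
      let ?L = "col_add k ?x"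
      have cDA: "?D * A \<in> carrier_mat n n" using cA mult_carrier_mat[OF multrow_carrier] by blast
      have uD: "unit_mat ?D" and uL: "unit_mat ?L"
        using sign_mat_multrow[OF k b1(1)] sign_mat_col_add[OF k, of ?x] by (simp_all add: sign_mat_def)
      have "sign_mat (?L * (?D * A))"
      proof (rule IH)
        show "unit_mat (?L * (?D * A))" by (intro unit_mat_mult uD uL A(1))
        fix i j assume ij: "i < n" "j \<le> k"
        then have j: "j < n" using k by simp
        have "(?L * (?D * A)) $$ (i, j) = (if i = k then b else 1) * A $$ (i, j) + ?x i * (b * A $$ (k, j))"
          unfolding col_add_mult[OF cDA k ij(1) j] multrow_mult[OF cA ij(1) j] multrow_mult[OF cA k j] by simp
        also have "\<dots> = (if i = j then 1 else 0)"
        proof (cases "j = k")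
          case True then show ?thesis using b1 by auto
        next
          case False
          then have "j < k" using ij by simp
          then have "A $$ (i, j) = (if i = j then 1 else 0)" "A $$ (k, j) = 0" using A(2) ij k by auto
          then show ?thesis using \<open>j < k\<close> by auto
        qed
        finally show "(?L * (?D * A)) $$ (i, j) = (if i = j then 1 else 0)" .
      qed
      then have "sign_mat (?D * A)"
        by (rule sign_mat_cancel[OF sign_mat_col_add[OF k] col_add_inverse[OF k] col_add_carrier cDA, rotated -1]) simp_all
      then show "sign_mat A"
        by (rule sign_mat_cancel[OF sign_mat_multrow[OF k b1(2)] multrow_inverse[OF k b1(2)] multrow_carrier cA])
    qed
    have "sign_mat A" if A: "unit_mat A" "?id A" for A
    proof (cases "A $$ (k, k) dvd 1")
      case True then show ?thesis using pivot A by blast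
    next
      case False
      note cA = unit_mat_carrier[OF A(1)]
      obtain C where C: "C \<in> carrier_mat n n" "C * A = 1\<^sub>m n" using A(1) unfolding unit_mat_def by blast
      have Cki: "C $$ (k, i) = 0" if "i < k" for i
      proof -
        have i: "i < n" using that k by simp
        have "(\<Sum>l<n. C $$ (k, l) * A $$ (l, i)) = 0"
          using mult_entry[OF C(1) cA k i] C(2) k i that by simp
        moreover have "(\<Sum>l<n. C $$ (k, l) * A $$ (l, i)) = (\<Sum>l<n. if l = i then C $$ (k, l) else 0)"
          by (intro sum.cong refl) (use A(2) that in auto)
        ultimately show ?thesis using i by simp
      qed
      have "\<exists>i<n. i > k \<and> A $$ (i, k) dvd 1"
      proof (rule ccontr)
        assume no: "\<not> ?thesis"
        have "\<not> C $$ (k, l) * A $$ (l, k) dvd 1" if "l < n" for l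
        proof (cases "l < k")
          case True then show ?thesis by (simp add: Cki)
        next
          case F: False
          then have "\<not> A $$ (l, k) dvd 1" using no False that by (cases "l = k") auto
          then show ?thesis by (simp add: unit_mult_iff)
        qed
        then have "\<not> (\<Sum>l<n. C $$ (k, l) * A $$ (l, k)) dvd 1" by (intro nonunit_sum) auto
        then show False using mult_entry[OF C(1) cA k k] C(2) k by simp
      qed
      then obtain i where i: "i < n" "i > k" "A $$ (i, k) dvd 1" by blast
      let ?x = "\<lambda>l. if l = k then 1 else 0 :: 'r"
      let ?L = "col_add i ?x"
      have xi: "?x i = 0" using i by simp
      have ent: "(?L * A) $$ (r, s) = A $$ (r, s) + ?x r * A $$ (i, s)" if "r < n" "s < n" for r s
        by (rule col_add_mult[OF cA i(1) that])
      have "sign_mat (?L * A)"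
      proof (rule pivot)
        show "unit_mat (?L * A)"
          using sign_mat_col_add[of i ?x, OF i(1) xi] A(1) by (intro unit_mat_mult) (simp_all add: sign_mat_def)
        show "?id (?L * A)"
        proof (intro allI impI)
          fix r s assume rs: "r < n" "s < k"
          then have "A $$ (i, s) = 0" using A(2) i by auto
          then show "(?L * A) $$ (r, s) = (if r = s then 1 else 0)" using ent[of r s] rs k A(2) by simp
        qed
        show "(?L * A) $$ (k, k) dvd 1"
          using ent[OF k k] unit_add_nonunit[OF i(3) False] by (simp add: add.commute)
      qed
      then show ?thesis
        by (rule sign_mat_cancel[OF sign_mat_col_add[OF i(1)] col_add_inverse[OF i(1)] col_add_carrier cA, rotated -1])
           (use i in auto)
    qed
    then show ?case by (simp add: k_def)
  qed
  from this[of n] show ?thesis using assms by simp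
qed

definition mat_on_N :: "('v \<Rightarrow> 'v) \<Rightarrow> 'r mat" where
  "mat_on_N g = mat n n (\<lambda>(i, j). B (u i) (g (v j)))"

lemma mat_on_N_carrier [simp]: "mat_on_N g \<in> carrier_mat n n"
  by (simp add: mat_on_N_def)

lemma inj_v: "inj_on v {..<n}"
proof (rule inj_onI)
  fix i j assume "i \<in> {..<n}" "j \<in> {..<n}" "v i = v j"
  then have "B (u i) (v i) = B (u i) (v j)" "i < n" "j < n" by auto
  then show "i = j" by (simp add: B_uv split: if_splits)
qed

lemma independent_v: "independent (v ` {..<n})"
proof (rule independent_mono)
  show "independent (case_sum u v ` ({..<n} <+> {..<n}))"
    using basis unfolding symplectic_basis_def basis_family_def by blast
  show "v ` {..<n} \<subseteq> case_sum u v ` ({..<n} <+> {..<n})"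
    by (auto simp: image_iff intro!: bexI[of _ "Inr _"])
qed

lemma representation_v:
  assumes x: "x \<in> N" and i: "i < n"
  shows "representation (v ` {..<n}) x (v i) = B (u i) x"
proof -
  let ?r = "representation (v ` {..<n}) x"
  have "(\<Sum>b\<in>v ` {..<n}. ?r b *s b) = x"
    by (rule sum_representation_eq[OF independent_v]) (use x in \<open>auto simp: N_def\<close>)
  then have "x = (\<Sum>j<n. ?r (v j) *s v j)" by (simp add: sum.reindex[OF inj_v])
  then have "B (u i) x = B (u i) (\<Sum>j<n. ?r (v j) *s v j)" by simp
  then show ?thesis by (simp only: u_sum[OF i])
qed

lemma stab_in:
  assumes "g \<in> Sp_stab scale B M N"
  shows "g \<in> Spc" "x \<in> N \<Longrightarrow> g x \<in> N" "x \<in> M \<Longrightarrow> g x \<in> M"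
  using assms unfolding Sp_stab_def by auto

lemma det_on_span_eq:
  assumes "g \<in> Sp_stab scale B M N"
  shows "det_on_span scale n v g = det (mat_on_N g)"
  unfolding det_on_span_def mat_on_N_def
  by (rule arg_cong[where f = det], rule cong_mat) (auto intro!: representation_v stab_in(2)[OF assms] v_in)

lemma act_mat_on_N:
  assumes g: "g \<in> Spc" "\<And>x. x \<in> N \<Longrightarrow> g x \<in> N" and y: "y \<in> N"
  shows "act (mat_on_N g) y = g y"
proof (rule N_eqI[OF act_in g(2)[OF y]])
  fix i assume i: "i < n"
  have "g y = (\<Sum>j<n. B (u j) y *s g (v j))"
    using prN_of_N[OF y] Sp_sum[OF g(1), of "\<lambda>j. B (u j) y *s v j" "{..<n}"] by (simp add: prN_def Sp_scale[OF g(1)])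
  then have "B (u i) (g y) = (\<Sum>j<n. B (u j) y * B (u i) (g (v j)))"
    by (simp add: B_sum_right B_scale_right)
  also have "\<dots> = (\<Sum>j<n. mat_on_N g $$ (i, j) * B (u j) y)"
    by (intro sum.cong refl) (use i in \<open>simp add: mat_on_N_def mult.commute\<close>)
  finally show "B (u i) (act (mat_on_N g) y) = B (u i) (g y)" by (simp add: u_act[OF i])
qed

lemma Sp_inv: "g \<in> Spc \<Longrightarrow> inv_into UNIV g \<in> Spc"
proof -
  assume g: "g \<in> Spc"
  have gi: "g (inv_into UNIV g x) = x" for x using Sp_surj[OF g] by (rule surj_f_inv_f)
  have "B (inv_into UNIV g x) (inv_into UNIV g y) = B x y" for x y
    using Sp_B[OF g, of "inv_into UNIV g x" "inv_into UNIV g y"] gi by simp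
  moreover have "module_hom scale scale (inv_into UNIV g)"
    using g module_pair.bij_module_hom_imp_inv_module_hom[OF module_pair.intro[OF module_scale module_scale]]
    unfolding Sp_carrier by blast
  ultimately show ?thesis using g unfolding Sp_carrier by (simp add: bij_imp_bij_inv)
qed

lemma unit_mat_on_N:
  assumes g: "g \<in> Sp_stab scale B M N"
  shows "unit_mat (mat_on_N g)"
proof -
  note gS = stab_in(1)[OF g]
  have hN: "inv_into UNIV g x \<in> N" if "x \<in> N" for x
  proof -
    have "x \<in> g ` N" using g that by (simp add: Sp_stab_def)
    then show ?thesis using inv_f_f[OF Sp_inj[OF gS]] by auto
  qed
  have "mat_on_N (inv_into UNIV g) * mat_on_N g = 1\<^sub>m n"
  proof (rule eq_matI)
    fix i j assume "i < dim_row (1\<^sub>m n)" "j < dim_col (1\<^sub>m n)"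
    then have ij: "i < n" "j < n" by simp_all
    have "(mat_on_N (inv_into UNIV g) * mat_on_N g) $$ (i, j) = (\<Sum>k<n. mat_on_N (inv_into UNIV g) $$ (i, k) * B (u k) (g (v j)))"
      unfolding mult_entry[OF mat_on_N_carrier mat_on_N_carrier ij]
      by (intro sum.cong refl) (use ij in \<open>simp add: mat_on_N_def\<close>)
    also have "\<dots> = B (u i) (act (mat_on_N (inv_into UNIV g)) (g (v j)))" by (simp add: u_act ij)
    also have "\<dots> = B (u i) (v j)"
      using act_mat_on_N[OF Sp_inv[OF gS] hN stab_in(2)[OF g v_in[OF ij(2)]]] inv_f_f[OF Sp_inj[OF gS]] by simp
    finally show "(mat_on_N (inv_into UNIV g) * mat_on_N g) $$ (i, j) = 1\<^sub>m n $$ (i, j)" using ij by (simp add: B_uv)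
  qed (simp_all add: mat_on_N_def)
  then show ?thesis unfolding unit_mat_def using mat_on_N_carrier by blast
qed

definition levi_op :: "('v \<Rightarrow> 'v) \<Rightarrow> complex mat" where
  "levi_op g = quad_char (det_on_span scale n v g) \<cdot>\<^sub>m op (perm g)"

lemma weil_levi:
  assumes g: "g \<in> Sp_stab scale B M N"
  shows "weil g (levi_op g)"
proof -
  note gS = stab_in(1)[OF g]
  let ?c = "quad_char (det_on_span scale n v g)"
  have c: "?c \<noteq> (0 :: complex)" using quad_char_cases[of "det_on_span scale n v g"] by auto
  have pg: "op (perm g) = op (perm (act (mat_on_N g)))"
    using act_mat_on_N[OF gS stab_in(2)[OF g]] by (intro op_cong) (simp add: perm_def)
  have r: "regular (op (perm g))"
    unfolding pg by (rule regular_perm[OF bij_act[OF unit_mat_on_N[OF g]] act_minus])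
  have "delta (op (perm g)) = ?c"
    using unit_mat_sign_mat[OF unit_mat_on_N[OF g]] unfolding sign_mat_def levi_sign_def det_on_span_eq[OF g] pg by blast
  then have d: "delta (levi_op g) = 1"
    unfolding levi_op_def by (simp add: delta_smult r c quad_char_square)
  have "op (perm g) * heis x = heis (g x) * op (perm g)" for x
  proof -
    have pr: "prN (g x) = g (prN x)"
    proof -
      have "g x = g (prM x) + g (prN x)" using decomp[of x] Sp_add[OF gS, of "prM x" "prN x"] by simp
      then show ?thesis
        using prN_add[of "g (prM x)" "g (prN x)"] prN_of_M[OF stab_in(3)[OF g prM_in]] prN_of_N[OF stab_in(2)[OF g prN_in]]
        by simp
    qed
    have gi: "g (inv_into UNIV g z) = z" "inv_into UNIV g (g z) = z" for z
      using surj_f_inv_f[OF Sp_surj[OF gS]] inv_f_f[OF Sp_inj[OF gS]] by auto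
    have hN: "inv_into UNIV g z \<in> N" if "z \<in> N" for z
    proof -
      have "z \<in> g ` N" using g that by (simp add: Sp_stab_def)
      then show ?thesis using gi by auto
    qed
    have "op (perm g) * heis x = op (\<lambda>z y. if inv_into UNIV g z = y + prN x then lam (B x (y + inv_into UNIV g z)) else 0)"
      unfolding heis_def by (rule perm_mult) (simp_all add: gi hN)
    also have "\<dots> = op (\<lambda>z y. if z = g y + prN (g x) then lam (B (g x) (g y + z)) else 0)"
    proof (rule op_cong)
      fix z y
      have "inv_into UNIV g z = y + prN x \<longleftrightarrow> z = g y + prN (g x)"
        unfolding pr Sp_add[OF gS, symmetric] using gi by metis
      moreover have "B x (y + inv_into UNIV g z) = B (g x) (g y + z)"
        using Sp_B[OF gS, of x "y + inv_into UNIV g z"] by (simp add: Sp_add[OF gS] gi)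
      ultimately show "(if inv_into UNIV g z = y + prN x then lam (B x (y + inv_into UNIV g z)) else 0)
          = (if z = g y + prN (g x) then lam (B (g x) (g y + z)) else 0)" by (simp only:)
    qed
    also have "\<dots> = heis (g x) * op (perm g)"
      unfolding heis_def by (rule mult_perm[symmetric]) (rule stab_in(2)[OF g])
    finally show ?thesis .
  qed
  then have "levi_op g * heis x = heis (g x) * levi_op g" for x
    unfolding levi_op_def
    by (simp add: mult_smult_assoc_mat[of _ m m _ m] mult_smult_distrib[of _ m m _ m])
  then show ?thesis unfolding weil_def using d r c by (simp add: levi_op_def regular_smult)
qed

end

section \<open>The representation\<close>

locale weil_space = symplectic_space lam scale B n u v
  for lam :: "'r::{finite, comm_ring_1} \<Rightarrow> complex"
    and scale :: "'r \<Rightarrow> 'v::ab_group_add \<Rightarrow> 'v" (infixr "*s" 75)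
    and B :: "'v \<Rightarrow> 'v \<Rightarrow> 'r" and n :: nat and u v :: "nat \<Rightarrow> 'v" +
  fixes scaleX :: "complex \<Rightarrow> 'x::ab_group_add \<Rightarrow> 'x" (infixr "*x" 75)
    and e :: "'v \<Rightarrow> 'x"
  assumes vector_space_X: "vector_space scaleX"
    and basis_X: "basis_family scaleX N e"
begin

sublocale X: vector_space scaleX by (rule vector_space_X)

lemma inj_e: "inj_on e N" and independent_e: "X.independent (e ` N)" and span_e: "X.span (e ` N) = UNIV"
  using basis_X unfolding basis_family_def by blast+

definition coord :: "'x \<Rightarrow> 'v \<Rightarrow> complex" where "coord z y = X.representation (e ` N) z (e y)"

lemma coord_expand: "(\<Sum>y\<in>N. coord z y *x e y) = z"
proof -
  have "(\<Sum>b\<in>e ` N. X.representation (e ` N) z b *x b) = z"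
    by (rule X.sum_representation_eq[OF independent_e]) (auto simp: span_e finite_N)
  then show ?thesis by (simp add: sum.reindex[OF inj_e] coord_def)
qed

lemma coord_add: "coord (z + w) y = coord z y + coord w y"
  unfolding coord_def by (subst X.representation_add[OF independent_e]) (simp_all add: span_e)

lemma coord_scale: "coord (a *x z) y = a * coord z y"
  using X.representation_scale[OF independent_e, of z a] by (simp add: coord_def span_e)

lemma coord_zero: "coord 0 y = 0"
  by (simp add: coord_def X.representation_zero)

lemma coord_sum: "finite A \<Longrightarrow> coord (sum f A) y = (\<Sum>i\<in>A. coord (f i) y)"
  by (induction A rule: finite_induct) (simp_all add: coord_add coord_zero)

lemma coord_basis: "x \<in> N \<Longrightarrow> y \<in> N \<Longrightarrow> coord (e x) y = (if y = x then 1 else 0)"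
  using X.representation_basis[OF independent_e, of "e x"] inj_onD[OF inj_e, of y x] by (auto simp: coord_def)

lemma coord_combination: "y \<in> N \<Longrightarrow> coord (\<Sum>x\<in>N. c x *x e x) y = c y"
proof -
  assume y: "y \<in> N"
  have "coord (\<Sum>x\<in>N. c x *x e x) y = (\<Sum>x\<in>N. if x = y then c x else 0)"
    unfolding coord_sum[OF finite_N] by (intro sum.cong refl) (use y in \<open>auto simp: coord_scale coord_basis\<close>)
  then show ?thesis using y by (simp add: finite_N)
qed

text \<open>The linear map on \<open>X\<close> that a matrix over the enumerated set \<open>N\<close> describes in the basis \<open>e\<close>.\<close>

definition to_map :: "complex mat \<Rightarrow> 'x \<Rightarrow> 'x" where
  "to_map A z = (\<Sum>x\<in>N. (\<Sum>y\<in>N. A $$ (idx x, idx y) * coord z y) *x e x)"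

lemma coord_to_map: "x \<in> N \<Longrightarrow> coord (to_map A z) x = (\<Sum>y\<in>N. A $$ (idx x, idx y) * coord z y)"
  unfolding to_map_def by (rule coord_combination)

lemma to_map_basis: "y \<in> N \<Longrightarrow> to_map (op K) (e y) = (\<Sum>x\<in>N. K x y *x e x)"
proof -
  assume y: "y \<in> N"
  have "(\<Sum>w\<in>N. op K $$ (idx x, idx w) * coord (e y) w) = K x y" if x: "x \<in> N" for x
  proof -
    have "(\<Sum>w\<in>N. op K $$ (idx x, idx w) * coord (e y) w) = (\<Sum>w\<in>N. if w = y then K x w else 0)"
      by (intro sum.cong refl) (use x y in \<open>simp add: op_entry coord_basis\<close>)
    then show ?thesis using y by (simp add: finite_N)
  qed
  then show ?thesis unfolding to_map_def by (intro sum.cong refl) simp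
qed

lemma linear_to_map: "Vector_Spaces.linear scaleX scaleX (to_map A)"
proof (rule Vector_Spaces.linear.intro[OF vector_space_X vector_space_X], rule module_hom.intro)
  show "Modules.module scaleX" by (rule X.module_axioms)
  show "Modules.module scaleX" by (rule X.module_axioms)
  show "module_hom_axioms scaleX scaleX (to_map A)"
  proof
    show "to_map A (z + w) = to_map A z + to_map A w" for z w
      by (simp add: to_map_def coord_add distrib_left sum.distrib X.scale_left_distrib)
    show "to_map A (a *x z) = a *x to_map A z" for a z
      unfolding to_map_def X.scale_sum_right
      by (intro sum.cong refl) (simp add: coord_scale sum_distrib_left mult.left_commute)
  qed
qed

lemma to_map_mult:
  assumes "A \<in> carrier_mat m m" "C \<in> carrier_mat m m"
  shows "to_map (A * C) = to_map A \<circ> to_map C"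
proof
  fix z
  obtain K L where KL: "A = op K" "C = op L" using op_surj assms by blast
  have "(\<Sum>y\<in>N. (A * C) $$ (idx x, idx y) * coord z y) = (\<Sum>w\<in>N. A $$ (idx x, idx w) * coord (to_map C z) w)"
    if x: "x \<in> N" for x
  proof -
    have "(\<Sum>y\<in>N. (A * C) $$ (idx x, idx y) * coord z y) = (\<Sum>y\<in>N. (\<Sum>w\<in>N. K x w * L w y) * coord z y)"
      unfolding KL op_mult by (intro sum.cong refl) (simp add: x op_entry)
    also have "\<dots> = (\<Sum>w\<in>N. K x w * (\<Sum>y\<in>N. L w y * coord z y))"
      unfolding sum_distrib_left sum_distrib_right by (subst sum.swap) (simp add: mult.assoc)
    also have "\<dots> = (\<Sum>w\<in>N. A $$ (idx x, idx w) * coord (to_map C z) w)"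
      unfolding KL by (intro sum.cong refl) (simp add: coord_to_map x op_entry)
    finally show ?thesis .
  qed
  then show "to_map (A * C) z = (to_map A \<circ> to_map C) z"
    unfolding comp_def to_map_def[of "A * C"] to_map_def[of A] by (intro sum.cong refl) simp
qed

lemma to_map_one: "to_map (1\<^sub>m m) = id"
proof
  fix z
  have "(\<Sum>y\<in>N. 1\<^sub>m m $$ (idx x, idx y) * coord z y) = coord z x" if x: "x \<in> N" for x
  proof -
    have "(\<Sum>y\<in>N. 1\<^sub>m m $$ (idx x, idx y) * coord z y) = (\<Sum>y\<in>N. if y = x then coord z y else 0)"
      unfolding op_one[symmetric] by (intro sum.cong refl) (use x in \<open>simp add: op_entry diag_def\<close>)
    then show ?thesis using x by (simp add: finite_N)
  qed
  then have "to_map (1\<^sub>m m) z = (\<Sum>x\<in>N. coord z x *x e x)" unfolding to_map_def by (intro sum.cong refl) simp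
  then show "to_map (1\<^sub>m m) z = id z" by (simp add: coord_expand)
qed

lemma to_map_GL:
  assumes "regular A" shows "to_map A \<in> carrier (GL scaleX)"
proof -
  obtain C where C: "C \<in> carrier_mat m m" "A * C = 1\<^sub>m m" "C * A = 1\<^sub>m m"
    using inverse_mat[OF regular_carrier[OF assms]] assms unfolding regular_def by blast
  have "to_map A \<circ> to_map C = id" "to_map C \<circ> to_map A = id"
    using to_map_mult[OF regular_carrier[OF assms] C(1)] to_map_mult[OF C(1) regular_carrier[OF assms]]
    by (simp_all add: C to_map_one)
  then have "bij (to_map A)" by (rule o_bij[rotated])
  then show ?thesis by (simp add: GL_def linear_to_map)
qed

lemma linear_determined:
  assumes "f \<in> carrier (GL scaleX)" "h \<in> carrier (GL scaleX)" "\<And>x. x \<in> N \<Longrightarrow> f (e x) = h (e x)"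
  shows "f = h"
proof
  fix z
  have f: "module_hom scaleX scaleX f" and h: "module_hom scaleX scaleX h"
    using assms(1,2) unfolding GL_def Vector_Spaces.linear_def by simp_all
  have "f (\<Sum>y\<in>N. coord z y *x e y) = h (\<Sum>y\<in>N. coord z y *x e y)"
    unfolding module_hom.sum[OF f] module_hom.sum[OF h] module_hom.scale[OF f] module_hom.scale[OF h]
    by (intro sum.cong refl) (simp add: assms(3))
  then show "f z = h z" unfolding coord_expand .
qed

lemma the_weil: "weil g A \<Longrightarrow> (THE A. weil g A) = A"
  using weil_unique by blast

definition W :: "('v \<Rightarrow> 'v) \<Rightarrow> 'x \<Rightarrow> 'x" where
  "W = restrict (\<lambda>g. to_map (THE A. weil g A)) Spc"

lemma W_eq: "g \<in> Spc \<Longrightarrow> weil g A \<Longrightarrow> W g = to_map A"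
  by (simp add: W_def the_weil)

lemma W_hom: "W \<in> hom (Sp scale B) (GL scaleX)"
  unfolding hom_def
proof (intro CollectI conjI ballI Pi_I)
  fix g assume g: "g \<in> Spc"
  obtain A where A: "weil g A" using weil_exists[OF g] by blast
  then show "W g \<in> carrier (GL scaleX)"
    using W_eq[OF g A] to_map_GL[of A] by (simp add: weil_def)
  fix h assume h: "h \<in> Spc"
  obtain C where C: "weil h C" using weil_exists[OF h] by blast
  have "W (g \<circ> h) = to_map (A * C)" by (rule W_eq[OF Sp_comp[OF g h] weil_mult[OF A C]])
  then show "W (g \<otimes>\<^bsub>Sp scale B\<^esub> h) = W g \<otimes>\<^bsub>GL scaleX\<^esub> W h"
    using W_eq[OF g A] W_eq[OF h C] to_map_mult[OF weil_carrier[OF A] weil_carrier[OF C]]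
    by (simp add: GL_def)
qed

lemma W_levi:
  assumes g: "g \<in> Sp_stab scale B M N" and x: "x \<in> N"
  shows "W g (e x) = quad_char (det_on_span scale n v g) *x e (g x)"
proof -
  let ?c = "quad_char (det_on_span scale n v g)"
  have "W g (e x) = to_map (op (\<lambda>z y. ?c * perm g z y)) (e x)"
    using W_eq[OF stab_in(1)[OF g] weil_levi[OF g]] by (simp add: levi_op_def op_smult)
  also have "\<dots> = (\<Sum>z\<in>N. if z = g x then ?c *x e z else 0)"
    unfolding to_map_basis[OF x] by (intro sum.cong refl) (simp add: perm_def)
  also have "\<dots> = ?c *x e (g x)" using stab_in(2)[OF g x] by (simp add: finite_N)
  finally show ?thesis .
qed

lemma W_fix:
  assumes t: "t \<in> Sp_fix scale B M" and x: "x \<in> N"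
  shows "W t (e x) = lam (B (t x) x) *x e x"
proof -
  have "W t (e x) = to_map (fix_op t) (e x)" using W_eq[OF Sp_fix_subset[OF t] weil_fix[OF t]] by simp
  also have "\<dots> = (\<Sum>z\<in>N. if z = x then lam (B (t x) x) *x e z else 0)"
    unfolding fix_op_def to_map_basis[OF x] by (intro sum.cong refl) (simp add: diag_def)
  finally show ?thesis using x by (simp add: finite_N)
qed

lemma W_flip:
  assumes x: "x \<in> N"
  shows "W (sp_flip scale B n u v) (e x) = inverse (gauss_sum lam ^ n) *x
    (\<Sum>w\<in>N. lam (- 2 * (\<Sum>i<n. B (u i) w * B (u i) x)) *x e w)"
proof -
  have "W (sp_flip scale B n u v) (e x) = to_map fourier (e x)"
    using W_eq[OF flip_in_Sp weil_flip] by (simp add: sp_flip_eq)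
  then show ?thesis
    unfolding fourier_def to_map_basis[OF x] X.scale_sum_right by (simp add: dot_def gauss_const_def)
qed

theorem weil_representation:
  "\<exists>!W. W \<in> hom (Sp scale B) (GL scaleX) \<inter> extensional Spc \<and>
    (\<forall>g \<in> Sp_stab scale B M N. \<forall>x \<in> N. W g (e x) = quad_char (det_on_span scale n v g) *x e (g x)) \<and>
    (\<forall>g \<in> Sp_fix scale B M. \<forall>x \<in> N. W g (e x) = lam (B (g x) x) *x e x) \<and>
    (\<forall>x \<in> N. W (sp_flip scale B n u v) (e x) = inverse (gauss_sum lam ^ n) *x
      (\<Sum>w\<in>N. lam (- 2 * (\<Sum>i<n. B (u i) w * B (u i) x)) *x e w))"
  (is "\<exists>!W. ?P W")
proof (rule ex1I[of _ W])
  have "W \<in> extensional Spc" by (simp add: W_def)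
  then show "?P W" using W_hom W_levi W_fix W_flip by blast
  fix W' assume W': "?P W'"
  then have hom': "W' \<in> hom (Sp scale B) (GL scaleX)" and ext': "W' \<in> extensional Spc" by simp_all
  have GL': "W' g \<in> carrier (GL scaleX)" and GL: "W g \<in> carrier (GL scaleX)" if "g \<in> Spc" for g
    using hom' W_hom that unfolding hom_def by blast+
  have "W' g = W g" if "g \<in> Spc" for g
  proof (rule Sp_induct[where Q = "\<lambda>g. W' g = W g", OF _ _ _ that])
    fix t assume t: "t \<in> Sp_fix scale B M"
    show "W' t = W t"
      by (rule linear_determined[OF GL'[OF Sp_fix_subset[OF t]] GL[OF Sp_fix_subset[OF t]]])
         (use W' W_fix t in simp)
  next
    show "W' flip = W flip"
      by (rule linear_determined[OF GL'[OF flip_in_Sp] GL[OF flip_in_Sp]])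
         (use W' W_flip in \<open>simp add: sp_flip_eq\<close>)
  next
    fix g h assume gh: "g \<in> Spc" "h \<in> Spc" "W' g = W g" "W' h = W h"
    then show "W' (g \<circ> h) = W (g \<circ> h)"
      using hom_mult[OF hom' gh(1,2)] hom_mult[OF W_hom gh(1,2)] by simp
  qed
  then show "W' = W"
    using ext' by (intro extensionalityI[of _ Spc]) (auto simp: W_def)
qed

end

theorem theorem6p1:
  fixes lam :: "'r::{finite, comm_ring_1} \<Rightarrow> complex"
    and scale :: "'r \<Rightarrow> 'v::ab_group_add \<Rightarrow> 'v"
    and B :: "'v \<Rightarrow> 'v \<Rightarrow> 'r"
    and n :: nat
    and u v :: "nat \<Rightarrow> 'v"
    and M N :: "'v set"
    and scaleX :: "complex \<Rightarrow> 'x::ab_group_add \<Rightarrow> 'x"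
    and e :: "'v \<Rightarrow> 'x"
  assumes local_ring: "\<exists>!I :: 'r set. max_ideal I"
    and two_unit: "(2 :: 'r) dvd 1"
    and min_ideal: "\<exists>!I :: 'r set. min_ideal I"
    and lam: "additive_char lam" "primitive_char lam"
    and n: "n \<ge> 1"
    and V: "Modules.module scale" "\<exists>b :: nat \<Rightarrow> 'v. basis_family scale {..<2 * n} b"
    and B: "alternating_form scale B" "nondegenerate_form scale B"
    and basis: "symplectic_basis scale B n u v"
    and M: "M = Modules.module.span scale (u ` {..<n})"
    and N: "N = Modules.module.span scale (v ` {..<n})"
    and X: "vector_space scaleX" "basis_family scaleX N e"
    and q: "card (residue_field :: 'r set set) > 3"
  shows "\<exists>!W. W \<in> hom (Sp scale B) (GL scaleX) \<inter> extensional (carrier (Sp scale B)) \<and>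
    (\<forall>g \<in> Sp_stab scale B M N. \<forall>x \<in> N.
       W g (e x) = scaleX (quad_char (det_on_span scale n v g)) (e (g x))) \<and>
    (\<forall>g \<in> Sp_fix scale B M. \<forall>x \<in> N.
       W g (e x) = scaleX (lam (B (g x) x)) (e x)) \<and>
    (\<forall>x \<in> N.
       W (sp_flip scale B n u v) (e x) =
         scaleX (inverse (gauss_sum lam ^ n))
           (\<Sum>w\<in>N. scaleX (lam (- 2 * (\<Sum>i<n. B (u i) w * B (u i) x))) (e w)))"
proof -
  interpret S: symplectic_space lam scale B n u v
    by (intro symplectic_space.intro finite_local_ring.intro symplectic_space_axioms.intro)
       (fact local_ring two_unit min_ideal lam V(1) B(1) basis)+
  have MN: "M = S.M" "N = S.N" by (simp_all add: M N S.M_def S.N_def)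
  interpret weil_space lam scale B n u v scaleX e
    by (intro weil_space.intro S.symplectic_space_axioms weil_space_axioms.intro)
       (fact X(1) X(2)[unfolded MN])+
  show ?thesis unfolding MN by (rule weil_representation)
qed

end
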